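(* Let $X\subseteq H_0^1(\Omega)$ be a closed subspace, let $\epsilon=(\epsilon_-,\epsilon_+)$ with $0<\epsilon_-<1<\epsilon_+<\infty$, let $u^0\in X$, and let $\{u^n\}_n\subset X$ be the sequence generated by the damped Kačanov scheme $$u^{n+1}=u^n-\delta(u^n)\,\mathsf{A}_\epsilon[u^n]^{-1}\mathsf{F}_\epsilon(u^n),\qquad n\ge 0,$$ with damping factors $\delta(u^n)>0$. If there is a constant $\delta_{\min}>0$ with $\delta(u^n)\ge\delta_{\min}$ for all $n\in\mathbb{N}$, and if there is a constant $\gamma>0$ independent of $n$ such that $$\mathsf{E}_\epsilon(u^n)-\mathsf{E}_\epsilon(u^{n+1})\ \ge\ \gamma\,\|\nabla(u^{n+1}-u^n)\|_{L^2(\Omega)}^2\qquad\text{for all } n\in\mathbb{N},$$ then $\{u^n\}_n$ converges in $X$ (with respect to the norm $\|\nabla\cdot\|_{L^2(\Omega)}$) to the unique minimiser $u_{X,\epsilon}^\star$ of $\mathsf{E}_\epsilon$ in $X$. In particular, this convergence holds if there are constants $\delta_{\min},\delta_{\max}$ with $$0<\delta_{\min}\le\delta(u^n)\le\delta_{\max}<\frac{2\mu_{\epsilon,-}}{\sqrt{3}\,\xi'_{\epsilon,+}}\qquad\text{for all } n\in\mathbb{N}.$$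
   Context: Setting: $\Omega\subset\mathbb{R}^d$, $d\in\{2,3\}$, is open and bounded with Lipschitz boundary. $C_+(\overline\Omega)=\{g\in C(\overline\Omega):\inf_{\overline\Omega} g>1\}$. The exponent $p\in C_+(\overline\Omega)$ is given, $p_-=\inf_{\overline\Omega}p$, $p_+=\sup_{\overline\Omega}p$. $H_0^1(\Omega)$ is endowed with the norm $\|\nabla u\|_{L^2(\Omega)}$. Source: $f\in L^{\alpha(\cdot)}(\Omega)$, i.e. $f$ is measurable with $\int_\Omega|f(x)|^{\alpha(x)}\,dx<\infty$, where $\alpha\in C_+(\overline\Omega)$ and $\alpha_-:=\min_{\overline\Omega}\alpha$ satisfies $\alpha_->1$ if $d=2$ and $\alpha_-\ge 6/5$ if $d=3$. Relaxed coefficient: for $x\in\Omega$, $t\ge0$, $$\mu_\epsilon(x,t)=\begin{cases}\epsilon_-^{p(x)-2}& t<\epsilon_-^2,\\ t^{(p(x)-2)/2}&\epsilon_-^2\le t\le\epsilon_+^2,\\ \epsilon_+^{p(x)-2}&t>\epsilon_+^2.\end{cases}$$ Relaxed energy: $\mathsf{E}_\epsilon(u)=\int_\Omega\varphi_\epsilon(x,|\nabla u|^2)\,dx-\int_\Omega fu\,dx$ for $u\in X$, where $$\varphi_\epsilon(x,t)=\begin{cases}\frac12\epsilon_-^{p(x)-2}t+\left(\frac1{p(x)}-\frac12\right)\epsilon_-^{p(x)}&0\le t<\epsilon_-^2,\\ \frac1{p(x)}t^{p(x)/2}&\epsilon_-^2\le t\le\epsilon_+^2,\\ \frac12\epsilon_+^{p(x)-2}t+\left(\frac1{p(x)}-\frac12\right)\epsilon_+^{p(x)}&t>\epsilon_+^2.\end{cases}$$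 This functional has a unique global minimiser $u_{X,\epsilon}^\star$ in $X$. Operators: for $u,v,w\in X$, $\mathsf{A}_\epsilon[u](v)(w)=\int_\Omega\mu_\epsilon(x,|\nabla u|^2)\nabla v\cdot\nabla w\,dx$. For fixed $u\in X$, $\mathsf{A}_\epsilon[u]:X\to X'$ is linear and invertible ($X'$ is the dual of $X$). Let $\ell_f(v)=\int_\Omega fv\,dx$ and $\mathsf{F}_\epsilon(u)=\mathsf{A}_\epsilon[u](u)-\ell_f\in X'$. Equivalently, the scheme reads $\mathsf{A}_\epsilon[u^n](u^{n+1}-u^n)=-\delta(u^n)\mathsf{F}_\epsilon(u^n)$ in $X'$. Constants: $\mu_{\epsilon,-}:=\min\{\epsilon_-^{p_+-2},\epsilon_+^{p_--2}\}$. Let $\xi_\epsilon(x,t)=\mu_\epsilon(x,t^2)t$ for $x\in\Omega$, $t\ge0$, and let $\xi_\epsilon'$ denote its derivative with respect to $t$, i.e. $\xi_\epsilon'(x,t)=\epsilon_-^{p(x)-2}$ for $t<\epsilon_-$, $\xi_\epsilon'(x,t)=(p(x)-1)t^{p(x)-2}$ for $\epsilon_-<t<\epsilon_+$, $\xi'_\epsilon(x,t)=\epsilon_+^{p(x)-2}$ for $t>\epsilon_+$, extended by $\xi_\epsilon'(x,\epsilon_\pm):=(p(x)-1)\epsilon_\pm^{p(x)-2}$. Then $\xi'_{\epsilon,+}:=\sup_{(x,t)\in\Omega\times[0,\infty)}\xi_\epsilon'(x,t)<\infty$. *)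

theory Defs
  imports "HOL-Analysis.Analysis"
begin

text \<open>
  Locally, after a rigid change of coordinates whose last axis is \<open>e\<close>, the set is the region
  strictly above the graph of a Lipschitz function \<open>\<gamma>\<close> of the remaining \<open>d - 1\<close> coordinates,
  that is, of the component of the point orthogonal to \<open>e\<close>.
\<close>
definition lipschitz_boundary :: "'a::euclidean_space set \<Rightarrow> bool" where
  "lipschitz_boundary \<Omega> \<longleftrightarrow>
     (\<forall>z\<in>frontier \<Omega>. \<exists>r>0. \<exists>e L \<gamma>. norm e = 1 \<and> L-lipschitz_on {y. y \<bullet> e = 0} \<gamma> \<and>
        \<Omega> \<inter> ball z r = {x \<in> ball z r. \<gamma> (x - (x \<bullet> e) *\<^sub>R e) < x \<bullet> e})"

definition C_plus :: "'a::topological_space set \<Rightarrow> ('a \<Rightarrow> real) set" where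
  "C_plus K = {g. continuous_on K g \<and> (INF x\<in>K. g x) > 1}"

text \<open>The variable exponent Lebesgue space, defined by finiteness of the modular.\<close>
definition L_var :: "'a::euclidean_space set \<Rightarrow> ('a \<Rightarrow> real) \<Rightarrow> ('a \<Rightarrow> real) set" where
  "L_var \<Omega> \<alpha> = {f \<in> borel_measurable (lebesgue_on \<Omega>).
     integrable (lebesgue_on \<Omega>) (\<lambda>x. \<bar>f x\<bar> powr \<alpha> x)}"

text \<open>
  Elements of \<open>L\<^sup>2\<close> and of the Sobolev spaces are represented by total functions; only the values
  on \<open>\<Omega>\<close> matter, and equality in the space is equality almost everywhere on \<open>\<Omega>\<close>.
\<close>

definition L2_space :: "'a::euclidean_space set \<Rightarrow> ('a \<Rightarrow> 'b::euclidean_space) set" where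
  "L2_space \<Omega> = {g \<in> borel_measurable (lebesgue_on \<Omega>).
     integrable (lebesgue_on \<Omega>) (\<lambda>x. (norm (g x))\<^sup>2)}"

definition L2_norm :: "'a::euclidean_space set \<Rightarrow> ('a \<Rightarrow> 'b::euclidean_space) \<Rightarrow> real" where
  "L2_norm \<Omega> g = sqrt (LINT x|lebesgue_on \<Omega>. (norm (g x))\<^sup>2)"

definition locally_integrable ::
    "'a::euclidean_space set \<Rightarrow> ('a \<Rightarrow> 'b::euclidean_space) \<Rightarrow> bool" where
  "locally_integrable \<Omega> g \<longleftrightarrow> (\<forall>K. compact K \<and> K \<subseteq> \<Omega> \<longrightarrow> integrable (lebesgue_on K) g)"

primrec Ck :: "nat \<Rightarrow> ('a::euclidean_space \<Rightarrow> real) \<Rightarrow> bool" where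
  "Ck 0 g \<longleftrightarrow> continuous_on UNIV g"
| "Ck (Suc k) g \<longleftrightarrow>
     g differentiable_on UNIV \<and> (\<forall>b\<in>Basis. Ck k (\<lambda>x. frechet_derivative g (at x) b))"

definition test_functions :: "'a::euclidean_space set \<Rightarrow> ('a \<Rightarrow> real) set" where
  "test_functions \<Omega> = {\<phi>. (\<forall>k. Ck k \<phi>) \<and>
     compact (closure {x. \<phi> x \<noteq> 0}) \<and> closure {x. \<phi> x \<noteq> 0} \<subseteq> \<Omega>}"

definition is_weak_gradient ::
    "'a::euclidean_space set \<Rightarrow> ('a \<Rightarrow> real) \<Rightarrow> ('a \<Rightarrow> 'a) \<Rightarrow> bool" where
  "is_weak_gradient \<Omega> u g \<longleftrightarrow> locally_integrable \<Omega> u \<and> locally_integrable \<Omega> g \<and>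
     (\<forall>\<phi>\<in>test_functions \<Omega>. \<forall>b\<in>Basis.
        (LINT x|lebesgue_on \<Omega>. u x * frechet_derivative \<phi> (at x) b)
          = - (LINT x|lebesgue_on \<Omega>. (g x \<bullet> b) * \<phi> x))"

text \<open>The weak gradient is unique up to null sets; an arbitrary representative is chosen.\<close>
definition wgrad :: "'a::euclidean_space set \<Rightarrow> ('a \<Rightarrow> real) \<Rightarrow> 'a \<Rightarrow> 'a" where
  "wgrad \<Omega> u = (SOME g. is_weak_gradient \<Omega> u g)"

definition H1 :: "'a::euclidean_space set \<Rightarrow> ('a \<Rightarrow> real) set" where
  "H1 \<Omega> = {u \<in> L2_space \<Omega>. \<exists>g\<in>L2_space \<Omega>. is_weak_gradient \<Omega> u g}"

definition H1_norm :: "'a::euclidean_space set \<Rightarrow> ('a \<Rightarrow> real) \<Rightarrow> real" where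
  "H1_norm \<Omega> u = sqrt ((L2_norm \<Omega> u)\<^sup>2 + (L2_norm \<Omega> (wgrad \<Omega> u))\<^sup>2)"

definition H10 :: "'a::euclidean_space set \<Rightarrow> ('a \<Rightarrow> real) set" where
  "H10 \<Omega> = {u \<in> H1 \<Omega>. \<exists>\<phi>. (\<forall>k::nat. \<phi> k \<in> test_functions \<Omega>) \<and>
     (\<lambda>k. H1_norm \<Omega> (\<lambda>x. \<phi> k x - u x)) \<longlonglongrightarrow> 0}"

definition H10_norm :: "'a::euclidean_space set \<Rightarrow> ('a \<Rightarrow> real) \<Rightarrow> real" where
  "H10_norm \<Omega> u = L2_norm \<Omega> (wgrad \<Omega> u)"

text \<open>Closedness makes such a set invariant under modification on null subsets of \<open>\<Omega>\<close>.\<close>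
definition closed_subspace_H10 :: "'a::euclidean_space set \<Rightarrow> ('a \<Rightarrow> real) set \<Rightarrow> bool" where
  "closed_subspace_H10 \<Omega> X \<longleftrightarrow>
     X \<subseteq> H10 \<Omega> \<and>
     (\<lambda>x. 0) \<in> X \<and>
     (\<forall>v\<in>X. \<forall>w\<in>X. (\<lambda>x. v x + w x) \<in> X) \<and>
     (\<forall>c. \<forall>v\<in>X. (\<lambda>x. c * v x) \<in> X) \<and>
     (\<forall>v w. (\<forall>k::nat. v k \<in> X) \<and> w \<in> H10 \<Omega> \<and>
        (\<lambda>k. H10_norm \<Omega> (\<lambda>x. v k x - w x)) \<longlonglongrightarrow> 0 \<longrightarrow> w \<in> X)"

text \<open>Throughout, \<open>em\<close> and \<open>ep\<close> stand for \<open>\<epsilon>\<^sub>-\<close> and \<open>\<epsilon>\<^sub>+\<close>.\<close>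

definition \<mu> :: "('a \<Rightarrow> real) \<Rightarrow> real \<Rightarrow> real \<Rightarrow> 'a \<Rightarrow> real \<Rightarrow> real" where
  "\<mu> p em ep x t =
     (if t < em\<^sup>2 then em powr (p x - 2)
      else if t \<le> ep\<^sup>2 then t powr ((p x - 2) / 2)
      else ep powr (p x - 2))"

definition \<phi>_relaxed :: "('a \<Rightarrow> real) \<Rightarrow> real \<Rightarrow> real \<Rightarrow> 'a \<Rightarrow> real \<Rightarrow> real" where
  "\<phi>_relaxed p em ep x t =
     (if t < em\<^sup>2 then 1/2 * em powr (p x - 2) * t + (1 / p x - 1/2) * em powr p x
      else if t \<le> ep\<^sup>2 then 1 / p x * t powr (p x / 2)
      else 1/2 * ep powr (p x - 2) * t + (1 / p x - 1/2) * ep powr p x)"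

text \<open>
  The derivative of \<open>\<xi> x t = \<mu> p em ep x (t\<^sup>2) * t\<close> with respect to \<open>t\<close>, extended to the two kinks
  \<open>t = em\<close> and \<open>t = ep\<close> by the formula of the middle branch.
\<close>
definition \<xi>' :: "('a \<Rightarrow> real) \<Rightarrow> real \<Rightarrow> real \<Rightarrow> 'a \<Rightarrow> real \<Rightarrow> real" where
  "\<xi>' p em ep x t =
     (if t < em then em powr (p x - 2)
      else if t \<le> ep then (p x - 1) * t powr (p x - 2)
      else ep powr (p x - 2))"

definition \<xi>'_plus :: "'a set \<Rightarrow> ('a \<Rightarrow> real) \<Rightarrow> real \<Rightarrow> real \<Rightarrow> real" where
  "\<xi>'_plus \<Omega> p em ep = (SUP (x, t) \<in> \<Omega> \<times> {0..}. \<xi>' p em ep x t)"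

definition \<mu>_minus ::
    "'a::topological_space set \<Rightarrow> ('a \<Rightarrow> real) \<Rightarrow> real \<Rightarrow> real \<Rightarrow> real" where
  "\<mu>_minus \<Omega> p em ep =
     min (em powr ((SUP x\<in>closure \<Omega>. p x) - 2)) (ep powr ((INF x\<in>closure \<Omega>. p x) - 2))"

definition load :: "'a::euclidean_space set \<Rightarrow> ('a \<Rightarrow> real) \<Rightarrow> ('a \<Rightarrow> real) \<Rightarrow> real" where
  "load \<Omega> f v = (LINT x|lebesgue_on \<Omega>. f x * v x)"

definition energy :: "'a::euclidean_space set \<Rightarrow> ('a \<Rightarrow> real) \<Rightarrow> real \<Rightarrow> real \<Rightarrow> ('a \<Rightarrow> real)
    \<Rightarrow> ('a \<Rightarrow> real) \<Rightarrow> real" where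
  "energy \<Omega> p em ep f u =
     (LINT x|lebesgue_on \<Omega>. \<phi>_relaxed p em ep x ((norm (wgrad \<Omega> u x))\<^sup>2)) - load \<Omega> f u"

definition A_op :: "'a::euclidean_space set \<Rightarrow> ('a \<Rightarrow> real) \<Rightarrow> real \<Rightarrow> real \<Rightarrow> ('a \<Rightarrow> real)
    \<Rightarrow> ('a \<Rightarrow> real) \<Rightarrow> ('a \<Rightarrow> real) \<Rightarrow> real" where
  "A_op \<Omega> p em ep u v w =
     (LINT x|lebesgue_on \<Omega>. \<mu> p em ep x ((norm (wgrad \<Omega> u x))\<^sup>2) * (wgrad \<Omega> v x \<bullet> wgrad \<Omega> w x))"

definition F_op :: "'a::euclidean_space set \<Rightarrow> ('a \<Rightarrow> real) \<Rightarrow> real \<Rightarrow> real \<Rightarrow> ('a \<Rightarrow> real)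
    \<Rightarrow> ('a \<Rightarrow> real) \<Rightarrow> ('a \<Rightarrow> real) \<Rightarrow> real" where
  "F_op \<Omega> p em ep f u w = A_op \<Omega> p em ep u u w - load \<Omega> f w"

text \<open>
  A representative of the preimage of \<open>l\<close> under \<open>A_op \<Omega> p em ep u\<close>, regarded as a map from \<open>X\<close>
  to its dual; equality in the dual means equality on \<open>X\<close>.
\<close>
definition A_inv :: "'a::euclidean_space set \<Rightarrow> ('a \<Rightarrow> real) \<Rightarrow> real \<Rightarrow> real \<Rightarrow> ('a \<Rightarrow> real) set
    \<Rightarrow> ('a \<Rightarrow> real) \<Rightarrow> (('a \<Rightarrow> real) \<Rightarrow> real) \<Rightarrow> 'a \<Rightarrow> real" where
  "A_inv \<Omega> p em ep X u l = (SOME v. v \<in> X \<and> (\<forall>w\<in>X. A_op \<Omega> p em ep u v w = l w))"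

definition damped_kacanov :: "'a::euclidean_space set \<Rightarrow> ('a \<Rightarrow> real) \<Rightarrow> real \<Rightarrow> real
    \<Rightarrow> ('a \<Rightarrow> real) \<Rightarrow> ('a \<Rightarrow> real) set \<Rightarrow> (('a \<Rightarrow> real) \<Rightarrow> real) \<Rightarrow> (nat \<Rightarrow> 'a \<Rightarrow> real) \<Rightarrow> bool" where
  "damped_kacanov \<Omega> p em ep f X \<delta> u \<longleftrightarrow>
     (\<forall>n. u n \<in> X \<and> \<delta> (u n) > 0 \<and>
        (AE x in lebesgue_on \<Omega>. u (Suc n) x =
           u n x - \<delta> (u n) * A_inv \<Omega> p em ep X (u n) (F_op \<Omega> p em ep f (u n)) x))"

definition is_minimiser :: "('a \<Rightarrow> real) set \<Rightarrow> (('a \<Rightarrow> real) \<Rightarrow> real) \<Rightarrow> ('a \<Rightarrow> real) \<Rightarrow> bool" where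
  "is_minimiser X E v \<longleftrightarrow> v \<in> X \<and> (\<forall>w\<in>X. E v \<le> E w)"

text \<open>Uniqueness is understood in the function space, i.e. up to null sets.\<close>
definition is_unique_minimiser ::
    "'a::euclidean_space set \<Rightarrow> ('a \<Rightarrow> real) set \<Rightarrow> (('a \<Rightarrow> real) \<Rightarrow> real) \<Rightarrow> ('a \<Rightarrow> real) \<Rightarrow> bool"
  where
  "is_unique_minimiser \<Omega> X E v \<longleftrightarrow> is_minimiser X E v \<and>
     (\<forall>w. is_minimiser X E w \<longrightarrow> (AE x in lebesgue_on \<Omega>. w x = v x))"

definition converges_to_minimiser ::
    "'a::euclidean_space set \<Rightarrow> ('a \<Rightarrow> real) set \<Rightarrow> (('a \<Rightarrow> real) \<Rightarrow> real) \<Rightarrow> (nat \<Rightarrow> 'a \<Rightarrow> real) \<Rightarrow> bool"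
  where
  "converges_to_minimiser \<Omega> X E u \<longleftrightarrow>
     (\<exists>v. is_unique_minimiser \<Omega> X E v \<and> (\<lambda>n. H10_norm \<Omega> (\<lambda>x. u n x - v x)) \<longlonglongrightarrow> 0)"

end

theory Submission
  imports Defs
begin

text \<open>
  The relaxed energy is trapped between two quadratic functionals: along every segment in \<open>X\<close>,
  \<open>m / 2 * (N (w - v))\<^sup>2 \<le> E w - E v - F v (w - v) \<le> L / 2 * (N (w - v))\<^sup>2\<close>, where \<open>F v\<close> is the residual at \<open>v\<close>,
  \<open>N\<close> the norm of the gradient, \<open>m > 0\<close>, and \<open>L\<close> is any upper bound of \<open>\<xi>'\<close>.  Everything about the
  scheme follows from these two inequalities.

  The lower one implies that \<open>E\<close> is bounded below and that \<open>F\<close> is strongly monotone.  If each step decreases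
  the energy by at least \<open>\<gamma>\<close> times the squared length of the step, the steps therefore tend to \<open>0\<close>.  The scheme
  reads \<open>F (u n) w = - A (u n) (u (n + 1) - u n) w / \<delta> (u n)\<close>, and \<open>\<delta>\<close> is bounded below, so the residuals tend
  to \<open>0\<close> as well; by strong monotonicity \<open>u\<close> is then a Cauchy sequence.  Passing to the limit in the two
  inequalities gives \<open>E v + m / 2 * (N (w - v))\<^sup>2 \<le> E w\<close> for the limit \<open>v\<close> and all \<open>w \<in> X\<close>, that is, \<open>v\<close> is the
  unique minimiser (lemma \<open>convergence\<close>).  The upper inequality with \<open>L = \<xi>'_plus\<close>, tested with the step of the
  scheme, produces the energy decrease when the damping factors are small (lemma
  \<open>step_size_bound_implies_decrease\<close>).

  The two inequalities are pointwise facts about the density (\<open>relaxed_density_expansion\<close>).  As a function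
  of \<open>t = norm y\<close>, the density minus \<open>m / 2 * t\<^sup>2\<close>, and \<open>L / 2 * t\<^sup>2\<close> minus the density, are convex and
  nondecreasing on each of the three pieces; tangent inequalities can be glued at the two kinks, and they
  carry over from \<open>t\<close> to \<open>y\<close> by the Cauchy-Schwarz inequality.

  The remaining work is functional analysis.  Weak gradients are unique by the fundamental lemma of the
  calculus of variations, so that the representative selected by \<open>wgrad\<close> is linear up to null sets.  The
  load is continuous because \<open>H10\<close> embeds into \<open>L\<^sup>6\<close> in dimension three and into every \<open>L\<^sup>q\<close> in dimension two;
  both embeddings come from one planar inequality for functions with integrable derivatives along the
  coordinate lines.  The same embeddings give a Poincare inequality, hence completeness of \<open>H10\<close>, and
  completeness gives the limit of the scheme as well as the invertibility of \<open>A (u n)\<close>.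
\<close>

section \<open>Smooth test functions\<close>

text \<open>
  The functions \<open>exp (- 1 / t) / t ^ n\<close>, extended by \<open>0\<close> to \<open>t \<le> 0\<close>.  The family, rather than the
  case \<open>n = 0\<close> alone, is needed because the span of its members is closed under differentiation.
\<close>
definition flat :: "nat \<Rightarrow> real \<Rightarrow> real" where
  "flat n t = (if t > 0 then exp (- inverse t) * inverse t ^ n else 0)"

text \<open>
  Since \<open>exp (1 / t)\<close> dominates \<open>(1 / t) ^ (n + 2)\<close>, the exponential absorbs \<open>n + 2\<close> powers of \<open>1 / t\<close>; the two
  surplus powers make the difference quotient at \<open>0\<close> vanish.
\<close>
lemma flat_le_square: "\<exists>C. \<forall>t. \<bar>flat n t\<bar> \<le> C * t\<^sup>2"
proof -
  have "flat n t \<le> (real (n+2)) ^ (n+2) * t\<^sup>2" for t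
  proof (cases "t > 0")
    case True
    have "(inverse t / real (n+2)) ^ (n+2) \<le> (1 + inverse t / real (n+2)) ^ (n+2)"
      using True by (intro power_mono) auto
    also have "\<dots> \<le> exp (inverse t)"
      using True exp_ge_one_plus_x_over_n_power_n[of "n+2" "inverse t"]
      by (simp add: order_trans[of _ 0])
    finally have "inverse t ^ (n+2) / real (n+2) ^ (n+2) \<le> exp (inverse t)"
      unfolding power_divide .
    then have "inverse t ^ (n+2) \<le> exp (inverse t) * real (n+2) ^ (n+2)"
      by (subst (asm) pos_divide_le_eq) (auto simp del: power_Suc)
    then have "inverse t ^ (n+2) \<le> real (n+2) ^ (n+2) * exp (inverse t)"
      by (simp add: mult.commute del: power_Suc)
    then have "inverse (exp (inverse t)) * inverse t ^ (n+2)
        \<le> inverse (exp (inverse t)) * (real (n+2) ^ (n+2) * exp (inverse t))"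
      by (intro mult_left_mono) auto
    then have "exp (- inverse t) * inverse t ^ (n+2) \<le> real (n+2) ^ (n+2)"
      unfolding exp_minus by (metis exp_not_eq_zero left_inverse mult.assoc mult.commute mult.right_neutral)
    then have "exp (- inverse t) * inverse t ^ (n+2) * t\<^sup>2 \<le> real (n+2) ^ (n+2) * t\<^sup>2"
      by (rule mult_right_mono) simp
    moreover have "exp (- inverse t) * inverse t ^ (n+2) * t\<^sup>2 = flat n t"
      using True by (simp add: flat_def field_simps power2_eq_square)
    ultimately show ?thesis by simp
  qed (auto simp: flat_def)
  moreover have "flat n t \<ge> 0" for t by (simp add: flat_def)
  ultimately show ?thesis by (intro exI[of _ "(real (n+2)) ^ (n+2)"]) auto
qed

lemma flat_has_derivative:
  "(flat n has_field_derivative (flat (n+2) t - real n * flat (n+1) t)) (at t)"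
proof -
  consider "t > 0" | "t < 0" | "t = 0" by linarith
  then show ?thesis
  proof cases
    case 1
    have "((\<lambda>t. exp (- inverse t) * inverse t ^ n) has_field_derivative
        (flat (n+2) t - real n * flat (n+1) t)) (at t)"
    proof (cases n)
      case 0
      then show ?thesis
        using 1 by (auto intro!: derivative_eq_intros simp: flat_def field_simps power2_eq_square)
    next
      case (Suc m)
      have "((\<lambda>t. exp (- inverse t) * inverse t ^ Suc m) has_field_derivative
        exp (- inverse t) * inverse t ^ 2 * inverse t ^ Suc m
          + exp (- inverse t) * (real (Suc m) * inverse t ^ m * (- (inverse t ^ 2)))) (at t)"
        using 1 by (auto intro!: derivative_eq_intros simp: power2_eq_square simp del: power_Suc)
      then show ?thesis using 1 Suc
        by (simp add: flat_def power2_eq_square algebra_simps)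
    qed
    moreover have ev: "\<forall>\<^sub>F s in nhds t. exp (- inverse s) * inverse s ^ n = flat n s"
      using eventually_nhds_in_open[of "{0<..}" t] 1 by (auto elim!: eventually_mono simp: flat_def)
    ultimately show ?thesis by (subst (asm) DERIV_cong_ev[OF refl ev refl])
  next
    case 2
    have "\<forall>\<^sub>F s in nhds t. 0 = flat n s"
      using eventually_nhds_in_open[of "{..<0}" t] 2 by (auto elim!: eventually_mono simp: flat_def)
    from DERIV_cong_ev[OF refl this refl, of 0] have "(flat n has_field_derivative 0) (at t)"
      by simp
    then show ?thesis using 2 by (simp add: flat_def)
  next
    case 3
    obtain C where C: "\<And>t. \<bar>flat n t\<bar> \<le> C * t\<^sup>2" using flat_le_square by blast
    have "((\<lambda>s. (flat n s - flat n 0) / (s - 0)) \<longlongrightarrow> 0) (at 0)"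
    proof (rule Lim_null_comparison)
      show "\<forall>\<^sub>F s in at 0. norm ((flat n s - flat n 0) / (s - 0)) \<le> C * \<bar>s\<bar>"
      proof (rule eventually_at_filter[THEN iffD2], rule always_eventually, intro allI impI)
        fix s :: real assume "s \<noteq> 0"
        then show "norm ((flat n s - flat n 0) / (s - 0)) \<le> C * \<bar>s\<bar>"
          using C[of s] by (auto simp: flat_def[of n 0] divide_le_eq power2_eq_square abs_mult)
      qed
      show "((\<lambda>s. C * \<bar>s\<bar>) \<longlongrightarrow> 0) (at 0)"
        by (auto intro!: tendsto_eq_intros)
    qed
    then have "(flat n has_field_derivative 0) (at 0)"
      by (simp add: has_field_derivative_iff)
    then show ?thesis using 3 by (simp add: flat_def)
  qed
qed

text \<open>
  An algebra of functions that contains the bumps below and is closed under partial derivatives;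
  membership therefore implies all differentiability classes at once.
\<close>
inductive_set smooth_algebra :: "('a::euclidean_space \<Rightarrow> real) set" where
  const: "(\<lambda>x. c) \<in> smooth_algebra"
| flat: "(\<lambda>x. flat n (c + v \<bullet> x)) \<in> smooth_algebra"
| add: "g \<in> smooth_algebra \<Longrightarrow> h \<in> smooth_algebra \<Longrightarrow> (\<lambda>x. g x + h x) \<in> smooth_algebra"
| mult: "g \<in> smooth_algebra \<Longrightarrow> h \<in> smooth_algebra \<Longrightarrow> (\<lambda>x. g x * h x) \<in> smooth_algebra"

lemma smooth_algebra_has_derivative:
  assumes "g \<in> smooth_algebra"
  shows "\<exists>D. (\<forall>x. (g has_derivative D x) (at x)) \<and> (\<forall>b. (\<lambda>x. D x b) \<in> smooth_algebra)"
  using assms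
proof induction
  case (const c)
  show ?case by (rule exI[of _ "\<lambda>x h. 0"]) (auto intro: smooth_algebra.const)
next
  case (flat n c v)
  let ?d = "\<lambda>t. flat (n+2) t - real n * flat (n+1) t"
  have "((\<lambda>x. flat n (c + v \<bullet> x)) has_derivative (\<lambda>h. (v \<bullet> h) * ?d (c + v \<bullet> x))) (at x)" for x
  proof -
    have "((\<lambda>x. c + v \<bullet> x) has_derivative (\<lambda>h. v \<bullet> h)) (at x)"
      by (auto intro!: derivative_eq_intros)
    then show ?thesis
      by (rule has_derivative_eq_rhs[OF has_derivative_compose[OF _
            flat_has_derivative[unfolded has_field_derivative_def]]])
         (simp add: fun_eq_iff mult.commute)
  qed
  moreover have "(\<lambda>x. (v \<bullet> b) * (flat (n+2) (c + v \<bullet> x) + (- real n) * flat (n+1) (c + v \<bullet> x)))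
      \<in> smooth_algebra" for b
    by (intro smooth_algebra.intros)
  ultimately show ?case
    by (intro exI[of _ "\<lambda>x h. (v \<bullet> h) * ?d (c + v \<bullet> x)"]) simp
next
  case (add g h)
  then obtain D E where "\<And>x. (g has_derivative D x) (at x)" "\<And>b. (\<lambda>x. D x b) \<in> smooth_algebra"
    "\<And>x. (h has_derivative E x) (at x)" "\<And>b. (\<lambda>x. E x b) \<in> smooth_algebra" by metis
  then show ?case
    by (intro exI[of _ "\<lambda>x b. D x b + E x b"]) (auto intro: has_derivative_add smooth_algebra.add)
next
  case (mult g h)
  then obtain D E where "\<And>x. (g has_derivative D x) (at x)" "\<And>b. (\<lambda>x. D x b) \<in> smooth_algebra"
    "\<And>x. (h has_derivative E x) (at x)" "\<And>b. (\<lambda>x. E x b) \<in> smooth_algebra" by metis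
  then show ?case using mult
    by (intro exI[of _ "\<lambda>x b. g x * E x b + D x b * h x"])
      (auto intro: has_derivative_mult intro!: smooth_algebra.intros)
qed

lemma smooth_algebra_Ck: "g \<in> smooth_algebra \<Longrightarrow> Ck k g"
proof (induction k arbitrary: g)
  case 0
  then obtain D where "\<And>x. (g has_derivative D x) (at x)" using smooth_algebra_has_derivative by blast
  then show ?case by (auto intro!: has_derivative_continuous_on simp: has_derivative_at_withinI)
next
  case (Suc k)
  then obtain D where D: "\<And>x. (g has_derivative D x) (at x)" "\<And>b. (\<lambda>x. D x b) \<in> smooth_algebra"
    using smooth_algebra_has_derivative by blast
  then have "frechet_derivative g (at x) = D x" for x by (metis frechet_derivative_at)
  with D Suc.IH show ?case
    by (auto simp: differentiable_on_def differentiable_def)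
qed

lemma smooth_algebra_prod:
  "finite I \<Longrightarrow> (\<And>i. i \<in> I \<Longrightarrow> g i \<in> smooth_algebra) \<Longrightarrow> (\<lambda>x. \<Prod>i\<in>I. g i x) \<in> smooth_algebra"
  by (induction I rule: finite_induct) (auto intro: smooth_algebra.intros)

text \<open>Bumps that are positive exactly on a box and, as \<open>k\<close> grows, increase to its indicator.\<close>
definition box_bump :: "'a::euclidean_space \<Rightarrow> 'a \<Rightarrow> nat \<Rightarrow> 'a \<Rightarrow> real" where
  "box_bump a b k x = (\<Prod>i\<in>Basis. flat 0 (real (Suc k) * (x \<bullet> i - a \<bullet> i)) *
     flat 0 (real (Suc k) * (b \<bullet> i - x \<bullet> i)))"

lemma box_bump_Ck: "Ck m (box_bump a b k)"
proof -
  have "(\<lambda>x. \<Prod>i\<in>Basis. flat 0 (- (real (Suc k) * (a \<bullet> i)) + (real (Suc k) *\<^sub>R i) \<bullet> x) *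
     flat 0 (real (Suc k) * (b \<bullet> i) + (- real (Suc k) *\<^sub>R i) \<bullet> x)) \<in> smooth_algebra"
    by (intro smooth_algebra_prod smooth_algebra.intros finite_Basis)
  also have "(\<lambda>x. \<Prod>i\<in>Basis. flat 0 (- (real (Suc k) * (a \<bullet> i)) + (real (Suc k) *\<^sub>R i) \<bullet> x) *
     flat 0 (real (Suc k) * (b \<bullet> i) + (- real (Suc k) *\<^sub>R i) \<bullet> x)) = box_bump a b k"
    unfolding box_bump_def
    by (intro ext prod.cong refl arg_cong2[where f="(*)"] arg_cong[where f="flat 0"])
       (simp_all add: algebra_simps inner_commute)
  finally show ?thesis by (rule smooth_algebra_Ck)
qed

lemma box_bump_eq_0: "x \<notin> box a b \<Longrightarrow> box_bump a b k x = 0"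
  unfolding box_bump_def mem_box
  by (subst prod_zero_iff) (auto simp: flat_def zero_less_mult_iff)

lemma box_bump_test_function:
  assumes "cbox a b \<subseteq> \<Omega>"
  shows "box_bump a b k \<in> test_functions \<Omega>"
proof -
  have "closure {x. box_bump a b k x \<noteq> 0} \<subseteq> cbox a b"
    using box_bump_eq_0 box_subset_cbox by (intro closure_minimal) fastforce+
  then show ?thesis
    using assms box_bump_Ck compact_cbox[of a b] unfolding test_functions_def
    by (auto simp: box_bump_Ck) (meson bounded_cbox bounded_subset closure_subset order_trans)+
qed

lemma box_bump_bounds: "0 \<le> box_bump a b k x" "box_bump a b k x \<le> 1"
proof -
  have *: "0 \<le> flat 0 t" "flat 0 t \<le> 1" for t by (auto simp: flat_def)
  show "0 \<le> box_bump a b k x" "box_bump a b k x \<le> 1" unfolding box_bump_def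
    by (auto intro!: prod_nonneg prod_le_1 mult_nonneg_nonneg mult_le_one simp: *)
qed

lemma box_bump_tendsto: "(\<lambda>k. box_bump a b k x) \<longlonglongrightarrow> indicator (box a b) x"
proof (cases "x \<in> box a b")
  case True
  have *: "(\<lambda>k. flat 0 (real (Suc k) * c)) \<longlonglongrightarrow> 1" if "c > 0" for c
  proof -
    have "(\<lambda>k. inverse (real (Suc k)) * inverse c) \<longlonglongrightarrow> 0 * inverse c"
      by (rule tendsto_mult[OF LIMSEQ_inverse_real_of_nat tendsto_const])
    then have "(\<lambda>k. exp (- (inverse (real (Suc k)) * inverse c))) \<longlonglongrightarrow> exp (- (0 * inverse c))"
      by (intro tendsto_exp tendsto_minus)
    then show ?thesis using that by (simp add: flat_def zero_less_mult_iff mult.commute)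
  qed
  have "(\<lambda>k. box_bump a b k x) \<longlonglongrightarrow> (\<Prod>i\<in>(Basis::'a set). 1 * 1)"
    unfolding box_bump_def using True by (intro tendsto_prod tendsto_mult *) (auto simp: mem_box)
  then show ?thesis using True by simp
qed (simp add: box_bump_eq_0)

section \<open>Square integrable functions\<close>

text \<open>
  The source of the Cauchy-Schwarz inequality for any nonnegative form, and of residual estimates for
  approximate minimisers of a quadratic functional.
\<close>
lemma nonneg_quadratic_discriminant:
  fixes a b c :: real
  assumes nonneg: "\<And>t. 0 \<le> a + 2 * t * b + t\<^sup>2 * c" and c: "0 \<le> c"
  shows "b\<^sup>2 \<le> a * c"
proof (cases "c = 0")
  case True
  have "b = 0"
  proof (rule ccontr)
    assume "b \<noteq> 0"
    with nonneg[of "- (a + 1) / (2 * b)"] True show False by (simp add: field_simps)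
  qed
  with True show ?thesis by simp
next
  case False
  with nonneg[of "- b / c"] c have "0 \<le> a - b\<^sup>2 / c" by (simp add: field_simps power2_eq_square)
  with False c show ?thesis by (simp add: field_simps)
qed

text \<open>
  Fatou's lemma for bounds \<open>c' k\<close> that converge: integrability of the limit is part of the conclusion, so the
  lemma transfers estimates from a sequence to its almost everywhere limit.
\<close>
lemma Fatou_integral:
  fixes h :: "'a \<Rightarrow> real"
  assumes int: "\<And>k::nat. integrable M (h' k)" and nonneg: "\<And>k x. 0 \<le> h' k x"
    and le: "\<And>k. integral\<^sup>L M (h' k) \<le> c' k" and c: "c' \<longlonglongrightarrow> c"
    and ae: "AE x in M. (\<lambda>k. h' k x) \<longlonglongrightarrow> h x" and h: "h \<in> borel_measurable M"
  shows "integrable M h" "integral\<^sup>L M h \<le> c"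
proof -
  have pos: "AE x in M. 0 \<le> h x" using ae by eventually_elim (auto intro: LIMSEQ_le_const simp: nonneg)
  have "(\<integral>\<^sup>+x. ennreal (h x) \<partial>M) = (\<integral>\<^sup>+x. liminf (\<lambda>k. ennreal (h' k x)) \<partial>M)"
  proof (rule nn_integral_cong_AE)
    show "AE x in M. ennreal (h x) = liminf (\<lambda>k. ennreal (h' k x))"
      using ae by eventually_elim (metis lim_imp_Liminf tendsto_ennrealI trivial_limit_sequentially)
  qed
  also have "\<dots> \<le> liminf (\<lambda>k. \<integral>\<^sup>+x. ennreal (h' k x) \<partial>M)"
    using int by (intro nn_integral_liminf) auto
  also have "\<dots> \<le> liminf (\<lambda>k. ennreal (c' k))"
    using int nonneg le by (intro Liminf_mono always_eventually allI)
      (auto simp: nn_integral_eq_integral intro!: ennreal_leI)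
  also have "\<dots> = ennreal c"
    using c by (metis lim_imp_Liminf tendsto_ennrealI trivial_limit_sequentially)
  finally have bound: "(\<integral>\<^sup>+x. ennreal (h x) \<partial>M) \<le> ennreal c" .
  then show int_h: "integrable M h"
    using pos h by (intro integrableI_nonneg) (auto intro: le_less_trans)
  have "0 \<le> c" using c le nonneg
    by (intro LIMSEQ_le_const[OF c]) (meson Bochner_Integration.integral_nonneg order_trans)
  then show "integral\<^sup>L M h \<le> c"
    using bound nn_integral_eq_integral[OF int_h pos] by simp
qed

lemma L2_spaceD:
  "g \<in> L2_space \<Omega> \<Longrightarrow> g \<in> borel_measurable (lebesgue_on \<Omega>)"
  "g \<in> L2_space \<Omega> \<Longrightarrow> integrable (lebesgue_on \<Omega>) (\<lambda>x. (norm (g x))\<^sup>2)"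
  by (auto simp: L2_space_def)

lemma L2_norm_nonneg [simp]: "0 \<le> L2_norm \<Omega> g"
  by (simp add: L2_norm_def Bochner_Integration.integral_nonneg)

lemma L2_norm_square: "(L2_norm \<Omega> g)\<^sup>2 = (LINT x|lebesgue_on \<Omega>. (norm (g x))\<^sup>2)"
  by (simp add: L2_norm_def Bochner_Integration.integral_nonneg)

lemma L2_norm_cong_AE:
  assumes "g \<in> borel_measurable (lebesgue_on \<Omega>)" "h \<in> borel_measurable (lebesgue_on \<Omega>)"
    and "AE x in lebesgue_on \<Omega>. g x = h x"
  shows "L2_norm \<Omega> g = L2_norm \<Omega> h"
proof -
  have "(LINT x|lebesgue_on \<Omega>. (norm (g x))\<^sup>2) = (LINT x|lebesgue_on \<Omega>. (norm (h x))\<^sup>2)"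
    using assms by (intro integral_cong_AE) (auto elim: eventually_mono)
  then show ?thesis by (simp add: L2_norm_def)
qed

lemma L2_space_dominated:
  assumes "g \<in> borel_measurable (lebesgue_on \<Omega>)" "h \<in> L2_space \<Omega>" "AE x in lebesgue_on \<Omega>. norm (g x) \<le> C * norm (h x)"
  shows "g \<in> L2_space \<Omega>"
proof -
  have "integrable (lebesgue_on \<Omega>) (\<lambda>x. (norm (g x))\<^sup>2)"
  proof (rule Bochner_Integration.integrable_bound)
    show "integrable (lebesgue_on \<Omega>) (\<lambda>x. C\<^sup>2 * (norm (h x))\<^sup>2)"
      using assms by (auto simp: L2_space_def)
    show "AE x in lebesgue_on \<Omega>. norm ((norm (g x))\<^sup>2) \<le> norm (C\<^sup>2 * (norm (h x))\<^sup>2)"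
      using assms(3) by eventually_elim (metis abs_le_square_iff abs_norm_cancel abs_of_nonneg
        norm_ge_zero order_trans power_mult_distrib real_norm_def zero_le_power2)
    show "(\<lambda>x. (norm (g x))\<^sup>2) \<in> borel_measurable (lebesgue_on \<Omega>)" using assms by measurable
  qed
  then show ?thesis using assms by (simp add: L2_space_def)
qed

lemma L2_inner_integrable:
  assumes "g \<in> L2_space \<Omega>" "h \<in> L2_space \<Omega>"
  shows "integrable (lebesgue_on \<Omega>) (\<lambda>x. g x \<bullet> h x)"
proof -
  have int: "integrable (lebesgue_on \<Omega>) (\<lambda>x. (norm (g x))\<^sup>2 + (norm (h x))\<^sup>2)"
    using assms by (auto simp: L2_space_def)
  have meas: "g \<in> borel_measurable (lebesgue_on \<Omega>)" "h \<in> borel_measurable (lebesgue_on \<Omega>)"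
    using assms by (auto simp: L2_space_def)
  have prod: "norm (g x) * norm (h x) \<le> (norm (g x))\<^sup>2 + (norm (h x))\<^sup>2" for x
  proof -
    have "2 * norm (g x) * norm (h x) \<le> (norm (g x))\<^sup>2 + (norm (h x))\<^sup>2" by (rule sum_squares_bound)
    moreover have "0 \<le> norm (g x) * norm (h x)" by simp
    ultimately show ?thesis by linarith
  qed
  show "integrable (lebesgue_on \<Omega>) (\<lambda>x. g x \<bullet> h x)"
    by (rule Bochner_Integration.integrable_bound[OF int])
       (use meas prod in \<open>auto intro: order_trans[OF Cauchy_Schwarz_ineq2]\<close>)
qed

lemma L2_norm_mult_integrable:
  assumes "g \<in> L2_space \<Omega>" "h \<in> L2_space \<Omega>"
  shows "integrable (lebesgue_on \<Omega>) (\<lambda>x. norm (g x) * norm (h x))"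
proof -
  have "(\<lambda>x. norm (g x)) \<in> L2_space \<Omega>" "(\<lambda>x. norm (h x)) \<in> L2_space \<Omega>"
    using assms by (auto simp: L2_space_def)
  from L2_inner_integrable[OF this] show ?thesis by simp
qed

lemma L2_space_scaleR: "g \<in> L2_space \<Omega> \<Longrightarrow> (\<lambda>x. c *\<^sub>R g x) \<in> L2_space \<Omega>"
  by (rule L2_space_dominated[where C="\<bar>c\<bar>"]) (auto simp: L2_space_def)

lemma L2_space_add:
  assumes "g \<in> L2_space \<Omega>" "h \<in> L2_space \<Omega>"
  shows "(\<lambda>x. g x + h x) \<in> L2_space \<Omega>"
proof -
  have "(norm (g x + h x))\<^sup>2 = (norm (g x))\<^sup>2 + 2 * (g x \<bullet> h x) + (norm (h x))\<^sup>2" for x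
    by (simp add: power2_norm_eq_inner inner_add inner_commute)
  then show ?thesis using assms L2_inner_integrable[OF assms] by (auto simp: L2_space_def)
qed

lemma L2_space_diff:
  assumes "g \<in> L2_space \<Omega>" "h \<in> L2_space \<Omega>"
  shows "(\<lambda>x. g x - h x) \<in> L2_space \<Omega>"
  using L2_space_add[OF assms(1) L2_space_scaleR[OF assms(2), of "-1"]] by simp

lemma L2_norm_scaleR: "L2_norm \<Omega> (\<lambda>x. c *\<^sub>R g x) = \<bar>c\<bar> * L2_norm \<Omega> g"
  by (simp add: L2_norm_def power_mult_distrib real_sqrt_mult)

lemma L2_norm_minus_commute: "L2_norm \<Omega> (\<lambda>x. g x - h x) = L2_norm \<Omega> (\<lambda>x. h x - g x)"
  by (simp add: L2_norm_def norm_minus_commute)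

lemma L2_norm_add_square:
  assumes "g \<in> L2_space \<Omega>" "h \<in> L2_space \<Omega>"
  shows "(L2_norm \<Omega> (\<lambda>x. g x + t *\<^sub>R h x))\<^sup>2 =
    (L2_norm \<Omega> g)\<^sup>2 + 2 * t * (LINT x|lebesgue_on \<Omega>. g x \<bullet> h x) + t\<^sup>2 * (L2_norm \<Omega> h)\<^sup>2"
proof -
  have "(norm (g x + t *\<^sub>R h x))\<^sup>2 = (norm (g x))\<^sup>2 + (2 * t) * (g x \<bullet> h x) + t\<^sup>2 * (norm (h x))\<^sup>2" for x
    unfolding power2_norm_eq_inner by (simp add: inner_add inner_commute power2_eq_square algebra_simps)
  then show ?thesis using assms L2_inner_integrable[OF assms]
    by (simp add: L2_norm_square L2_spaceD)
qed

lemma L2_Cauchy_Schwarz: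
  assumes "g \<in> L2_space \<Omega>" "h \<in> L2_space \<Omega>"
  shows "\<bar>LINT x|lebesgue_on \<Omega>. g x \<bullet> h x\<bar> \<le> L2_norm \<Omega> g * L2_norm \<Omega> h"
proof -
  have "0 \<le> (L2_norm \<Omega> g)\<^sup>2 + 2 * t * (LINT x|lebesgue_on \<Omega>. g x \<bullet> h x) + t\<^sup>2 * (L2_norm \<Omega> h)\<^sup>2" for t
    using L2_norm_add_square[OF assms, of t] by (metis zero_le_power2)
  then have "(LINT x|lebesgue_on \<Omega>. g x \<bullet> h x)\<^sup>2 \<le> (L2_norm \<Omega> g * L2_norm \<Omega> h)\<^sup>2"
    unfolding power_mult_distrib by (rule nonneg_quadratic_discriminant) simp
  from real_sqrt_le_mono[OF this] show ?thesis by (simp add: abs_mult)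
qed

lemma L2_Cauchy_Schwarz_norm:
  assumes "g \<in> L2_space \<Omega>" "h \<in> L2_space \<Omega>"
  shows "(LINT x|lebesgue_on \<Omega>. norm (g x) * norm (h x)) \<le> L2_norm \<Omega> g * L2_norm \<Omega> h"
proof -
  have "(\<lambda>x. norm (g x)) \<in> L2_space \<Omega>" "(\<lambda>x. norm (h x)) \<in> L2_space \<Omega>"
    using assms by (auto simp: L2_space_def)
  from L2_Cauchy_Schwarz[OF this] show ?thesis by (simp add: L2_norm_def)
qed

lemma L2_norm_triangle:
  assumes "g \<in> L2_space \<Omega>" "h \<in> L2_space \<Omega>"
  shows "L2_norm \<Omega> (\<lambda>x. g x + h x) \<le> L2_norm \<Omega> g + L2_norm \<Omega> h"
proof -
  have "(L2_norm \<Omega> (\<lambda>x. g x + h x))\<^sup>2 \<le> (L2_norm \<Omega> g + L2_norm \<Omega> h)\<^sup>2"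
    using L2_norm_add_square[OF assms, of 1] L2_Cauchy_Schwarz[OF assms] by (simp add: power2_sum)
  then show ?thesis by (rule power2_le_imp_le) simp
qed

lemma L2_norm_triangle_diff:
  assumes "g \<in> L2_space \<Omega>" "h \<in> L2_space \<Omega>" "k \<in> L2_space \<Omega>"
  shows "L2_norm \<Omega> (\<lambda>x. g x - k x) \<le> L2_norm \<Omega> (\<lambda>x. g x - h x) + L2_norm \<Omega> (\<lambda>x. h x - k x)"
  using L2_norm_triangle[OF L2_space_diff[OF assms(1,2)] L2_space_diff[OF assms(2,3)]] by simp

lemma L2_norm_le_add_diff:
  assumes "g \<in> L2_space \<Omega>" "h \<in> L2_space \<Omega>"
  shows "L2_norm \<Omega> g \<le> L2_norm \<Omega> h + L2_norm \<Omega> (\<lambda>x. g x - h x)"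
  using L2_norm_triangle[OF assms(2) L2_space_diff[OF assms]] by simp

lemma L2_norm_tendsto:
  assumes "\<And>k::nat. g k \<in> L2_space \<Omega>" "h \<in> L2_space \<Omega>" "(\<lambda>k. L2_norm \<Omega> (\<lambda>x. g k x - h x)) \<longlonglongrightarrow> 0"
  shows "(\<lambda>k. L2_norm \<Omega> (g k)) \<longlonglongrightarrow> L2_norm \<Omega> h"
proof -
  have "norm (L2_norm \<Omega> (g k) - L2_norm \<Omega> h) \<le> L2_norm \<Omega> (\<lambda>x. g k x - h x)" for k
    using L2_norm_le_add_diff[OF assms(1)[of k] assms(2)] L2_norm_le_add_diff[OF assms(2) assms(1)[of k]]
    by (simp add: L2_norm_minus_commute abs_le_iff)
  then have "(\<lambda>k. L2_norm \<Omega> (g k) - L2_norm \<Omega> h) \<longlonglongrightarrow> 0"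
    using assms(3) by (intro Lim_null_comparison[OF _ assms(3)] always_eventually) auto
  then show ?thesis by (rule LIM_zero_cancel)
qed

lemma L2_space_integrable:
  assumes "\<Omega> \<in> lmeasurable" "g \<in> L2_space \<Omega>"
  shows "integrable (lebesgue_on \<Omega>) g"
    and "(LINT x|lebesgue_on \<Omega>. norm (g x)) \<le> sqrt (measure (lebesgue_on \<Omega>) \<Omega>) * L2_norm \<Omega> g"
proof -
  interpret finite_measure "lebesgue_on \<Omega>" by (rule finite_measure_lebesgue_on) fact
  have one: "(\<lambda>x. 1::real) \<in> L2_space \<Omega>" by (simp add: L2_space_def)
  have "integrable (lebesgue_on \<Omega>) (\<lambda>x. norm (1::real) * norm (g x))"
    by (rule L2_norm_mult_integrable[OF one assms(2)])
  then show "integrable (lebesgue_on \<Omega>) g"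
    using assms by (simp add: integrable_norm_iff L2_space_def)
  show "(LINT x|lebesgue_on \<Omega>. norm (g x)) \<le> sqrt (measure (lebesgue_on \<Omega>) \<Omega>) * L2_norm \<Omega> g"
    using L2_Cauchy_Schwarz_norm[OF one assms(2)] by (simp add: L2_norm_def)
qed

text \<open>
  Finite measure turns convergence in \<open>L\<^sup>2\<close> into convergence in \<open>L\<^sup>1\<close>, which has the subsequence property.
\<close>
lemma L2_convergent_AE_subseq:
  assumes \<Omega>: "\<Omega> \<in> lmeasurable" and g: "\<And>k::nat. g k \<in> L2_space \<Omega>" and h: "h \<in> L2_space \<Omega>"
    and lim: "(\<lambda>k. L2_norm \<Omega> (\<lambda>x. g k x - h x)) \<longlonglongrightarrow> 0"
  obtains r :: "nat \<Rightarrow> nat" where "strict_mono r" "AE x in lebesgue_on \<Omega>. (\<lambda>k. g (r k) x) \<longlonglongrightarrow> h x"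
proof -
  have "(\<lambda>k. LINT x|lebesgue_on \<Omega>. norm (g k x - h x)) \<longlonglongrightarrow> 0"
  proof (rule tendsto_sandwich[OF _ _ tendsto_const])
    show "(\<lambda>k. sqrt (measure (lebesgue_on \<Omega>) \<Omega>) * L2_norm \<Omega> (\<lambda>x. g k x - h x)) \<longlonglongrightarrow> 0"
      using lim by (rule tendsto_mult_right_zero)
  qed (auto intro!: always_eventually L2_space_integrable[OF \<Omega>] L2_space_diff g h
      simp: Bochner_Integration.integral_nonneg)
  from tendsto_L1_AE_subseq[OF _ this] obtain r where
    r: "strict_mono r" "AE x in lebesgue_on \<Omega>. (\<lambda>k. g (r k) x - h x) \<longlonglongrightarrow> 0"
    using L2_space_integrable(1)[OF \<Omega> L2_space_diff[OF g h]] by blast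
  show thesis
    using r by (intro that[of r]) (auto elim: eventually_mono intro: LIM_zero_cancel)
qed

text \<open>
  On a set of finite measure an \<open>L\<^sup>2\<close> Cauchy sequence is Cauchy in \<open>L\<^sup>1\<close>, so a subsequence converges
  almost everywhere; Fatou's lemma turns this into convergence in \<open>L\<^sup>2\<close>.
\<close>
lemma L2_complete:
  fixes g :: "nat \<Rightarrow> 'a::euclidean_space \<Rightarrow> 'b::euclidean_space"
  assumes \<Omega>: "\<Omega> \<in> lmeasurable" and g: "\<And>k. g k \<in> L2_space \<Omega>"
    and Cauchy: "\<And>e. e > 0 \<Longrightarrow> \<exists>N. \<forall>m\<ge>N. \<forall>n\<ge>N. L2_norm \<Omega> (\<lambda>x. g m x - g n x) < e"
  obtains h where "h \<in> L2_space \<Omega>" "(\<lambda>k. L2_norm \<Omega> (\<lambda>x. g k x - h x)) \<longlonglongrightarrow> 0"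
proof -
  let ?M = "lebesgue_on \<Omega>" and ?c = "sqrt (measure (lebesgue_on \<Omega>) \<Omega>)"
  have [measurable]: "g k \<in> borel_measurable ?M" for k using g by (simp add: L2_space_def)
  have int: "integrable ?M (g k)" for k using L2_space_integrable(1)[OF \<Omega> g] .
  have "\<exists>N. \<forall>i\<ge>N. \<forall>j\<ge>N. (LINT x|?M. norm (g i x - g j x)) < e" if e: "e > 0" for e
  proof -
    have "e / (?c + 1) > 0" using e by (intro divide_pos_pos add_nonneg_pos) auto
    from Cauchy[OF this]
    obtain N where N: "\<And>m n. m \<ge> N \<Longrightarrow> n \<ge> N \<Longrightarrow> L2_norm \<Omega> (\<lambda>x. g m x - g n x) < e / (?c + 1)"
      by blast
    have "(LINT x|?M. norm (g i x - g j x)) < e" if "i \<ge> N" "j \<ge> N" for i j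
    proof -
      have "(LINT x|?M. norm (g i x - g j x)) \<le> ?c * L2_norm \<Omega> (\<lambda>x. g i x - g j x)"
        by (rule L2_space_integrable(2)[OF \<Omega> L2_space_diff[OF g g]])
      also have "\<dots> \<le> (?c + 1) * L2_norm \<Omega> (\<lambda>x. g i x - g j x)"
        by (intro mult_right_mono) auto
      also have "\<dots> < (?c + 1) * (e / (?c + 1))"
        using N[OF that] by (intro mult_strict_left_mono) (auto simp: add_nonneg_pos)
      finally show ?thesis by (simp add: add_nonneg_pos add_nonneg_eq_0_iff)
    qed
    then show ?thesis by blast
  qed
  from cauchy_L1_AE_cauchy_subseq[OF int this] obtain r where
    r: "strict_mono r" "AE x in ?M. Cauchy (\<lambda>i. g (r i) x)" by blast
  define h where "h x = lim (\<lambda>i. g (r i) x)" for x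
  have [measurable]: "h \<in> borel_measurable ?M"
    unfolding h_def by (rule borel_measurable_lim_metric) measurable
  have ae: "AE x in ?M. (\<lambda>i. g (r i) x) \<longlonglongrightarrow> h x"
    using r(2) by eventually_elim (simp add: h_def Cauchy_convergent_iff convergent_LIMSEQ_iff)
  have tail: "integrable ?M (\<lambda>x. (norm (g n x - h x))\<^sup>2) \<and> L2_norm \<Omega> (\<lambda>x. g n x - h x) \<le> e"
    if N: "\<And>m n. m \<ge> N \<Longrightarrow> n \<ge> N \<Longrightarrow> L2_norm \<Omega> (\<lambda>x. g m x - g n x) < e" and "n \<ge> N" for N n e
  proof -
    have e: "e > 0" using N[of N N] by (auto intro: le_less_trans[OF L2_norm_nonneg])
    have le: "(LINT x|?M. (norm (g n x - g (r (k + N)) x))\<^sup>2) \<le> e\<^sup>2" for k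
    proof -
      have "r (k + N) \<ge> N" using seq_suble[OF r(1), of "k + N"] by linarith
      then have "L2_norm \<Omega> (\<lambda>x. g n x - g (r (k + N)) x) \<le> e" using N[OF \<open>n \<ge> N\<close>] by (simp add: less_imp_le)
      then show ?thesis unfolding L2_norm_square[symmetric] by (intro power_mono) auto
    qed
    have ae': "AE x in ?M. (\<lambda>k. (norm (g n x - g (r (k + N)) x))\<^sup>2) \<longlonglongrightarrow> (norm (g n x - h x))\<^sup>2"
      using ae by eventually_elim (auto intro!: tendsto_intros LIMSEQ_ignore_initial_segment)
    have int': "integrable ?M (\<lambda>x. (norm (g n x - g (r (k + N)) x))\<^sup>2)" for k
      using L2_space_diff[OF g g] by (auto simp: L2_space_def)
    have F: "integrable ?M (\<lambda>x. (norm (g n x - h x))\<^sup>2)"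
      "(LINT x|?M. (norm (g n x - h x))\<^sup>2) \<le> e\<^sup>2"
      by (rule Fatou_integral[OF int' _ le tendsto_const ae']; measurable)+
    then show ?thesis using e
      by (auto simp: L2_norm_def intro!: real_le_lsqrt Bochner_Integration.integral_nonneg)
  qed
  obtain N where "\<And>m n. m \<ge> N \<Longrightarrow> n \<ge> N \<Longrightarrow> L2_norm \<Omega> (\<lambda>x. g m x - g n x) < 1"
    using Cauchy[of 1] by auto
  from tail[OF this, of N] have "(\<lambda>x. g N x - h x) \<in> L2_space \<Omega>" by (auto simp: L2_space_def)
  from L2_space_diff[OF g[of N] this] have h: "h \<in> L2_space \<Omega>" by simp
  have "(\<lambda>k. L2_norm \<Omega> (\<lambda>x. g k x - h x)) \<longlonglongrightarrow> 0"
  proof (rule LIMSEQ_I)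
    fix e :: real assume "e > 0"
    then obtain N where N: "\<And>m n. m \<ge> N \<Longrightarrow> n \<ge> N \<Longrightarrow> L2_norm \<Omega> (\<lambda>x. g m x - g n x) < e / 2"
      using Cauchy[of "e / 2"] by auto
    have "L2_norm \<Omega> (\<lambda>x. g n x - h x) < e" if "n \<ge> N" for n
      using tail[OF N that] \<open>e > 0\<close> by fastforce
    then show "\<exists>N. \<forall>n\<ge>N. norm (L2_norm \<Omega> (\<lambda>x. g n x - h x) - 0) < e" by auto
  qed
  with h show thesis by (rule that)
qed

section \<open>Weak gradients\<close>

lemma test_function_has_derivative:
  assumes "\<psi> \<in> test_functions \<Omega>"
  shows "(\<psi> has_derivative frechet_derivative \<psi> (at x)) (at x)"
proof -
  have "Ck (Suc 0) \<psi>" using assms unfolding test_functions_def by blast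
  then show ?thesis by (simp add: frechet_derivative_works differentiable_on_def)
qed

lemma test_function_continuous:
  assumes "\<psi> \<in> test_functions \<Omega>"
  shows "continuous_on UNIV \<psi>" "b \<in> Basis \<Longrightarrow> continuous_on UNIV (\<lambda>x. frechet_derivative \<psi> (at x) b)"
proof -
  have "Ck 0 \<psi>" "Ck (Suc 0) \<psi>" using assms unfolding test_functions_def by blast+
  then show "continuous_on UNIV \<psi>" "b \<in> Basis \<Longrightarrow> continuous_on UNIV (\<lambda>x. frechet_derivative \<psi> (at x) b)"
    by auto
qed

text \<open>
  A derivative vanishes on the open complement of the closed support, so one compact set serves the function
  and its partial derivatives.
\<close>
lemma test_function_support:
  assumes "\<psi> \<in> test_functions \<Omega>"
  obtains K where "compact K" "K \<subseteq> \<Omega>" "\<And>x. x \<notin> K \<Longrightarrow> \<psi> x = 0"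
    "\<And>x h. x \<notin> K \<Longrightarrow> frechet_derivative \<psi> (at x) h = 0"
proof
  let ?K = "closure {x. \<psi> x \<noteq> 0}"
  show "compact ?K" "?K \<subseteq> \<Omega>" using assms by (auto simp: test_functions_def)
  show 0: "\<psi> x = 0" if "x \<notin> ?K" for x using that closure_subset[of "{x. \<psi> x \<noteq> 0}"] by blast
  show "frechet_derivative \<psi> (at x) h = 0" if x: "x \<notin> ?K" for x h
  proof -
    have "((\<lambda>_. 0) has_derivative (\<lambda>_. 0)) (at x)" by simp
    then have "(\<psi> has_derivative (\<lambda>_. 0)) (at x)"
    proof (rule has_derivative_transform_within_open)
      show "open (- ?K)" by (intro open_Compl closed_closure)
      show "x \<in> - ?K" using x by (simp only: Compl_iff not_False_eq_True)
      show "0 = \<psi> y" if "y \<in> - ?K" for y using 0[of y] that by simp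
    qed
    then show ?thesis using frechet_derivative_at by metis
  qed
qed

lemma locally_integrable_mult_compact_support:
  fixes g h :: "'a::euclidean_space \<Rightarrow> real"
  assumes g: "locally_integrable \<Omega> g" and \<Omega>: "\<Omega> \<in> sets lebesgue" and h: "continuous_on UNIV h"
    and K: "compact K" "K \<subseteq> \<Omega>" "\<And>x. x \<notin> K \<Longrightarrow> h x = 0"
  shows "integrable (lebesgue_on \<Omega>) (\<lambda>x. g x * h x)"
proof -
  have [measurable]: "K \<in> sets lebesgue" using K(1) by (simp add: borel_compact)
  have h_meas: "h \<in> borel_measurable (lebesgue_on K)"
    using h by (intro continuous_imp_measurable_on_sets_lebesgue) (auto intro: continuous_on_subset)
  have gK: "integrable (lebesgue_on K) g" using g K by (auto simp: locally_integrable_def)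
  have "bounded (h ` K)" using compact_continuous_image[OF continuous_on_subset[OF h] K(1)]
    by (simp add: compact_imp_bounded)
  then obtain C where C: "\<And>x. x \<in> K \<Longrightarrow> \<bar>h x\<bar> \<le> C" unfolding bounded_iff by auto
  have "integrable (lebesgue_on K) (\<lambda>x. g x * h x)"
  proof (rule Bochner_Integration.integrable_bound)
    show "integrable (lebesgue_on K) (\<lambda>x. C * norm (g x))" using gK by simp
    show "AE x in lebesgue_on K. norm (g x * h x) \<le> norm (C * norm (g x))"
    proof (rule AE_I2)
      fix x assume "x \<in> space (lebesgue_on K)"
      then have "\<bar>h x\<bar> \<le> C" using C by simp
      then show "norm (g x * h x) \<le> norm (C * norm (g x))"
        by (simp add: abs_mult) (metis abs_ge_self abs_ge_zero mult.commute mult_left_mono order_trans)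
    qed
  qed (use gK h_meas in measurable)
  then have "integrable lebesgue (\<lambda>x. if x \<in> K then g x * h x else 0)"
    by (subst Lebesgue_Measure.integrable_restrict_UNIV) auto
  also have "(\<lambda>x. if x \<in> K then g x * h x else 0) = (\<lambda>x. if x \<in> \<Omega> then g x * h x else 0)"
    using K by (intro ext) auto
  finally show ?thesis using \<Omega> by (simp add: Lebesgue_Measure.integrable_restrict_UNIV)
qed

lemma locally_integrable_mult_test_function:
  fixes g :: "'a::euclidean_space \<Rightarrow> real"
  assumes "locally_integrable \<Omega> g" "\<Omega> \<in> sets lebesgue" "\<psi> \<in> test_functions \<Omega>"
  shows "integrable (lebesgue_on \<Omega>) (\<lambda>x. g x * \<psi> x)"
    and "b \<in> Basis \<Longrightarrow> integrable (lebesgue_on \<Omega>) (\<lambda>x. g x * frechet_derivative \<psi> (at x) b)"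
proof -
  obtain K where K: "compact K" "K \<subseteq> \<Omega>" "\<And>x. x \<notin> K \<Longrightarrow> \<psi> x = 0"
    "\<And>x h. x \<notin> K \<Longrightarrow> frechet_derivative \<psi> (at x) h = 0"
    using test_function_support[OF assms(3)] by metis
  show "integrable (lebesgue_on \<Omega>) (\<lambda>x. g x * \<psi> x)"
    using K by (intro locally_integrable_mult_compact_support[OF assms(1,2) test_function_continuous(1)[OF assms(3)]])
  show "b \<in> Basis \<Longrightarrow> integrable (lebesgue_on \<Omega>) (\<lambda>x. g x * frechet_derivative \<psi> (at x) b)"
    using K by (intro locally_integrable_mult_compact_support[OF assms(1,2) test_function_continuous(2)[OF assms(3)]])
qed

text \<open>
  An open set is a countable union of compact boxes, on each of which the function is measurable.
\<close>
lemma locally_integrable_measurable: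
  assumes "open \<Omega>" "locally_integrable \<Omega> g"
  shows "g \<in> borel_measurable (lebesgue_on \<Omega>)"
proof -
  obtain D where D: "countable D" "D \<subseteq> Pow \<Omega>" "\<And>X. X \<in> D \<Longrightarrow> \<exists>a b. X = cbox a b" "\<Union>D = \<Omega>"
    using open_countable_Union_open_cbox[OF assms(1)] by metis
  show ?thesis
  proof (rule measurable_piecewise_restrict[OF D(1)])
    fix X assume X: "X \<in> D"
    then have sub: "compact X" "X \<subseteq> \<Omega>" "X \<in> sets lebesgue" using D by fastforce+
    then show "X \<inter> space (lebesgue_on \<Omega>) \<in> sets (lebesgue_on \<Omega>)"
      using assms(1) by (auto simp: sets_restrict_space_iff Int_absorb2)
    have "integrable (lebesgue_on X) g" using assms(2) sub by (auto simp: locally_integrable_def)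
    moreover have "restrict_space (lebesgue_on \<Omega>) X = lebesgue_on X"
      using sub assms(1) by (subst restrict_restrict_space) (auto simp: Int_absorb1)
    ultimately show "g \<in> borel_measurable (restrict_space (lebesgue_on \<Omega>) X)" by simp
  qed (use D(4) in auto)
qed

lemma locally_integrable_linear:
  "locally_integrable \<Omega> g \<Longrightarrow> bounded_linear T \<Longrightarrow> locally_integrable \<Omega> (\<lambda>x. T (g x))"
  unfolding locally_integrable_def using integrable_bounded_linear[of T _ g] by simp

lemma locally_integrable_add:
  "locally_integrable \<Omega> g \<Longrightarrow> locally_integrable \<Omega> h \<Longrightarrow> locally_integrable \<Omega> (\<lambda>x. g x + h x)"
  unfolding locally_integrable_def by (blast intro: Bochner_Integration.integrable_add)

lemma locally_integrable_diff:
  "locally_integrable \<Omega> g \<Longrightarrow> locally_integrable \<Omega> h \<Longrightarrow> locally_integrable \<Omega> (\<lambda>x. g x - h x)"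
  unfolding locally_integrable_def by (blast intro: Bochner_Integration.integrable_diff)

lemma L2_space_locally_integrable:
  assumes "\<Omega> \<in> lmeasurable" "g \<in> L2_space \<Omega>"
  shows "locally_integrable \<Omega> g"
  unfolding locally_integrable_def
proof (intro allI impI)
  fix K :: "'a set" assume K: "compact K \<and> K \<subseteq> \<Omega>"
  then have [measurable]: "K \<in> sets lebesgue" by (simp add: borel_compact)
  have "set_integrable lebesgue \<Omega> g" "\<Omega> \<in> sets lebesgue"
    using L2_space_integrable(1)[OF assms] assms(1)
    by (auto simp: set_integrable_def integrable_restrict_space)
  then have "set_integrable lebesgue K g" using K by (auto intro: set_integrable_subset)
  then show "integrable (lebesgue_on K) g"
    by (simp add: set_integrable_def integrable_restrict_space)
qed

text \<open>
  Boxes form a generator of the Borel sets that is stable under intersection, so vanishing integrals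
  propagate from boxes to all Borel sets.
\<close>
lemma integral_boxes_zero_imp_AE_zero:
  fixes g :: "'a::euclidean_space \<Rightarrow> real"
  assumes g: "integrable lebesgue g"
    and boxes: "\<And>c d. (LINT x|lebesgue. indicator (box c d) x * g x) = 0"
    and total: "(LINT x|lebesgue. g x) = 0"
  shows "AE x in lebesgue. g x = 0"
proof -
  \<comment> \<open>Boxes generate the Borel sets only, hence the passage to a Borel representative.\<close>
  obtain g' where g'[measurable]: "g' \<in> borel_measurable lborel" and eq: "AE x in lborel. g x = g' x"
    using completion_ex_borel_measurable_real[of g lborel] g by auto
  have eqc: "AE x in lebesgue. g x = g' x" using AE_completion[OF eq] .
  have gmeas: "g \<in> borel_measurable lebesgue" using g by simp
  have g'meas: "g' \<in> borel_measurable lebesgue" using g' by (rule measurable_completion)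
  have int': "integrable lborel g'"
    using g eqc integrable_cong_AE[OF gmeas g'meas eqc] integrable_completion[OF g'] by simp
  have tr: "(LINT x|lborel. indicator A x * g' x) = (LINT x|lebesgue. indicator A x * g x)"
    if [measurable]: "A \<in> sets borel" for A
  proof -
    have "(LINT x|lborel. indicator A x * g' x) = (LINT x|lebesgue. indicator A x * g' x)"
      by (rule integral_completion[symmetric]) measurable
    also have "\<dots> = (LINT x|lebesgue. indicator A x * g x)"
    proof (rule integral_cong_AE)
      show "(\<lambda>x. indicator A x * g' x) \<in> borel_measurable lebesgue"
        by (intro measurable_completion) measurable
      have "indicator A \<in> borel_measurable lebesgue" by (intro measurable_completion) measurable
      then show "(\<lambda>x. indicator A x * g x) \<in> borel_measurable lebesgue"
        using gmeas by (rule borel_measurable_times)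
    qed (use eqc in \<open>eventually_elim, simp\<close>)
    finally show ?thesis .
  qed
  have setint: "set_integrable lborel A g'" if "A \<in> sets borel" for A
    unfolding set_integrable_def using int' that by (intro integrable_mult_indicator) auto
  have zero: "(LINT x|lborel. indicator A x * g' x) = 0" if A: "A \<in> sets borel" for A
  proof -
    let ?G = "range (\<lambda>(a, b). box a b :: 'a set)"
    have sub: "sigma_sets UNIV ?G = sets borel" by (simp add: borel_eq_box)
    have "Int_stable ?G" by (auto simp: Int_stable_def box_Int_box)
    moreover have "?G \<subseteq> Pow UNIV" by simp
    moreover have "A \<in> sigma_sets UNIV ?G" using A sub by simp
    ultimately show ?thesis
    proof (induction rule: sigma_sets_induct_disjoint)
      case (basic A)
      then show ?case using boxes tr by auto
    next
      case (compl A)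
      then have [measurable]: "A \<in> sets borel" using sub by simp
      have "(LINT x|lborel. indicator (UNIV - A) x * g' x) = (LINT x|lborel. g' x - indicator A x * g' x)"
        by (intro Bochner_Integration.integral_cong) (auto simp: indicator_def)
      also have "\<dots> = (LINT x|lborel. g' x) - (LINT x|lborel. indicator A x * g' x)"
        using int' setint[of A] by (simp add: set_integrable_def)
      also have "(LINT x|lborel. g' x) = 0" using tr[of UNIV] total by simp
      finally show ?case using compl by simp
    next
      case (union A)
      then have A: "\<And>i. A i \<in> sets borel" using sub by auto
      then have "(LINT x:(\<Union>i. A i)|lborel. g' x) = (\<Sum>i. (LINT x:(A i)|lborel. g' x))"
        using union(1) setint by (intro lebesgue_integral_countable_add) (auto simp: disjoint_family_on_def)
      then show ?case using union by (simp add: set_lebesgue_integral_def)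
    qed simp
  qed
  have "AE x in lborel. g' x = 0"
    using zero by (intro density_unique_real[OF int']) (simp_all add: set_lebesgue_integral_def)
  then have "AE x in lebesgue. g' x = 0" by (rule AE_completion)
  with eqc show ?thesis by eventually_elim simp
qed

text \<open>
  The fundamental lemma of the calculus of variations.  Bumps of a box inside \<open>\<Omega>\<close> are test functions and
  converge to its indicator, so the integral of \<open>g\<close> over such a box vanishes; countably many boxes cover \<open>\<Omega>\<close>.
\<close>
lemma orthogonal_to_test_functions_imp_AE_zero:
  fixes g :: "'a::euclidean_space \<Rightarrow> real"
  assumes \<Omega>: "open \<Omega>" and g: "locally_integrable \<Omega> g"
    and orth: "\<And>\<psi>. \<psi> \<in> test_functions \<Omega> \<Longrightarrow> (LINT x|lebesgue_on \<Omega>. g x * \<psi> x) = 0"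
  shows "AE x in lebesgue_on \<Omega>. g x = 0"
proof -
  have [measurable]: "\<Omega> \<in> sets lebesgue" using \<Omega> by simp
  have sub_zero: "(LINT x|lebesgue. indicator (box a b) x * g x) = 0" if ab: "cbox a b \<subseteq> \<Omega>" for a b
  proof -
    have int: "integrable lebesgue (\<lambda>x. indicator (cbox a b) x * g x)"
      using g ab integrable_restrict_space[of "cbox a b" lebesgue g]
      by (auto simp: locally_integrable_def)
    have box_meas: "indicator (box a b) \<in> borel_measurable lebesgue"
      by (intro measurable_completion) measurable
    have cbox_meas: "(\<lambda>x. indicator (cbox a b) x * g x) \<in> borel_measurable lebesgue"
      using int by (rule borel_measurable_integrable)
    have "(\<lambda>k. LINT x|lebesgue. box_bump a b k x * (indicator (cbox a b) x * g x))
        \<longlonglongrightarrow> (LINT x|lebesgue. indicator (box a b) x * (indicator (cbox a b) x * g x))"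
    proof (rule integral_dominated_convergence)
      show "integrable lebesgue (\<lambda>x. \<bar>indicator (cbox a b) x * g x\<bar>)" using int by simp
      show "(\<lambda>x. indicator (box a b) x * (indicator (cbox a b) x * g x)) \<in> borel_measurable lebesgue"
        using box_meas cbox_meas by (rule borel_measurable_times)
      have "box_bump a b k \<in> borel_measurable borel" for k
        using box_bump_Ck[of 0 a b k] by (auto intro: borel_measurable_continuous_onI)
      then have "box_bump a b k \<in> borel_measurable lebesgue" for k
        by (simp add: measurable_completion)
      then show "(\<lambda>x. box_bump a b k x * (indicator (cbox a b) x * g x)) \<in> borel_measurable lebesgue" for k
        using cbox_meas by (rule borel_measurable_times)
      show "AE x in lebesgue. (\<lambda>k. box_bump a b k x * (indicator (cbox a b) x * g x))
          \<longlonglongrightarrow> indicator (box a b) x * (indicator (cbox a b) x * g x)"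
        by (intro AE_I2 tendsto_mult box_bump_tendsto tendsto_const)
      show "AE x in lebesgue. norm (box_bump a b k x * (indicator (cbox a b) x * g x))
          \<le> \<bar>indicator (cbox a b) x * g x\<bar>" for k
        using box_bump_bounds[of a b k]
        by (intro AE_I2) (auto simp: abs_mult mult_left_le_one_le)
    qed
    moreover have "(LINT x|lebesgue. box_bump a b k x * (indicator (cbox a b) x * g x)) = 0" for k
    proof -
      have "0 = (LINT x|lebesgue_on \<Omega>. g x * box_bump a b k x)"
        using orth[OF box_bump_test_function[OF ab]] by simp
      also have "\<dots> = (LINT x|lebesgue. indicator \<Omega> x *\<^sub>R (g x * box_bump a b k x))"
        by (simp add: integral_restrict_space)
      also have "\<dots> = (LINT x|lebesgue. box_bump a b k x * (indicator (cbox a b) x * g x))"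
      proof (rule Bochner_Integration.integral_cong)
        fix x
        show "indicator \<Omega> x *\<^sub>R (g x * box_bump a b k x) = box_bump a b k x * (indicator (cbox a b) x * g x)"
          using ab box_subset_cbox[of a b] box_bump_eq_0[of x a b k]
          by (cases "x \<in> box a b") (auto simp: indicator_def)
      qed simp
      finally show ?thesis by simp
    qed
    ultimately have "(LINT x|lebesgue. indicator (box a b) x * (indicator (cbox a b) x * g x)) = 0"
      by (simp add: LIMSEQ_const_iff)
    also have "(\<lambda>x. indicator (box a b) x * (indicator (cbox a b) x * g x)) = (\<lambda>x. indicator (box a b) x * g x)"
      using box_subset_cbox[of a b] by (intro ext) (auto simp: indicator_def)
    finally show ?thesis .
  qed
  have on_box: "AE x in lebesgue. x \<in> cbox a b \<longrightarrow> g x = 0" if ab: "cbox a b \<subseteq> \<Omega>" for a b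
  proof -
    have int: "integrable lebesgue (\<lambda>x. indicator (cbox a b) x *\<^sub>R g x)"
      using g ab integrable_restrict_space[of "cbox a b" lebesgue g]
      by (auto simp: locally_integrable_def)
    have "integrable lebesgue (\<lambda>x. indicator (box a b) x *\<^sub>R (indicator (cbox a b) x *\<^sub>R g x))"
      by (rule integrable_mult_indicator[OF _ int]) simp
    also have "(\<lambda>x. indicator (box a b) x *\<^sub>R (indicator (cbox a b) x *\<^sub>R g x)) = (\<lambda>x. indicator (box a b) x * g x)"
      using box_subset_cbox[of a b] by (intro ext) (auto simp: indicator_def)
    finally have int': "integrable lebesgue (\<lambda>x. indicator (box a b) x * g x)" .
    have "AE x in lebesgue. indicator (box a b) x * g x = 0"
    proof (rule integral_boxes_zero_imp_AE_zero[OF int'])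
      show "(LINT x|lebesgue. indicator (box a b) x * g x) = 0" by (rule sub_zero[OF ab])
      fix c d
      \<comment> \<open>The integrand lives on \<open>box a b\<close>, and a nonempty intersection of boxes has its closure in \<open>cbox a b\<close>.\<close>
      obtain e f where ef: "box c d \<inter> box a b = box e f" using box_Int_box[of c d a b] by blast
      have "(LINT x|lebesgue. indicator (box e f) x * g x) = 0"
      proof (cases "box e f = {}")
        case False
        then have "cbox e f = closure (box e f)" by simp
        also have "\<dots> \<subseteq> cbox a b"
          using ef box_subset_cbox[of a b] by (intro closure_minimal) auto
        finally show ?thesis using ab sub_zero by blast
      qed simp
      also have "(\<lambda>x. indicator (box e f) x * g x) = (\<lambda>x. indicator (box c d) x * (indicator (box a b) x * g x))"
        by (intro ext) (auto simp: ef[symmetric] indicator_def)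
      finally show "(LINT x|lebesgue. indicator (box c d) x * (indicator (box a b) x * g x)) = 0" .
    qed
    moreover have "AE x in lebesgue. x \<notin> cbox a b - box a b"
      using negligible_frontier_interval[of a b] by (intro AE_not_in) (simp add: negligible_iff_null_sets)
    ultimately show ?thesis by eventually_elim (auto simp: indicator_def)
  qed
  obtain D where D: "countable D" "D \<subseteq> Pow \<Omega>" "\<And>X. X \<in> D \<Longrightarrow> \<exists>a b. X = cbox a b" "\<Union>D = \<Omega>"
    using open_countable_Union_open_cbox[OF \<Omega>] by metis
  have "AE x in lebesgue. \<forall>X\<in>D. x \<in> X \<longrightarrow> g x = 0"
  proof (subst AE_ball_countable[OF D(1)], rule ballI)
    fix X assume "X \<in> D"
    then obtain a b where "X = cbox a b" "cbox a b \<subseteq> \<Omega>" using D by blast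
    then show "AE x in lebesgue. x \<in> X \<longrightarrow> g x = 0" using on_box by simp
  qed
  then have "AE x in lebesgue. x \<in> \<Omega> \<longrightarrow> g x = 0"
    by eventually_elim (use D(4) in blast)
  then show ?thesis by (simp add: AE_restrict_space_iff)
qed

lemma weak_gradient_unique:
  assumes \<Omega>: "open \<Omega>" and g: "is_weak_gradient \<Omega> u g" and h: "is_weak_gradient \<Omega> u h"
  shows "AE x in lebesgue_on \<Omega>. g x = h x"
proof -
  have sets: "\<Omega> \<in> sets lebesgue" using \<Omega> by simp
  have "AE x in lebesgue_on \<Omega>. (g x - h x) \<bullet> b = 0" if b: "b \<in> Basis" for b
  proof (rule orthogonal_to_test_functions_imp_AE_zero[OF \<Omega>])
    have lg: "locally_integrable \<Omega> (\<lambda>x. g x \<bullet> b)" "locally_integrable \<Omega> (\<lambda>x. h x \<bullet> b)"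
      using g h by (auto simp: is_weak_gradient_def intro: locally_integrable_linear bounded_linear_inner_left)
    then show "locally_integrable \<Omega> (\<lambda>x. (g x - h x) \<bullet> b)"
      unfolding inner_diff_left by (rule locally_integrable_diff)
    fix \<psi> assume \<psi>: "\<psi> \<in> test_functions \<Omega>"
    have "(LINT x|lebesgue_on \<Omega>. (g x - h x) \<bullet> b * \<psi> x)
        = (LINT x|lebesgue_on \<Omega>. (g x \<bullet> b) * \<psi> x) - (LINT x|lebesgue_on \<Omega>. (h x \<bullet> b) * \<psi> x)"
      using locally_integrable_mult_test_function(1)[OF _ sets \<psi>] lg
      by (simp add: inner_diff_left left_diff_distrib)
    also have "\<dots> = 0"
    proof -
      have "(LINT x|lebesgue_on \<Omega>. u x * frechet_derivative \<psi> (at x) b) = - (LINT x|lebesgue_on \<Omega>. (g x \<bullet> b) * \<psi> x)"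
        "(LINT x|lebesgue_on \<Omega>. u x * frechet_derivative \<psi> (at x) b) = - (LINT x|lebesgue_on \<Omega>. (h x \<bullet> b) * \<psi> x)"
        using g h \<psi> b unfolding is_weak_gradient_def by blast+
      then show ?thesis by simp
    qed
    finally show "(LINT x|lebesgue_on \<Omega>. (g x - h x) \<bullet> b * \<psi> x) = 0" .
  qed
  then have "AE x in lebesgue_on \<Omega>. \<forall>b\<in>Basis. (g x - h x) \<bullet> b = 0"
    by (subst AE_ball_countable) (auto intro: countable_finite)
  then show ?thesis by eventually_elim (metis euclidean_all_zero_iff right_minus_eq)
qed

lemma weak_gradient_add:
  assumes \<Omega>: "open \<Omega>" and u: "is_weak_gradient \<Omega> u g" and v: "is_weak_gradient \<Omega> v h"
  shows "is_weak_gradient \<Omega> (\<lambda>x. u x + v x) (\<lambda>x. g x + h x)"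
  unfolding is_weak_gradient_def
proof (intro conjI ballI)
  have sets: "\<Omega> \<in> sets lebesgue" using \<Omega> by simp
  have loc: "locally_integrable \<Omega> u" "locally_integrable \<Omega> v" "locally_integrable \<Omega> g" "locally_integrable \<Omega> h"
    using u v by (auto simp: is_weak_gradient_def)
  then show "locally_integrable \<Omega> (\<lambda>x. u x + v x)" "locally_integrable \<Omega> (\<lambda>x. g x + h x)"
    by (auto intro: locally_integrable_add)
  fix \<psi> and b :: 'a assume \<psi>: "\<psi> \<in> test_functions \<Omega>" and b: "b \<in> Basis"
  have "locally_integrable \<Omega> (\<lambda>x. g x \<bullet> b)" "locally_integrable \<Omega> (\<lambda>x. h x \<bullet> b)"
    using loc by (auto intro: locally_integrable_linear bounded_linear_inner_left)
  note int = this[THEN locally_integrable_mult_test_function(1)[OF _ sets \<psi>]]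
    loc(1,2)[THEN locally_integrable_mult_test_function(2)[OF _ sets \<psi> b]]
  show "(LINT x|lebesgue_on \<Omega>. (u x + v x) * frechet_derivative \<psi> (at x) b)
      = - (LINT x|lebesgue_on \<Omega>. ((g x + h x) \<bullet> b) * \<psi> x)"
    using u v \<psi> b int by (simp add: is_weak_gradient_def inner_add_left distrib_right)
qed

lemma weak_gradient_scale:
  assumes "is_weak_gradient \<Omega> u g"
  shows "is_weak_gradient \<Omega> (\<lambda>x. c * u x) (\<lambda>x. c *\<^sub>R g x)"
proof -
  have "locally_integrable \<Omega> (\<lambda>x. c * u x)" "locally_integrable \<Omega> (\<lambda>x. c *\<^sub>R g x)"
    using assms locally_integrable_linear[OF _ bounded_linear_mult_right[of c], of \<Omega> u]
      locally_integrable_linear[OF _ bounded_linear_scaleR_right[of c], of \<Omega> g]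
    by (simp_all add: is_weak_gradient_def)
  then show ?thesis using assms unfolding is_weak_gradient_def by (simp add: mult.assoc)
qed

lemma weak_gradient_cong_AE:
  assumes \<Omega>: "open \<Omega>" and u: "is_weak_gradient \<Omega> u g" and ae: "AE x in lebesgue_on \<Omega>. u x = v x"
    and v: "locally_integrable \<Omega> v"
  shows "is_weak_gradient \<Omega> v g"
  unfolding is_weak_gradient_def
proof (intro conjI ballI)
  have sets: "\<Omega> \<in> sets lebesgue" using \<Omega> by simp
  show "locally_integrable \<Omega> g" "locally_integrable \<Omega> v" using u v by (auto simp: is_weak_gradient_def)
  fix \<psi> and b :: 'a assume \<psi>: "\<psi> \<in> test_functions \<Omega>" and b: "b \<in> Basis"
  have "locally_integrable \<Omega> u" using u by (simp add: is_weak_gradient_def)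
  note int = this v
  note int = int[THEN locally_integrable_mult_test_function(2)[OF _ sets \<psi> b]]
  have "(LINT x|lebesgue_on \<Omega>. v x * frechet_derivative \<psi> (at x) b)
      = (LINT x|lebesgue_on \<Omega>. u x * frechet_derivative \<psi> (at x) b)"
    using int ae by (intro integral_cong_AE) (auto elim: eventually_mono)
  then show "(LINT x|lebesgue_on \<Omega>. v x * frechet_derivative \<psi> (at x) b)
      = - (LINT x|lebesgue_on \<Omega>. (g x \<bullet> b) * \<psi> x)"
    using u \<psi> b by (simp add: is_weak_gradient_def)
qed

lemma wgrad_is_weak_gradient: "is_weak_gradient \<Omega> u g \<Longrightarrow> is_weak_gradient \<Omega> u (wgrad \<Omega> u)"
  unfolding wgrad_def by (rule someI[of "is_weak_gradient \<Omega> u"])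

text \<open>
  By uniqueness, the arbitrary choice in \<open>wgrad\<close> is invisible almost everywhere.  Linearity of the weak
  gradient and its invariance under modification on null sets enter through this lemma.
\<close>
lemma wgrad_AE_eq:
  assumes "open \<Omega>" "is_weak_gradient \<Omega> u g"
  shows "AE x in lebesgue_on \<Omega>. wgrad \<Omega> u x = g x"
  by (rule weak_gradient_unique[OF assms(1) wgrad_is_weak_gradient[OF assms(2)] assms(2)])

lemma wgrad_L2:
  assumes "open \<Omega>" "is_weak_gradient \<Omega> u g" "g \<in> L2_space \<Omega>"
  shows "wgrad \<Omega> u \<in> L2_space \<Omega>"
proof (rule L2_space_dominated[OF _ assms(3), of _ 1])
  show "wgrad \<Omega> u \<in> borel_measurable (lebesgue_on \<Omega>)"
    using wgrad_is_weak_gradient[OF assms(2)] assms(1)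
    by (intro locally_integrable_measurable) (simp_all add: is_weak_gradient_def)
  show "AE x in lebesgue_on \<Omega>. norm (wgrad \<Omega> u x) \<le> 1 * norm (g x)"
    using wgrad_AE_eq[OF assms(1,2)] by eventually_elim simp
qed

lemma H1_wgrad:
  assumes "open \<Omega>" "u \<in> H1 \<Omega>"
  shows "wgrad \<Omega> u \<in> L2_space \<Omega>" "is_weak_gradient \<Omega> u (wgrad \<Omega> u)" "u \<in> L2_space \<Omega>"
proof -
  obtain g where "g \<in> L2_space \<Omega>" "is_weak_gradient \<Omega> u g" "u \<in> L2_space \<Omega>"
    using assms(2) by (auto simp: H1_def)
  then show "wgrad \<Omega> u \<in> L2_space \<Omega>" "is_weak_gradient \<Omega> u (wgrad \<Omega> u)" "u \<in> L2_space \<Omega>"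
    using wgrad_L2[OF assms(1)] wgrad_is_weak_gradient by blast+
qed

lemma H1_I: "u \<in> L2_space \<Omega> \<Longrightarrow> is_weak_gradient \<Omega> u g \<Longrightarrow> g \<in> L2_space \<Omega> \<Longrightarrow> u \<in> H1 \<Omega>"
  unfolding H1_def by blast

lemma wgrad_add_AE:
  assumes "open \<Omega>" "u \<in> H1 \<Omega>" "v \<in> H1 \<Omega>"
  shows "AE x in lebesgue_on \<Omega>. wgrad \<Omega> (\<lambda>x. u x + v x) x = wgrad \<Omega> u x + wgrad \<Omega> v x"
  using assms by (intro wgrad_AE_eq weak_gradient_add H1_wgrad)

lemma wgrad_scale_AE:
  assumes "open \<Omega>" "u \<in> H1 \<Omega>"
  shows "AE x in lebesgue_on \<Omega>. wgrad \<Omega> (\<lambda>x. c * u x) x = c *\<^sub>R wgrad \<Omega> u x"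
  using assms by (intro wgrad_AE_eq weak_gradient_scale H1_wgrad)

lemma H1_add:
  assumes "open \<Omega>" "u \<in> H1 \<Omega>" "v \<in> H1 \<Omega>"
  shows "(\<lambda>x. u x + v x) \<in> H1 \<Omega>"
  using H1_wgrad[OF assms(1,2)] H1_wgrad[OF assms(1,3)] assms(1)
  by (intro H1_I[OF L2_space_add weak_gradient_add L2_space_add])

lemma H1_scale:
  assumes "open \<Omega>" "u \<in> H1 \<Omega>"
  shows "(\<lambda>x. c * u x) \<in> H1 \<Omega>"
  using H1_wgrad[OF assms] L2_space_scaleR[of u \<Omega> c]
  by (intro H1_I[OF _ weak_gradient_scale L2_space_scaleR]) auto

lemma H1_diff:
  assumes "open \<Omega>" "u \<in> H1 \<Omega>" "v \<in> H1 \<Omega>"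
  shows "(\<lambda>x. u x - v x) \<in> H1 \<Omega>"
  using H1_add[OF assms(1,2) H1_scale[OF assms(1,3), of "-1"]] by simp

lemma wgrad_diff_AE:
  assumes "open \<Omega>" "u \<in> H1 \<Omega>" "v \<in> H1 \<Omega>"
  shows "AE x in lebesgue_on \<Omega>. wgrad \<Omega> (\<lambda>x. u x - v x) x = wgrad \<Omega> u x - wgrad \<Omega> v x"
proof -
  have "AE x in lebesgue_on \<Omega>. wgrad \<Omega> (\<lambda>x. u x + (-1) * v x) x = wgrad \<Omega> u x + wgrad \<Omega> (\<lambda>x. (-1) * v x) x"
    by (intro wgrad_add_AE H1_scale assms)
  moreover have "AE x in lebesgue_on \<Omega>. wgrad \<Omega> (\<lambda>x. (-1) * v x) x = (-1) *\<^sub>R wgrad \<Omega> v x"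
    by (intro wgrad_scale_AE assms)
  ultimately show ?thesis by eventually_elim simp
qed

lemma H10_norm_diff:
  assumes "open \<Omega>" "u \<in> H1 \<Omega>" "v \<in> H1 \<Omega>"
  shows "H10_norm \<Omega> (\<lambda>x. u x - v x) = L2_norm \<Omega> (\<lambda>x. wgrad \<Omega> u x - wgrad \<Omega> v x)"
  unfolding H10_norm_def using assms
  by (intro L2_norm_cong_AE wgrad_diff_AE L2_spaceD(1) L2_space_diff H1_wgrad H1_diff)

section \<open>The gradient of a test function\<close>

definition grad :: "('a::euclidean_space \<Rightarrow> real) \<Rightarrow> 'a \<Rightarrow> 'a" where
  "grad \<psi> x = (\<Sum>b\<in>Basis. frechet_derivative \<psi> (at x) b *\<^sub>R b)"

lemma test_function_grad:
  assumes "\<psi> \<in> test_functions \<Omega>"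
  shows "(\<psi> has_derivative (\<lambda>h. grad \<psi> x \<bullet> h)) (at x)" "continuous_on UNIV (grad \<psi>)"
    "b \<in> Basis \<Longrightarrow> grad \<psi> x \<bullet> b = frechet_derivative \<psi> (at x) b"
proof -
  have d: "(\<psi> has_derivative frechet_derivative \<psi> (at x)) (at x)"
    by (rule test_function_has_derivative[OF assms])
  have lin: "linear (frechet_derivative \<psi> (at x))" using d by (rule has_derivative_linear)
  have "frechet_derivative \<psi> (at x) h = grad \<psi> x \<bullet> h" for h
  proof -
    have "frechet_derivative \<psi> (at x) h = frechet_derivative \<psi> (at x) (\<Sum>b\<in>Basis. (h \<bullet> b) *\<^sub>R b)"
      by (simp add: euclidean_representation)
    also have "\<dots> = (\<Sum>b\<in>Basis. (h \<bullet> b) * frechet_derivative \<psi> (at x) b)"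
      using lin by (simp add: linear_sum linear_scale)
    also have "\<dots> = grad \<psi> x \<bullet> h"
      unfolding grad_def inner_sum_left
      by (intro sum.cong) (simp_all add: inner_commute)
    finally show ?thesis .
  qed
  then have eq: "frechet_derivative \<psi> (at x) = (\<lambda>h. grad \<psi> x \<bullet> h)" by (rule ext)
  with d show "(\<psi> has_derivative (\<lambda>h. grad \<psi> x \<bullet> h)) (at x)" by simp
  show "b \<in> Basis \<Longrightarrow> grad \<psi> x \<bullet> b = frechet_derivative \<psi> (at x) b" by (simp add: eq)
  show "continuous_on UNIV (grad \<psi>)"
    unfolding grad_def by (intro continuous_on_sum continuous_on_scaleR test_function_continuous(2)[OF assms]
      continuous_on_const)
qed

lemma test_function_grad_support:
  assumes "\<psi> \<in> test_functions \<Omega>"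
  obtains K where "compact K" "K \<subseteq> \<Omega>" "\<And>x. x \<notin> K \<Longrightarrow> \<psi> x = 0" "\<And>x. x \<notin> K \<Longrightarrow> grad \<psi> x = 0"
proof -
  obtain K where K: "compact K" "K \<subseteq> \<Omega>" "\<And>x. x \<notin> K \<Longrightarrow> \<psi> x = 0"
    "\<And>x h. x \<notin> K \<Longrightarrow> frechet_derivative \<psi> (at x) h = 0"
    using test_function_support[OF assms] by metis
  show thesis by (rule that[OF K(1-3)]) (simp_all add: grad_def K(4))
qed

lemma continuous_compact_support_integrable:
  fixes h :: "'a::euclidean_space \<Rightarrow> 'b::euclidean_space"
  assumes h: "continuous_on UNIV h" and K: "compact K" "\<And>x. x \<notin> K \<Longrightarrow> h x = 0"
  shows "integrable lborel h"
proof -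
  have "integrable lborel (\<lambda>x. indicator K x *\<^sub>R h x)"
    using K(1) continuous_on_subset[OF h] by (intro borel_integrable_compact) auto
  also have "(\<lambda>x. indicator K x *\<^sub>R h x) = h"
    using K(2) by (intro ext) (auto simp: indicator_def)
  finally show ?thesis .
qed

lemma integral_lebesgue_on_compact_support:
  fixes h :: "'a::euclidean_space \<Rightarrow> 'b::euclidean_space"
  assumes h: "continuous_on UNIV h" and K: "compact K" "\<And>x. x \<notin> K \<Longrightarrow> h x = 0"
    and \<Omega>: "K \<subseteq> \<Omega>" "\<Omega> \<in> sets lebesgue"
  shows "integrable (lebesgue_on \<Omega>) h" "integral\<^sup>L (lebesgue_on \<Omega>) h = integral\<^sup>L lborel h"
proof -
  have int: "integrable lborel h" by (rule continuous_compact_support_integrable[OF h K])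
  have eq: "(\<lambda>x. indicator \<Omega> x *\<^sub>R h x) = h"
    using K(2) \<Omega>(1) by (intro ext) (auto simp: indicator_def)
  show "integrable (lebesgue_on \<Omega>) h"
    using \<Omega>(2) int by (subst integrable_restrict_space) (simp_all add: eq integrable_completion)
  show "integral\<^sup>L (lebesgue_on \<Omega>) h = integral\<^sup>L lborel h"
    using \<Omega>(2) int by (subst integral_restrict_space) (simp_all add: eq integral_completion)
qed

text \<open>
  The difference quotients in direction \<open>b\<close> have integral \<open>0\<close> by translation invariance of Lebesgue
  measure, and they converge to the partial derivative boundedly on a bounded set.
\<close>
lemma integral_partial_derivative_eq_0:
  fixes F :: "'a::euclidean_space \<Rightarrow> real"
  assumes F: "\<And>x. (F has_derivative F' x) (at x)" and cont: "continuous_on UNIV (\<lambda>x. F' x b)"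
    and K: "compact K" "\<And>x. x \<notin> K \<Longrightarrow> F x = 0" "\<And>x. x \<notin> K \<Longrightarrow> F' x b = 0" and b: "norm b = 1"
  shows "(LINT x|lborel. F' x b) = 0"
proof -
  define t where "t k = inverse (real (Suc k))" for k
  have t: "0 < t k" "t k \<le> 1" for k by (auto simp: t_def field_simps)
  have t0: "t \<longlonglongrightarrow> 0" unfolding t_def by (rule LIMSEQ_inverse_real_of_nat)
  define q where "q k x = (F (t k *\<^sub>R b + x) - F x) / t k" for k x
  have contF: "continuous_on UNIV F" using F by (intro has_derivative_continuous_on) (auto intro: has_derivative_at_withinI)
  have intF: "integrable lborel F" by (rule continuous_compact_support_integrable[OF contF K(1,2)])
  have "(LINT x|lborel. F (c + x)) = (LINT x|lborel. F x)" "integrable lborel (\<lambda>x. F (c + x))" for c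
  proof -
    have "integral\<^sup>L (distr lborel borel ((+) c)) F = (LINT x|lborel. F (c + x))"
      using intF by (intro integral_distr) auto
    then show "(LINT x|lborel. F (c + x)) = (LINT x|lborel. F x)" by (simp add: lborel_distr_plus)
    have "integrable (distr lborel borel ((+) c)) F" using intF by (simp add: lborel_distr_plus)
    then show "integrable lborel (\<lambda>x. F (c + x))"
      by (subst (asm) integrable_distr_eq) (use intF in auto)
  qed
  then have q0: "(LINT x|lborel. q k x) = 0" and qint: "integrable lborel (q k)" for k
    using intF by (simp_all add: q_def[abs_def])
  have qmeas: "q k \<in> borel_measurable lborel" for k
    using qint by (rule borel_measurable_integrable)
  obtain R where R: "\<And>x. x \<in> K \<Longrightarrow> norm x \<le> R" using compact_imp_bounded[OF K(1)] by (auto simp: bounded_iff)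
  have "bounded ((\<lambda>x. F' x b) ` K)"
    using compact_continuous_image[OF continuous_on_subset[OF cont] K(1)] by (simp add: compact_imp_bounded)
  then obtain C0 where C0: "\<And>x. x \<in> K \<Longrightarrow> \<bar>F' x b\<bar> \<le> C0" unfolding bounded_iff by auto
  define C where "C = max C0 0"
  have C: "\<bar>F' x b\<bar> \<le> C" for x using C0[of x] K(3)[of x] by (cases "x \<in> K") (auto simp: C_def)
  have line: "((\<lambda>s. F (s *\<^sub>R b + x)) has_field_derivative F' (s *\<^sub>R b + x) b) (at s)" for s x
  proof -
    have lin: "linear (F' (s *\<^sub>R b + x))" using F by (rule has_derivative_linear)
    have "((\<lambda>s. s *\<^sub>R b + x) has_derivative (\<lambda>h. h *\<^sub>R b)) (at s)"
      by (auto intro!: derivative_eq_intros)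
    from has_derivative_compose[OF this F] show ?thesis
      unfolding has_field_derivative_def
      by (rule has_derivative_eq_rhs) (simp add: fun_eq_iff linear_scale[OF lin])
  qed
  have "(\<lambda>k. LINT x|lborel. q k x) \<longlonglongrightarrow> (LINT x|lborel. F' x b)"
  proof (rule integral_dominated_convergence)
    show "integrable lborel (\<lambda>x. C * indicator (cball (0::'a) (R + 1)) x)"
      using emeasure_lborel_cball_finite[of "0::'a" "R + 1"]
      by (intro integrable_mult_right integrable_real_indicator) simp_all
    show "(\<lambda>x. F' x b) \<in> borel_measurable lborel"
      using cont by (simp add: borel_measurable_continuous_onI)
    show "q k \<in> borel_measurable lborel" for k by (rule qmeas)
    show "AE x in lborel. (\<lambda>k. q k x) \<longlonglongrightarrow> F' x b"
    proof (rule AE_I2)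
      fix x
      have "((\<lambda>s. (F (s *\<^sub>R b + x) - F (0 *\<^sub>R b + x)) / (s - 0)) \<longlongrightarrow> F' x b) (at 0)"
        using line[of x 0] by (simp add: has_field_derivative_iff)
      then have "((\<lambda>s. (F (s *\<^sub>R b + x) - F x) / s) \<longlongrightarrow> F' x b) (at 0)" by simp
      moreover have "filterlim t (at 0) sequentially"
        using t0 t(1) by (intro filterlim_atI always_eventually allI) (metis less_irrefl)+
      ultimately show "(\<lambda>k. q k x) \<longlonglongrightarrow> F' x b"
        unfolding q_def by (rule filterlim_compose)
    qed
    show "AE x in lborel. norm (q k x) \<le> C * indicator (cball 0 (R + 1)) x" for k
    proof (rule AE_I2)
      fix x
      show "norm (q k x) \<le> C * indicator (cball 0 (R + 1)) x"
      proof (cases "norm x \<le> R + 1")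
        case True
        obtain z where "F (t k *\<^sub>R b + x) - F (0 *\<^sub>R b + x) = (t k - 0) * F' (z *\<^sub>R b + x) b"
          using MVT2[of 0 "t k" "\<lambda>s. F (s *\<^sub>R b + x)" "\<lambda>s. F' (s *\<^sub>R b + x) b"] t(1) line by blast
        then have "q k x = F' (z *\<^sub>R b + x) b" using t(1)[of k] by (simp add: q_def)
        with True C show ?thesis by simp
      next
        case False
        have "norm (t k *\<^sub>R b + x) \<ge> norm x - t k"
          using norm_diff_ineq[of x "t k *\<^sub>R b"] t(1)[of k] b by (simp add: add.commute)
        then have "norm (t k *\<^sub>R b + x) > R" using False t(2)[of k] by linarith
        then have "t k *\<^sub>R b + x \<notin> K" "x \<notin> K" using R False by force+
        then show ?thesis using False K(2) by (simp add: q_def)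
      qed
    qed
  qed
  with q0 show ?thesis by (simp add: LIMSEQ_const_iff)
qed

text \<open>
  Integration by parts: by the product rule the two integrands add up to a partial derivative of \<open>\<phi> * \<psi>\<close>,
  whose integral is \<open>0\<close>.
\<close>
lemma grad_is_weak_gradient:
  assumes \<Omega>: "open \<Omega>" and \<phi>: "\<phi> \<in> test_functions \<Omega>"
  shows "is_weak_gradient \<Omega> \<phi> (grad \<phi>)"
  unfolding is_weak_gradient_def
proof (intro conjI ballI)
  have sets: "\<Omega> \<in> sets lebesgue" using \<Omega> by simp
  have loc: "locally_integrable \<Omega> h" if h: "continuous_on UNIV h" for h :: "'a \<Rightarrow> 'b::euclidean_space"
    unfolding locally_integrable_def
  proof (intro allI impI)
    fix K :: "'a set" assume K: "compact K \<and> K \<subseteq> \<Omega>"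
    then have [measurable]: "K \<in> sets borel" by (simp add: borel_compact)
    have *: "integrable lborel (\<lambda>x. indicator K x *\<^sub>R h x)"
      using K continuous_on_subset[OF h] by (intro borel_integrable_compact) auto
    show "integrable (lebesgue_on K) h"
      using * K by (subst integrable_restrict_space) (auto intro!: integrable_completion[THEN iffD2])
  qed
  show "locally_integrable \<Omega> \<phi>" "locally_integrable \<Omega> (grad \<phi>)"
    using test_function_continuous(1)[OF \<phi>] test_function_grad(2)[OF \<phi>] by (auto intro: loc)
  fix \<psi> and b :: 'a assume \<psi>: "\<psi> \<in> test_functions \<Omega>" and b: "b \<in> Basis"
  obtain K where K: "compact K" "K \<subseteq> \<Omega>" "\<And>x. x \<notin> K \<Longrightarrow> \<psi> x = 0" "\<And>x. x \<notin> K \<Longrightarrow> grad \<psi> x = 0"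
    using test_function_grad_support[OF \<psi>] by metis
  note cont = test_function_continuous(1)[OF \<phi>] test_function_grad(2)[OF \<phi>]
    test_function_continuous(1)[OF \<psi>] test_function_grad(2)[OF \<psi>]
  have c: "continuous_on UNIV (\<lambda>x. \<phi> x * (grad \<psi> x \<bullet> b))" "continuous_on UNIV (\<lambda>x. (grad \<phi> x \<bullet> b) * \<psi> x)"
    by (intro continuous_intros cont)+
  have d: "((\<lambda>x. \<phi> x * \<psi> x) has_derivative (\<lambda>h. \<phi> x * (grad \<psi> x \<bullet> h) + (grad \<phi> x \<bullet> h) * \<psi> x)) (at x)" for x
    by (rule has_derivative_mult[OF test_function_grad(1)[OF \<phi>] test_function_grad(1)[OF \<psi>]])
  have "(LINT x|lborel. \<phi> x * (grad \<psi> x \<bullet> b) + (grad \<phi> x \<bullet> b) * \<psi> x) = 0"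
    by (rule integral_partial_derivative_eq_0[OF d, of b K])
       (use K b in \<open>auto intro!: continuous_on_add c\<close>)
  moreover have "(LINT x|lborel. \<phi> x * (grad \<psi> x \<bullet> b) + (grad \<phi> x \<bullet> b) * \<psi> x)
      = (LINT x|lborel. \<phi> x * (grad \<psi> x \<bullet> b)) + (LINT x|lborel. (grad \<phi> x \<bullet> b) * \<psi> x)"
    by (intro Bochner_Integration.integral_add continuous_compact_support_integrable[OF c(1) K(1)]
        continuous_compact_support_integrable[OF c(2) K(1)]) (simp_all add: K)
  moreover have "(LINT x|lebesgue_on \<Omega>. \<phi> x * frechet_derivative \<psi> (at x) b) = (LINT x|lborel. \<phi> x * (grad \<psi> x \<bullet> b))"
    using integral_lebesgue_on_compact_support(2)[OF c(1) K(1) _ K(2) sets] K(4)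
    by (simp add: test_function_grad(3)[OF \<psi> b])
  moreover have "(LINT x|lebesgue_on \<Omega>. (grad \<phi> x \<bullet> b) * \<psi> x) = (LINT x|lborel. (grad \<phi> x \<bullet> b) * \<psi> x)"
    using integral_lebesgue_on_compact_support(2)[OF c(2) K(1) _ K(2) sets] K(3) by simp
  ultimately show "(LINT x|lebesgue_on \<Omega>. \<phi> x * frechet_derivative \<psi> (at x) b)
      = - (LINT x|lebesgue_on \<Omega>. (grad \<phi> x \<bullet> b) * \<psi> x)" by simp
qed

lemma test_function_L2:
  assumes \<Omega>: "open \<Omega>" and \<phi>: "\<phi> \<in> test_functions \<Omega>"
  shows "\<phi> \<in> L2_space \<Omega>" "grad \<phi> \<in> L2_space \<Omega>" "\<phi> \<in> H1 \<Omega>"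
proof -
  have sets: "\<Omega> \<in> sets lebesgue" using \<Omega> by simp
  obtain K where K: "compact K" "K \<subseteq> \<Omega>" "\<And>x. x \<notin> K \<Longrightarrow> \<phi> x = 0" "\<And>x. x \<notin> K \<Longrightarrow> grad \<phi> x = 0"
    using test_function_grad_support[OF \<phi>] by metis
  note cont = test_function_continuous(1)[OF \<phi>] test_function_grad(2)[OF \<phi>]
  have c: "continuous_on UNIV (\<lambda>x. (norm (\<phi> x))\<^sup>2)" "continuous_on UNIV (\<lambda>x. (norm (grad \<phi> x))\<^sup>2)"
    by (intro continuous_intros cont)+
  show 1: "\<phi> \<in> L2_space \<Omega>" "grad \<phi> \<in> L2_space \<Omega>"
    using integral_lebesgue_on_compact_support(1)[OF c(1) K(1) _ K(2) sets] K(3)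
      integral_lebesgue_on_compact_support(1)[OF c(2) K(1) _ K(2) sets] K(4)
      integral_lebesgue_on_compact_support(1)[OF cont(1) K(1) _ K(2) sets]
      integral_lebesgue_on_compact_support(1)[OF cont(2) K(1) _ K(2) sets]
    unfolding L2_space_def by simp_all
  show "\<phi> \<in> H1 \<Omega>"
    by (rule H1_I[OF 1(1) grad_is_weak_gradient[OF \<Omega> \<phi>] 1(2)])
qed

section \<open>Sobolev inequalities in dimensions two and three\<close>

lemma product_sigma_finite_lborel: "product_sigma_finite (\<lambda>b. lborel :: real measure)"
  by (simp add: product_sigma_finite_def sigma_finite_lborel)

lemma nn_integral_lborel_Basis2:
  fixes f :: "'a::euclidean_space \<Rightarrow> ennreal"
  assumes B: "Basis = {e1, e2 :: 'a}" "e1 \<noteq> e2" and [measurable]: "f \<in> borel_measurable borel"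
  shows "(\<integral>\<^sup>+x. f x \<partial>lborel) = (\<integral>\<^sup>+t. \<integral>\<^sup>+s. f (s *\<^sub>R e1 + t *\<^sub>R e2) \<partial>lborel \<partial>lborel)"
proof -
  interpret product_sigma_finite "\<lambda>b::'a. lborel :: real measure" by (rule product_sigma_finite_lborel)
  have "(\<integral>\<^sup>+x. f x \<partial>lborel) = (\<integral>\<^sup>+g. f (\<Sum>b\<in>Basis. g b *\<^sub>R b) \<partial>Pi\<^sub>M Basis (\<lambda>b::'a. lborel))"
    unfolding lborel_def[where 'a='a] lborel_eq_real[symmetric] by (subst nn_integral_distr) auto
  also have "\<dots> = (\<integral>\<^sup>+g. f (g e1 *\<^sub>R e1 + g e2 *\<^sub>R e2) \<partial>Pi\<^sub>M (insert e1 {e2}) (\<lambda>b::'a. lborel))"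
    unfolding B(1) using B(2) by simp
  also have "\<dots> = (\<integral>\<^sup>+g. \<integral>\<^sup>+s. f (s *\<^sub>R e1 + g e2 *\<^sub>R e2) \<partial>lborel \<partial>Pi\<^sub>M {e2} (\<lambda>b::'a. lborel))"
    using B(2) by (subst product_nn_integral_insert) auto
  also have "\<dots> = (\<integral>\<^sup>+t. \<integral>\<^sup>+s. f (s *\<^sub>R e1 + t *\<^sub>R e2) \<partial>lborel \<partial>lborel)"
    by (rule product_nn_integral_singleton) measurable
  finally show ?thesis .
qed

text \<open>
  The basis vectors may be listed in any order, which replaces applications of Tonelli's theorem below.
\<close>
lemma nn_integral_lborel_Basis3:
  fixes f :: "'a::euclidean_space \<Rightarrow> ennreal"
  assumes B: "Basis = {e1, e2, e3 :: 'a}" "e1 \<noteq> e2" "e1 \<noteq> e3" "e2 \<noteq> e3"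
    and [measurable]: "f \<in> borel_measurable borel"
  shows "(\<integral>\<^sup>+x. f x \<partial>lborel) =
    (\<integral>\<^sup>+r. \<integral>\<^sup>+t. \<integral>\<^sup>+s. f (s *\<^sub>R e1 + t *\<^sub>R e2 + r *\<^sub>R e3) \<partial>lborel \<partial>lborel \<partial>lborel)"
proof -
  interpret product_sigma_finite "\<lambda>b::'a. lborel :: real measure" by (rule product_sigma_finite_lborel)
  have "(\<integral>\<^sup>+x. f x \<partial>lborel) = (\<integral>\<^sup>+g. f (\<Sum>b\<in>Basis. g b *\<^sub>R b) \<partial>Pi\<^sub>M Basis (\<lambda>b::'a. lborel))"
    unfolding lborel_def[where 'a='a] lborel_eq_real[symmetric] by (subst nn_integral_distr) auto
  also have "\<dots> = (\<integral>\<^sup>+g. f (g e1 *\<^sub>R e1 + g e2 *\<^sub>R e2 + g e3 *\<^sub>R e3) \<partial>Pi\<^sub>M (insert e1 {e2, e3}) (\<lambda>b::'a. lborel))"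
    unfolding B(1) using B(2-4) by (simp add: add.assoc)
  also have "\<dots> = (\<integral>\<^sup>+g. \<integral>\<^sup>+s. f (s *\<^sub>R e1 + g e2 *\<^sub>R e2 + g e3 *\<^sub>R e3) \<partial>lborel \<partial>Pi\<^sub>M (insert e2 {e3}) (\<lambda>b::'a. lborel))"
    using B(2-4) by (subst product_nn_integral_insert) auto
  also have "\<dots> = (\<integral>\<^sup>+g. \<integral>\<^sup>+t. \<integral>\<^sup>+s. f (s *\<^sub>R e1 + t *\<^sub>R e2 + g e3 *\<^sub>R e3) \<partial>lborel \<partial>lborel \<partial>Pi\<^sub>M {e3} (\<lambda>b::'a. lborel))"
    using B(2-4) by (subst product_nn_integral_insert) auto
  also have "\<dots> = (\<integral>\<^sup>+r. \<integral>\<^sup>+t. \<integral>\<^sup>+s. f (s *\<^sub>R e1 + t *\<^sub>R e2 + r *\<^sub>R e3) \<partial>lborel \<partial>lborel \<partial>lborel)"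
    by (rule product_nn_integral_singleton) measurable
  finally show ?thesis .
qed

abbreviation plane_integral :: "(real \<Rightarrow> real \<Rightarrow> ennreal) \<Rightarrow> ennreal" where
  "plane_integral f \<equiv> \<integral>\<^sup>+t. \<integral>\<^sup>+s. f s t \<partial>lborel \<partial>lborel"

text \<open>
  A function of two variables that is dominated by the integral of \<open>G\<close> along both coordinate lines is
  dominated, after squaring, by a product of a function of \<open>t\<close> and a function of \<open>s\<close>.
\<close>
lemma planar_square_integral_bound:
  fixes A G :: "real \<Rightarrow> real \<Rightarrow> ennreal"
  assumes G[measurable]: "(\<lambda>(s, t). G s t) \<in> borel_measurable (borel \<Otimes>\<^sub>M borel)"
    and 1: "\<And>s t. A s t \<le> (\<integral>\<^sup>+s'. G s' t \<partial>lborel)"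
    and 2: "\<And>s t. A s t \<le> (\<integral>\<^sup>+t'. G s t' \<partial>lborel)"
  shows "plane_integral (\<lambda>s t. (A s t)\<^sup>2) \<le> (plane_integral G)\<^sup>2"
proof -
  have [measurable]: "(\<lambda>(t, s). G s t) \<in> borel_measurable (borel \<Otimes>\<^sub>M borel)"
    using measurable_compose[OF measurable_pair_swap' G] by (simp add: case_prod_unfold)
  have "plane_integral (\<lambda>s t. (A s t)\<^sup>2)
      \<le> (\<integral>\<^sup>+t. \<integral>\<^sup>+s. (\<integral>\<^sup>+s'. G s' t \<partial>lborel) * (\<integral>\<^sup>+t'. G s t' \<partial>lborel) \<partial>lborel \<partial>lborel)"
    unfolding power2_eq_square by (intro nn_integral_mono mult_mono 1 2) auto
  also have "\<dots> = (\<integral>\<^sup>+t. (\<integral>\<^sup>+s'. G s' t \<partial>lborel) * (\<integral>\<^sup>+s. \<integral>\<^sup>+t'. G s t' \<partial>lborel \<partial>lborel) \<partial>lborel)"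
    by (intro nn_integral_cong nn_integral_cmult) measurable
  also have "\<dots> = plane_integral G * (\<integral>\<^sup>+s. \<integral>\<^sup>+t. G s t \<partial>lborel \<partial>lborel)"
    by (rule nn_integral_multc) measurable
  also have "(\<integral>\<^sup>+s. \<integral>\<^sup>+t. G s t \<partial>lborel \<partial>lborel) = plane_integral G"
    by (rule lborel_pair.Fubini'[symmetric]) measurable
  finally show ?thesis by (simp add: power2_eq_square)
qed

lemma planar_Cauchy_Schwarz:
  fixes a b :: "real \<Rightarrow> real \<Rightarrow> ennreal"
  assumes [measurable]: "(\<lambda>(s, t). a s t) \<in> borel_measurable (borel \<Otimes>\<^sub>M borel)"
    "(\<lambda>(s, t). b s t) \<in> borel_measurable (borel \<Otimes>\<^sub>M borel)"
  shows "(plane_integral (\<lambda>s t. a s t * b s t))\<^sup>2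
    \<le> plane_integral (\<lambda>s t. (a s t)\<^sup>2) * plane_integral (\<lambda>s t. (b s t)\<^sup>2)"
proof -
  have eq: "plane_integral f = (\<integral>\<^sup>+x. f (fst x) (snd x) \<partial>(lborel \<Otimes>\<^sub>M lborel))"
    if [measurable]: "(\<lambda>(s, t). f s t) \<in> borel_measurable (borel \<Otimes>\<^sub>M borel)" for f :: "real \<Rightarrow> real \<Rightarrow> ennreal"
    by (subst lborel_pair.nn_integral_snd[symmetric]) (auto simp: case_prod_unfold[symmetric])
  have "(\<integral>\<^sup>+x. a (fst x) (snd x) * b (fst x) (snd x) \<partial>(lborel \<Otimes>\<^sub>M lborel))\<^sup>2
    \<le> (\<integral>\<^sup>+x. (a (fst x) (snd x))\<^sup>2 \<partial>(lborel \<Otimes>\<^sub>M lborel)) * (\<integral>\<^sup>+x. (b (fst x) (snd x))\<^sup>2 \<partial>(lborel \<Otimes>\<^sub>M lborel))"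
    by (rule Cauchy_Schwarz_nn_integral) measurable
  then show ?thesis by (subst (1 2 3) eq) measurable
qed

locale compactly_supported_C1 =
  fixes u :: "'a::euclidean_space \<Rightarrow> real" and du :: "'a \<Rightarrow> 'a" and K :: "'a set"
  assumes deriv: "\<And>x. (u has_derivative (\<lambda>h. du x \<bullet> h)) (at x)"
    and cont_du: "continuous_on UNIV du"
    and K: "compact K" "\<And>x. x \<notin> K \<Longrightarrow> u x = 0" "\<And>x. x \<notin> K \<Longrightarrow> du x = 0"
begin

text \<open>
  The estimates are Tonelli arguments and take place in the extended nonnegative reals.
\<close>
definition A :: "'a \<Rightarrow> ennreal" where "A x = ennreal \<bar>u x\<bar>"
definition N :: "'a \<Rightarrow> ennreal" where "N x = ennreal (norm (du x))"

lemma cont_u: "continuous_on UNIV u"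
  using deriv by (intro has_derivative_continuous_on) (auto intro: has_derivative_at_withinI)

lemma A_measurable [measurable]: "A \<in> borel_measurable borel"
  and N_measurable [measurable]: "N \<in> borel_measurable borel"
proof -
  have [measurable]: "u \<in> borel_measurable borel" "du \<in> borel_measurable borel"
    using cont_u cont_du by (auto intro: borel_measurable_continuous_onI)
  show "A \<in> borel_measurable borel" "N \<in> borel_measurable borel"
    unfolding A_def[abs_def] N_def[abs_def] by measurable
qed

text \<open>
  The fundamental theorem of calculus for \<open>u ^ (m + 1)\<close> on the line through \<open>y\<close> in direction \<open>b\<close>, starting at a
  point outside the support.
\<close>
lemma line_bound:
  assumes b: "b \<in> Basis"
  shows "(A (t *\<^sub>R b + y)) ^ Suc m \<le> (\<integral>\<^sup>+s. of_nat (Suc m) * (A (s *\<^sub>R b + y) ^ m * N (s *\<^sub>R b + y)) \<partial>lborel)"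
proof -
  define v where "v s = u (s *\<^sub>R b + y) ^ Suc m" for s
  define v' where "v' s = real (Suc m) * u (s *\<^sub>R b + y) ^ m * (du (s *\<^sub>R b + y) \<bullet> b)" for s
  have dv: "(v has_field_derivative v' s) (at s)" for s
  proof -
    have "((\<lambda>s. s *\<^sub>R b + y) has_derivative (\<lambda>h. h *\<^sub>R b)) (at s)"
      by (auto intro!: derivative_eq_intros)
    from has_derivative_compose[OF this deriv]
    have "((\<lambda>s. u (s *\<^sub>R b + y)) has_field_derivative (du (s *\<^sub>R b + y) \<bullet> b)) (at s)"
      unfolding has_field_derivative_def
      by (rule has_derivative_eq_rhs) (simp add: fun_eq_iff mult.commute)
    from DERIV_power[OF this, of "Suc m"] show ?thesis
      unfolding v_def[abs_def] v'_def by (simp add: mult.commute mult.left_commute)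
  qed
  have cont_v': "continuous_on UNIV v'"
    unfolding v'_def[abs_def]
    by (intro continuous_intros continuous_on_compose2[OF cont_u] continuous_on_compose2[OF cont_du]) auto
  obtain R where R: "\<And>x. x \<in> K \<Longrightarrow> norm x \<le> R" using compact_imp_bounded[OF K(1)] by (auto simp: bounded_iff)
  \<comment> \<open>Far enough to the left for \<open>a *\<^sub>R b + y\<close> to leave a ball around \<open>K\<close>.\<close>
  define a where "a = min t (- (\<bar>R\<bar> + norm y + 1))"
  have "norm (a *\<^sub>R b + y) > R"
  proof -
    have "\<bar>a\<bar> \<ge> \<bar>R\<bar> + norm y + 1" unfolding a_def by (auto simp: min_def abs_if)
    moreover have "norm (a *\<^sub>R b + y) \<ge> \<bar>a\<bar> - norm y"
      using norm_diff_ineq[of "a *\<^sub>R b" y] b by simp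
    ultimately show ?thesis by linarith
  qed
  then have va: "v a = 0" using R K(2) unfolding v_def by force
  have FTC: "has_bochner_integral lborel (\<lambda>s. v' s * indicator {a..t} s) (v t - v a)"
    using dv cont_v' by (intro has_bochner_integral_FTC_Icc_real)
      (auto simp: a_def has_real_derivative_iff_has_vector_derivative continuous_on_eq_continuous_at)
  have "(A (t *\<^sub>R b + y)) ^ Suc m = ennreal (norm (v t))"
    by (simp add: A_def v_def power_abs ennreal_power del: power_Suc)
  also have "norm (v t) = norm (integral\<^sup>L lborel (\<lambda>s. v' s * indicator {a..t} s))"
    using FTC va by (simp add: has_bochner_integral_integral_eq)
  also have "ennreal \<dots> \<le> (\<integral>\<^sup>+s. norm (v' s * indicator {a..t} s) \<partial>lborel)"
    using FTC by (intro integral_norm_bound_ennreal) (simp add: has_bochner_integral_iff)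
  also have "\<dots> \<le> (\<integral>\<^sup>+s. of_nat (Suc m) * (A (s *\<^sub>R b + y) ^ m * N (s *\<^sub>R b + y)) \<partial>lborel)"
  proof (rule nn_integral_mono)
    fix s
    have "\<bar>du (s *\<^sub>R b + y) \<bullet> b\<bar> \<le> norm (du (s *\<^sub>R b + y))"
      using Cauchy_Schwarz_ineq2[of "du (s *\<^sub>R b + y)" b] b by simp
    then have "norm (v' s * indicator {a..t} s) \<le> real (Suc m) * (\<bar>u (s *\<^sub>R b + y)\<bar> ^ m * norm (du (s *\<^sub>R b + y)))"
      unfolding v'_def
      by (auto simp: abs_mult power_abs indicator_def mult.assoc intro!: mult_left_mono simp del: of_nat_Suc)
    then have "ennreal (norm (v' s * indicator {a..t} s))
        \<le> ennreal (real (Suc m) * (\<bar>u (s *\<^sub>R b + y)\<bar> ^ m * norm (du (s *\<^sub>R b + y))))"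
      by (rule ennreal_leI)
    also have "\<dots> = of_nat (Suc m) * (A (s *\<^sub>R b + y) ^ m * N (s *\<^sub>R b + y))"
      unfolding A_def N_def
      by (simp add: ennreal_mult ennreal_power ennreal_of_nat_eq_real_of_nat del: of_nat_Suc)
    finally show "ennreal (norm (v' s * indicator {a..t} s)) \<le> of_nat (Suc m) * (A (s *\<^sub>R b + y) ^ m * N (s *\<^sub>R b + y))" .
  qed
  finally show ?thesis .
qed

text \<open>
  The planar bound for \<open>u ^ (m + 1)\<close>, followed by the Cauchy-Schwarz inequality, trades the exponent
  \<open>2 * (m + 1)\<close> for \<open>2 * m\<close> and one factor of the Dirichlet integral.  The indicator of \<open>K\<close> keeps the
  case \<open>m = 0\<close> finite, where the induction over \<open>m\<close> starts.
\<close>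
lemma sobolev_plane_step:
  assumes B: "Basis = {e1, e2 :: 'a}" "e1 \<noteq> e2"
  shows "(\<integral>\<^sup>+x. A x ^ (2 * Suc m) \<partial>lborel)
    \<le> (of_nat (Suc m))\<^sup>2 * (\<integral>\<^sup>+x. indicator K x * A x ^ (2 * m) \<partial>lborel) * (\<integral>\<^sup>+x. (N x)\<^sup>2 \<partial>lborel)"
proof -
  define G where "G x = of_nat (Suc m) * (A x ^ m * N x)" for x
  have [measurable]: "G \<in> borel_measurable borel" unfolding G_def[abs_def] by measurable
  have [measurable]: "K \<in> sets borel" using K(1) by (simp add: borel_compact)
  have power_Suc_double: "A y ^ (2 * Suc m) = (A y ^ Suc m)\<^sup>2" for y
    by (simp only: power_mult[symmetric] mult.commute)
  have "(\<integral>\<^sup>+x. A x ^ (2 * Suc m) \<partial>lborel) = plane_integral (\<lambda>s t. (A (s *\<^sub>R e1 + t *\<^sub>R e2) ^ Suc m)\<^sup>2)"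
    unfolding power_Suc_double by (rule nn_integral_lborel_Basis2[OF B]) measurable
  also have "\<dots> \<le> (plane_integral (\<lambda>s t. G (s *\<^sub>R e1 + t *\<^sub>R e2)))\<^sup>2"
  proof (rule planar_square_integral_bound)
    fix s t
    have e2: "e2 \<in> Basis" by (simp add: B(1))
    show "A (s *\<^sub>R e1 + t *\<^sub>R e2) ^ Suc m \<le> (\<integral>\<^sup>+s'. G (s' *\<^sub>R e1 + t *\<^sub>R e2) \<partial>lborel)"
      unfolding G_def by (rule line_bound) (simp add: B)
    show "A (s *\<^sub>R e1 + t *\<^sub>R e2) ^ Suc m \<le> (\<integral>\<^sup>+t'. G (s *\<^sub>R e1 + t' *\<^sub>R e2) \<partial>lborel)"
      unfolding G_def using line_bound[OF e2, of t "s *\<^sub>R e1" m] by (simp add: add.commute)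
  qed measurable
  also have "plane_integral (\<lambda>s t. G (s *\<^sub>R e1 + t *\<^sub>R e2)) = (\<integral>\<^sup>+x. G x \<partial>lborel)"
    by (rule nn_integral_lborel_Basis2[OF B, symmetric]) measurable
  also have "(\<integral>\<^sup>+x. G x \<partial>lborel) = of_nat (Suc m) * (\<integral>\<^sup>+x. (indicator K x * A x ^ m) * N x \<partial>lborel)"
  proof -
    have "G x = of_nat (Suc m) * ((indicator K x * A x ^ m) * N x)" for x
      using K(3) by (cases "x \<in> K") (auto simp: G_def N_def)
    then show ?thesis by (simp add: nn_integral_cmult)
  qed
  also have "(of_nat (Suc m) * (\<integral>\<^sup>+x. (indicator K x * A x ^ m) * N x \<partial>lborel))\<^sup>2
      = (of_nat (Suc m))\<^sup>2 * (\<integral>\<^sup>+x. (indicator K x * A x ^ m) * N x \<partial>lborel)\<^sup>2"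
    by (rule power_mult_distrib)
  also have "\<dots> \<le> (of_nat (Suc m))\<^sup>2 * ((\<integral>\<^sup>+x. (indicator K x * A x ^ m)\<^sup>2 \<partial>lborel) * (\<integral>\<^sup>+x. (N x)\<^sup>2 \<partial>lborel))"
    by (intro mult_left_mono Cauchy_Schwarz_nn_integral) auto
  also have "(\<lambda>x. (indicator K x * A x ^ m)\<^sup>2) = (\<lambda>x. indicator K x * A x ^ (2 * m))"
    by (intro ext) (auto simp: indicator_def mult.commute[of 2] power_mult)
  finally show ?thesis by (simp add: mult.assoc)
qed

lemma sobolev_plane:
  assumes B: "Basis = {e1, e2 :: 'a}" "e1 \<noteq> e2"
  shows "(\<integral>\<^sup>+x. indicator K x * A x ^ (2 * m) \<partial>lborel)
    \<le> (fact m)\<^sup>2 * emeasure lborel K * (\<integral>\<^sup>+x. (N x)\<^sup>2 \<partial>lborel) ^ m"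
proof (induction m)
  case 0
  have [measurable]: "K \<in> sets borel" using K(1) by (simp add: borel_compact)
  show ?case by simp
next
  case (Suc m)
  have "(\<integral>\<^sup>+x. indicator K x * A x ^ (2 * Suc m) \<partial>lborel) \<le> (\<integral>\<^sup>+x. A x ^ (2 * Suc m) \<partial>lborel)"
    by (intro nn_integral_mono) (auto simp: indicator_def)
  also have "\<dots> \<le> (of_nat (Suc m))\<^sup>2 * (\<integral>\<^sup>+x. indicator K x * A x ^ (2 * m) \<partial>lborel) * (\<integral>\<^sup>+x. (N x)\<^sup>2 \<partial>lborel)"
    by (rule sobolev_plane_step[OF B])
  also have "\<dots> \<le> (of_nat (Suc m))\<^sup>2 * ((fact m)\<^sup>2 * emeasure lborel K * (\<integral>\<^sup>+x. (N x)\<^sup>2 \<partial>lborel) ^ m)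
      * (\<integral>\<^sup>+x. (N x)\<^sup>2 \<partial>lborel)"
    by (intro mult_right_mono mult_left_mono Suc.IH) auto
  also have "\<dots> = (fact (Suc m))\<^sup>2 * emeasure lborel K * (\<integral>\<^sup>+x. (N x)\<^sup>2 \<partial>lborel) ^ Suc m"
    by (simp add: power_mult_distrib mult_ac del: of_nat_Suc)
  finally show ?case .
qed

lemma finite_power_integral: "(\<integral>\<^sup>+x. A x ^ Suc m \<partial>lborel) < \<infinity>" "(\<integral>\<^sup>+x. (N x)\<^sup>2 \<partial>lborel) < \<infinity>"
proof -
  have "integrable lborel (\<lambda>x. \<bar>u x\<bar> ^ Suc m)"
    by (rule continuous_compact_support_integrable[OF _ K(1)]) (auto intro!: continuous_intros cont_u simp: K)
  moreover have "integrable lborel (\<lambda>x. (norm (du x))\<^sup>2)"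
    by (rule continuous_compact_support_integrable[OF _ K(1)]) (auto intro!: continuous_intros cont_du simp: K)
  ultimately show "(\<integral>\<^sup>+x. A x ^ Suc m \<partial>lborel) < \<infinity>" "(\<integral>\<^sup>+x. (N x)\<^sup>2 \<partial>lborel) < \<infinity>"
    by (auto simp: integrable_iff_bounded A_def N_def ennreal_power power_abs abs_mult simp del: power_Suc)
qed

text \<open>
  In space, the planar bound for \<open>u\<^sup>3\<close> on the slices orthogonal to \<open>e3\<close> leaves the slice integrals of
  \<open>u\<^sup>4\<close>, and these are bounded uniformly in the slice by integrating along \<open>e3\<close>.
\<close>
lemma sobolev_space:
  assumes B: "Basis = {e1, e2, e3 :: 'a}" "e1 \<noteq> e2" "e1 \<noteq> e3" "e2 \<noteq> e3"
  shows "(\<integral>\<^sup>+x. A x ^ 6 \<partial>lborel) \<le> 1296 * (\<integral>\<^sup>+x. (N x)\<^sup>2 \<partial>lborel) ^ 3"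
proof -
  define J S where "J = (\<integral>\<^sup>+x. A x ^ 6 \<partial>lborel)" and "S = (\<integral>\<^sup>+x. (N x)\<^sup>2 \<partial>lborel)"
  define W where "W = (\<integral>\<^sup>+x. of_nat (Suc 3) * (A x ^ 3 * N x) \<partial>lborel)"
  define P where "P s t r = s *\<^sub>R e1 + t *\<^sub>R e2 + r *\<^sub>R e3" for s t r
  have PA[measurable]: "(\<lambda>(s, t). A (P s t r)) \<in> borel_measurable (borel \<Otimes>\<^sub>M borel)"
    and PN[measurable]: "(\<lambda>(s, t). N (P s t r)) \<in> borel_measurable (borel \<Otimes>\<^sub>M borel)" for r
    unfolding P_def by measurable
  have W_sq: "W\<^sup>2 \<le> 16 * (J * S)"
  proof -
    have "W = 4 * (\<integral>\<^sup>+x. A x ^ 3 * N x \<partial>lborel)"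
      unfolding W_def by (subst nn_integral_cmult) auto
    then have "W\<^sup>2 = 16 * (\<integral>\<^sup>+x. A x ^ 3 * N x \<partial>lborel)\<^sup>2" by (simp add: power_mult_distrib)
    also have "\<dots> \<le> 16 * ((\<integral>\<^sup>+x. (A x ^ 3)\<^sup>2 \<partial>lborel) * (\<integral>\<^sup>+x. (N x)\<^sup>2 \<partial>lborel))"
      by (intro mult_left_mono Cauchy_Schwarz_nn_integral) auto
    finally show ?thesis by (simp add: J_def S_def flip: power_mult)
  qed
  have slice4: "plane_integral (\<lambda>s t. A (P s t r) ^ 4) \<le> W" for r
  proof -
    have "plane_integral (\<lambda>s t. A (P s t r) ^ 4)
        \<le> (\<integral>\<^sup>+t. \<integral>\<^sup>+s. \<integral>\<^sup>+r. of_nat (Suc 3) * (A (r *\<^sub>R e3 + s *\<^sub>R e1 + t *\<^sub>R e2) ^ 3 *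
            N (r *\<^sub>R e3 + s *\<^sub>R e1 + t *\<^sub>R e2)) \<partial>lborel \<partial>lborel \<partial>lborel)"
    proof (intro nn_integral_mono)
      fix s t
      have e3: "e3 \<in> Basis" by (simp add: B(1))
      have eq: "P s t r = r *\<^sub>R e3 + (s *\<^sub>R e1 + t *\<^sub>R e2)" by (simp add: P_def)
      show "A (P s t r) ^ 4 \<le> (\<integral>\<^sup>+r. of_nat (Suc 3) * (A (r *\<^sub>R e3 + s *\<^sub>R e1 + t *\<^sub>R e2) ^ 3 *
            N (r *\<^sub>R e3 + s *\<^sub>R e1 + t *\<^sub>R e2)) \<partial>lborel)"
        using line_bound[OF e3, of r "s *\<^sub>R e1 + t *\<^sub>R e2" 3] unfolding eq by (simp add: add.assoc)
    qed
    also have "\<dots> = W"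
      unfolding W_def by (rule nn_integral_lborel_Basis3[symmetric]) (use B in auto)
    finally show ?thesis .
  qed
  have slice6: "plane_integral (\<lambda>s t. A (P s t r) ^ 6)
      \<le> 9 * W * plane_integral (\<lambda>s t. (N (P s t r))\<^sup>2)" for r
  proof -
    have "plane_integral (\<lambda>s t. A (P s t r) ^ 6)
        = plane_integral (\<lambda>s t. (A (P s t r) ^ Suc 2)\<^sup>2)"
      by (simp flip: power_mult)
    also have "\<dots> \<le> (plane_integral (\<lambda>s t. of_nat (Suc 2) * (A (P s t r) ^ 2 * N (P s t r))))\<^sup>2"
    proof (rule planar_square_integral_bound)
      fix s t
      have e: "e1 \<in> Basis" "e2 \<in> Basis" by (simp_all add: B(1))
      show "A (P s t r) ^ Suc 2 \<le> (\<integral>\<^sup>+s. of_nat (Suc 2) * (A (P s t r) ^ 2 * N (P s t r)) \<partial>lborel)"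
        using line_bound[OF e(1), of s "t *\<^sub>R e2 + r *\<^sub>R e3" 2] by (simp add: P_def add.assoc del: of_nat_Suc power_Suc)
      have "P s t r = t *\<^sub>R e2 + (s *\<^sub>R e1 + r *\<^sub>R e3)" for t by (simp add: P_def)
      then show "A (P s t r) ^ Suc 2 \<le> (\<integral>\<^sup>+t. of_nat (Suc 2) * (A (P s t r) ^ 2 * N (P s t r)) \<partial>lborel)"
        using line_bound[OF e(2), of t "s *\<^sub>R e1 + r *\<^sub>R e3" 2] by (simp del: of_nat_Suc power_Suc)
    qed measurable
    also have "plane_integral (\<lambda>s t. of_nat (Suc 2) * (A (P s t r) ^ 2 * N (P s t r)))
        = 3 * plane_integral (\<lambda>s t. A (P s t r) ^ 2 * N (P s t r))"
      by (simp add: nn_integral_cmult)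
    also have "\<dots>\<^sup>2 = 9 * (plane_integral (\<lambda>s t. A (P s t r) ^ 2 * N (P s t r)))\<^sup>2"
      by (simp add: power_mult_distrib)
    also have "\<dots> \<le> 9 * (plane_integral (\<lambda>s t. (A (P s t r) ^ 2)\<^sup>2)
        * plane_integral (\<lambda>s t. (N (P s t r))\<^sup>2))"
      by (intro mult_left_mono planar_Cauchy_Schwarz) auto
    also have "\<dots> \<le> 9 * (W * plane_integral (\<lambda>s t. (N (P s t r))\<^sup>2))"
      using slice4[of r] by (intro mult_left_mono mult_right_mono) (simp_all flip: power_mult)
    finally show ?thesis by (simp add: mult.assoc)
  qed
  have "J = (\<integral>\<^sup>+r. \<integral>\<^sup>+t. \<integral>\<^sup>+s. A (P s t r) ^ 6 \<partial>lborel \<partial>lborel \<partial>lborel)"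
    unfolding J_def P_def by (rule nn_integral_lborel_Basis3[OF B]) measurable
  also have "\<dots> \<le> (\<integral>\<^sup>+r. 9 * W * plane_integral (\<lambda>s t. (N (P s t r))\<^sup>2) \<partial>lborel)"
    by (intro nn_integral_mono slice6)
  also have "\<dots> = 9 * W * (\<integral>\<^sup>+r. \<integral>\<^sup>+t. \<integral>\<^sup>+s. (N (P s t r))\<^sup>2 \<partial>lborel \<partial>lborel \<partial>lborel)"
    by (rule nn_integral_cmult) (unfold P_def, measurable)
  also have "(\<integral>\<^sup>+r. \<integral>\<^sup>+t. \<integral>\<^sup>+s. (N (P s t r))\<^sup>2 \<partial>lborel \<partial>lborel \<partial>lborel) = S"
    unfolding S_def P_def by (rule nn_integral_lborel_Basis3[OF B, symmetric]) measurable
  finally have J_le: "J \<le> 9 * W * S" .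
  have "J\<^sup>2 \<le> (9 * W * S)\<^sup>2" by (rule power_mono[OF J_le]) simp
  also have "\<dots> = 81 * W\<^sup>2 * S\<^sup>2" by (simp add: power_mult_distrib)
  also have "\<dots> \<le> 81 * (16 * (J * S)) * S\<^sup>2"
    by (intro mult_right_mono mult_left_mono W_sq) auto
  finally have J_sq: "J\<^sup>2 \<le> 1296 * J * S ^ 3"
    by (simp add: power2_eq_square power3_eq_cube mult_ac)
  have fin: "J < \<infinity>" "S < \<infinity>"
    using finite_power_integral(1)[of 5] finite_power_integral(2) by (simp_all add: J_def S_def)
  then obtain j s where js: "J = ennreal j" "S = ennreal s" "j \<ge> 0" "s \<ge> 0"
    by (metis ennreal_enn2real enn2real_nonneg infinity_ennreal_def)
  \<comment> \<open>Finiteness of \<open>J\<close> is what allows a factor \<open>J\<close> to be cancelled.\<close>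
  have "j ^ 2 \<le> 1296 * j * s ^ 3"
    using J_sq js by (simp add: ennreal_power ennreal_mult[symmetric] flip: ennreal_numeral)
  then have "j \<le> 1296 * s ^ 3"
    using js by (cases "j = 0") (auto simp: power2_eq_square mult_ac)
  then show ?thesis
    using js by (simp add: J_def[symmetric] S_def[symmetric] ennreal_power ennreal_mult[symmetric] flip: ennreal_numeral)
qed

end

lemma test_function_compactly_supported_C1:
  assumes "\<phi> \<in> test_functions \<Omega>"
  obtains K where "K \<subseteq> \<Omega>" "compactly_supported_C1 \<phi> (grad \<phi>) K"
proof -
  obtain K where K: "compact K" "K \<subseteq> \<Omega>" "\<And>x. x \<notin> K \<Longrightarrow> \<phi> x = 0" "\<And>x. x \<notin> K \<Longrightarrow> grad \<phi> x = 0"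
    using test_function_grad_support[OF assms] by metis
  then have "compactly_supported_C1 \<phi> (grad \<phi>) K"
    using test_function_grad[OF assms] by unfold_locales auto
  with K(2) show thesis by (rule that)
qed

text \<open>
  The constant depends on the support only through its measure, which is at most that of \<open>\<Omega>\<close>.
\<close>
lemma sobolev_test_functions:
  fixes \<Omega> :: "'a::euclidean_space set"
  assumes \<Omega>: "open \<Omega>" "bounded \<Omega>" and dim: "DIM('a) = 2 \<or> DIM('a) = 3 \<and> m = 3" and m: "m > 0"
  shows "\<exists>C\<ge>0. \<forall>\<phi>\<in>test_functions \<Omega>. integrable (lebesgue_on \<Omega>) (\<lambda>x. \<phi> x ^ (2 * m)) \<and>
    (LINT x|lebesgue_on \<Omega>. \<phi> x ^ (2 * m)) \<le> C * L2_norm \<Omega> (grad \<phi>) ^ (2 * m)"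
proof -
  define C where "C = max 1296 ((fact m)\<^sup>2 * measure lborel \<Omega>)"
  have sets: "\<Omega> \<in> sets lebesgue" "\<Omega> \<in> sets borel" using \<Omega> by simp_all
  have "integrable (lebesgue_on \<Omega>) (\<lambda>x. \<phi> x ^ (2 * m)) \<and>
    (LINT x|lebesgue_on \<Omega>. \<phi> x ^ (2 * m)) \<le> C * L2_norm \<Omega> (grad \<phi>) ^ (2 * m)"
    if \<phi>: "\<phi> \<in> test_functions \<Omega>" for \<phi>
  proof -
    obtain K where KO: "K \<subseteq> \<Omega>" and KC: "compactly_supported_C1 \<phi> (grad \<phi>) K"
      by (rule test_function_compactly_supported_C1[OF \<phi>])
    interpret compactly_supported_C1 \<phi> "grad \<phi>" K by (rule KC)
    note Kc = K(1)
    have Kb: "K \<in> sets borel" using Kc by (simp add: borel_compact)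
    define s where "s = (LINT x|lborel. (norm (grad \<phi> x))\<^sup>2)"
    have c: "continuous_on UNIV (\<lambda>x. \<phi> x ^ (2 * m))" "continuous_on UNIV (\<lambda>x. (norm (grad \<phi> x))\<^sup>2)"
      by (intro continuous_intros cont_u cont_du)+
    have z: "\<And>x. x \<notin> K \<Longrightarrow> \<phi> x ^ (2 * m) = 0" "\<And>x. x \<notin> K \<Longrightarrow> (norm (grad \<phi> x))\<^sup>2 = 0"
      using K(2,3) m by simp_all
    note i1 = integral_lebesgue_on_compact_support[OF c(1) Kc z(1) KO sets(1)]
      and i2 = integral_lebesgue_on_compact_support[OF c(2) Kc z(2) KO sets(1)]
    have int: "integrable lborel (\<lambda>x. \<phi> x ^ (2 * m))" "integrable lborel (\<lambda>x. (norm (grad \<phi> x))\<^sup>2)"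
      using continuous_compact_support_integrable[OF c(1) Kc z(1)]
        continuous_compact_support_integrable[OF c(2) Kc z(2)] by blast+
    have S: "(\<integral>\<^sup>+x. (N x)\<^sup>2 \<partial>lborel) = ennreal s"
      unfolding N_def s_def using int(2) by (simp add: ennreal_power nn_integral_eq_integral)
    have s_nonneg: "s \<ge> 0" by (simp add: s_def Bochner_Integration.integral_nonneg)
    have J: "(\<integral>\<^sup>+x. A x ^ (2 * m) \<partial>lborel) = ennreal (LINT x|lborel. \<phi> x ^ (2 * m))"
    proof -
      have "A x ^ (2 * m) = ennreal (\<phi> x ^ (2 * m))" for x
        by (simp add: A_def ennreal_power power_even_abs)
      then show ?thesis using int(1) by (simp add: nn_integral_eq_integral)
    qed
    have "ennreal (LINT x|lborel. \<phi> x ^ (2 * m)) \<le> ennreal (C * s ^ m)"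
    proof (cases "DIM('a) = 2")
      case True
      then obtain e1 e2 where B: "(Basis :: 'a set) = {e1, e2}" "e1 \<noteq> e2" by (auto simp: card_2_iff)
      have fin: "emeasure lborel \<Omega> = ennreal (measure lborel \<Omega>)"
        using emeasure_bounded_finite[OF \<Omega>(2)] by (intro emeasure_eq_ennreal_measure) auto
      have "(\<integral>\<^sup>+x. A x ^ (2 * m) \<partial>lborel) = (\<integral>\<^sup>+x. indicator K x * A x ^ (2 * m) \<partial>lborel)"
      proof (rule nn_integral_cong)
        fix x show "A x ^ (2 * m) = indicator K x * A x ^ (2 * m)"
          using K(2)[of x] m by (cases "x \<in> K") (auto simp: A_def)
      qed
      also have "\<dots> \<le> (fact m)\<^sup>2 * emeasure lborel K * ennreal s ^ m"
        using sobolev_plane[OF B, of m] by (simp add: S)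
      also have "\<dots> \<le> (fact m)\<^sup>2 * ennreal (measure lborel \<Omega>) * ennreal s ^ m"
        unfolding fin[symmetric] using sets KO by (intro mult_right_mono mult_left_mono emeasure_mono) auto
      also have "\<dots> = ennreal ((fact m)\<^sup>2 * measure lborel \<Omega> * s ^ m)"
      proof -
        have "(fact m :: ennreal) = ennreal (fact m)"
          by (metis ennreal_of_nat_eq_real_of_nat of_nat_fact)
        then show ?thesis using s_nonneg by (simp add: ennreal_mult ennreal_power)
      qed
      also have "\<dots> \<le> ennreal (C * s ^ m)"
        using s_nonneg by (intro ennreal_leI mult_right_mono) (auto simp: C_def)
      finally show ?thesis unfolding J .
    next
      case False
      then have "m = 3" "card (Basis :: 'a set) = 3" using dim by auto
      then obtain e1 e2 e3 where B: "(Basis :: 'a set) = {e1, e2, e3}" "e1 \<noteq> e2" "e1 \<noteq> e3" "e2 \<noteq> e3"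
        by (auto simp: card_3_iff)
      have "(\<integral>\<^sup>+x. A x ^ (2 * m) \<partial>lborel) \<le> 1296 * ennreal s ^ m"
        using sobolev_space[OF B] \<open>m = 3\<close> by (simp add: S)
      also have "\<dots> = ennreal (1296 * s ^ m)"
        using s_nonneg by (simp add: ennreal_mult ennreal_power)
      also have "\<dots> \<le> ennreal (C * s ^ m)"
        using s_nonneg by (intro ennreal_leI mult_right_mono) (auto simp: C_def)
      finally show ?thesis unfolding J .
    qed
    then have "(LINT x|lborel. \<phi> x ^ (2 * m)) \<le> C * s ^ m"
      using s_nonneg by (subst (asm) ennreal_le_iff) (auto simp: C_def)
    moreover have "s ^ m = L2_norm \<Omega> (grad \<phi>) ^ (2 * m)"
      using i2(2) by (simp add: power_mult L2_norm_square s_def)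
    ultimately show ?thesis using i1 by simp
  qed
  moreover have "C \<ge> 0" by (simp add: C_def)
  ultimately show ?thesis by blast
qed

section \<open>The space of functions with zero boundary values\<close>

lemma H10_H1: "u \<in> H10 \<Omega> \<Longrightarrow> u \<in> H1 \<Omega>"
  by (simp add: H10_def)

lemma H1_norm_bounds: "L2_norm \<Omega> u \<le> H1_norm \<Omega> u" "L2_norm \<Omega> (wgrad \<Omega> u) \<le> H1_norm \<Omega> u"
  "H1_norm \<Omega> u \<le> L2_norm \<Omega> u + L2_norm \<Omega> (wgrad \<Omega> u)"
  unfolding H1_norm_def
  by (rule real_le_rsqrt, simp, rule real_le_rsqrt, simp, rule sqrt_sum_squares_le_sum, simp_all)

lemma H10_approximation:
  assumes \<Omega>: "open \<Omega>" and u: "u \<in> H10 \<Omega>"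
  obtains \<phi> :: "nat \<Rightarrow> 'a::euclidean_space \<Rightarrow> real" where "\<And>k. \<phi> k \<in> test_functions \<Omega>"
    "(\<lambda>k. L2_norm \<Omega> (\<lambda>x. \<phi> k x - u x)) \<longlonglongrightarrow> 0"
    "(\<lambda>k. L2_norm \<Omega> (\<lambda>x. grad (\<phi> k) x - wgrad \<Omega> u x)) \<longlonglongrightarrow> 0"
proof -
  obtain \<phi> :: "nat \<Rightarrow> 'a \<Rightarrow> real" where \<phi>: "\<And>k. \<phi> k \<in> test_functions \<Omega>"
    and lim: "(\<lambda>k. H1_norm \<Omega> (\<lambda>x. \<phi> k x - u x)) \<longlonglongrightarrow> 0"
    using u unfolding H10_def by blast
  have "(\<lambda>k. L2_norm \<Omega> (\<lambda>x. \<phi> k x - u x)) \<longlonglongrightarrow> 0"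
    by (rule tendsto_sandwich[OF _ _ tendsto_const lim]) (auto simp: H1_norm_bounds)
  moreover have "L2_norm \<Omega> (\<lambda>x. grad (\<phi> k) x - wgrad \<Omega> u x) = L2_norm \<Omega> (wgrad \<Omega> (\<lambda>x. \<phi> k x - u x))" for k
  proof (rule L2_norm_cong_AE)
    have H: "\<phi> k \<in> H1 \<Omega>" by (rule test_function_L2(3)[OF \<Omega> \<phi>])
    note H1_wgrad(1)[OF \<Omega> H1_diff[OF \<Omega> H H10_H1[OF u]]] H1_wgrad(1)[OF \<Omega> H10_H1[OF u]]
      test_function_L2(2)[OF \<Omega> \<phi>, of k]
    then show "(\<lambda>x. grad (\<phi> k) x - wgrad \<Omega> u x) \<in> borel_measurable (lebesgue_on \<Omega>)"
      "wgrad \<Omega> (\<lambda>x. \<phi> k x - u x) \<in> borel_measurable (lebesgue_on \<Omega>)"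
      by (auto intro!: L2_spaceD(1) L2_space_diff)
    show "AE x in lebesgue_on \<Omega>. grad (\<phi> k) x - wgrad \<Omega> u x = wgrad \<Omega> (\<lambda>x. \<phi> k x - u x) x"
      using wgrad_diff_AE[OF \<Omega> H H10_H1[OF u]] wgrad_AE_eq[OF \<Omega> grad_is_weak_gradient[OF \<Omega> \<phi>], of k]
      by eventually_elim simp
  qed
  then have "(\<lambda>k. L2_norm \<Omega> (\<lambda>x. grad (\<phi> k) x - wgrad \<Omega> u x)) \<longlonglongrightarrow> 0"
    by (intro tendsto_sandwich[OF _ _ tendsto_const lim]) (auto simp: H1_norm_bounds)
  ultimately show thesis by (rule that[OF \<phi>])
qed

text \<open>
  The inequality passes to the closure of the test functions by Fatou's lemma along an almost everywhere
  convergent subsequence.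
\<close>
lemma sobolev_H10:
  fixes \<Omega> :: "'a::euclidean_space set"
  assumes \<Omega>: "open \<Omega>" "bounded \<Omega>" and dim: "DIM('a) = 2 \<or> DIM('a) = 3 \<and> m = 3" and m: "m > 0"
  shows "\<exists>C\<ge>0. \<forall>u\<in>H10 \<Omega>. integrable (lebesgue_on \<Omega>) (\<lambda>x. u x ^ (2 * m)) \<and>
    (LINT x|lebesgue_on \<Omega>. u x ^ (2 * m)) \<le> C * H10_norm \<Omega> u ^ (2 * m)"
proof -
  have lm: "\<Omega> \<in> lmeasurable" using \<Omega> by (intro lmeasurable_open)
  obtain C where C: "C \<ge> 0" "\<And>\<phi>. \<phi> \<in> test_functions \<Omega> \<Longrightarrow> integrable (lebesgue_on \<Omega>) (\<lambda>x. \<phi> x ^ (2 * m))"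
    "\<And>\<phi>. \<phi> \<in> test_functions \<Omega> \<Longrightarrow> (LINT x|lebesgue_on \<Omega>. \<phi> x ^ (2 * m)) \<le> C * L2_norm \<Omega> (grad \<phi>) ^ (2 * m)"
    using sobolev_test_functions[OF assms] by blast
  have "integrable (lebesgue_on \<Omega>) (\<lambda>x. u x ^ (2 * m)) \<and>
    (LINT x|lebesgue_on \<Omega>. u x ^ (2 * m)) \<le> C * H10_norm \<Omega> u ^ (2 * m)" if u: "u \<in> H10 \<Omega>" for u
  proof -
    note uL2 = H1_wgrad[OF \<Omega>(1) H10_H1[OF u]]
    obtain \<phi> where \<phi>: "\<And>k::nat. \<phi> k \<in> test_functions \<Omega>"
      and lim: "(\<lambda>k. L2_norm \<Omega> (\<lambda>x. \<phi> k x - u x)) \<longlonglongrightarrow> 0"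
        "(\<lambda>k. L2_norm \<Omega> (\<lambda>x. grad (\<phi> k) x - wgrad \<Omega> u x)) \<longlonglongrightarrow> 0"
      by (rule H10_approximation[OF \<Omega>(1) u]) (rule that)
    have g: "(\<lambda>k. L2_norm \<Omega> (grad (\<phi> k))) \<longlonglongrightarrow> H10_norm \<Omega> u"
      unfolding H10_norm_def using test_function_L2(2)[OF \<Omega>(1) \<phi>] uL2(1) lim(2) by (rule L2_norm_tendsto)
    obtain r :: "nat \<Rightarrow> nat" where r: "strict_mono r" "AE x in lebesgue_on \<Omega>. (\<lambda>k. \<phi> (r k) x) \<longlonglongrightarrow> u x"
      by (rule L2_convergent_AE_subseq[OF lm test_function_L2(1)[OF \<Omega>(1) \<phi>] uL2(3) lim(1)]) (rule that)
    have c: "(\<lambda>k. C * L2_norm \<Omega> (grad (\<phi> (r k))) ^ (2 * m)) \<longlonglongrightarrow> C * H10_norm \<Omega> u ^ (2 * m)"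
      using LIMSEQ_subseq_LIMSEQ[OF g r(1)] by (intro tendsto_intros) (simp add: o_def)
    have ae: "AE x in lebesgue_on \<Omega>. (\<lambda>k. \<phi> (r k) x ^ (2 * m)) \<longlonglongrightarrow> u x ^ (2 * m)"
      using r(2) by eventually_elim (rule tendsto_power)
    have [measurable]: "u \<in> borel_measurable (lebesgue_on \<Omega>)" using uL2(3) by (rule L2_spaceD)
    have pos: "0 \<le> \<phi> (r k) x ^ (2 * m)" for k x by (simp add: power_mult)
    show ?thesis
      by (intro conjI; rule Fatou_integral[OF C(2)[OF \<phi>] pos C(3)[OF \<phi>] c ae]; measurable)
  qed
  with C(1) show ?thesis by blast
qed

text \<open>
  Letting \<open>s\<close> decrease to \<open>N\<close> covers the case \<open>N = 0\<close>, in which \<open>s = N\<close> is not admissible.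
\<close>
lemma homogeneous_bound:
  fixes I N B :: real
  assumes bound: "\<And>s. s > 0 \<Longrightarrow> N \<le> s \<Longrightarrow> I \<le> s ^ k * B" and N: "0 \<le> N"
  shows "I \<le> N ^ k * B"
proof (rule tendsto_lowerbound)
  have "((\<lambda>s. s ^ k * B) \<longlongrightarrow> N ^ k * B) (at N)" by (intro tendsto_intros)
  then show "((\<lambda>s. s ^ k * B) \<longlongrightarrow> N ^ k * B) (at_right N)" by (rule tendsto_mono[rotated]) (simp add: at_le)
  show "\<forall>\<^sub>F s in at_right N. I \<le> s ^ k * B"
    using bound N by (auto simp: eventually_at_right_field intro!: exI[of _ "N + 1"])
qed simp

text \<open>
  If \<open>\<bar>g\<bar>\<close> is controlled by \<open>s ^ k * (F + (u / s) ^ (2 * m))\<close> for all \<open>s > 0\<close>, its integral is controlled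
  by the \<open>k\<close>-th power of the norm of \<open>u\<close>: let \<open>s\<close> tend to that norm.  Such a control holds for
  \<open>f u\<close> with \<open>k = 1\<close>, by Young's inequality, and for \<open>u\<^sup>2\<close> with \<open>k = 2\<close>.
\<close>
lemma integral_bound_by_scaling:
  fixes g F u :: "'a::euclidean_space \<Rightarrow> real"
  assumes u: "integrable (lebesgue_on \<Omega>) (\<lambda>x. u x ^ (2 * m))"
      "(LINT x|lebesgue_on \<Omega>. u x ^ (2 * m)) \<le> C * n ^ (2 * m)"
    and F: "integrable (lebesgue_on \<Omega>) F" and C: "0 \<le> C" and n: "0 \<le> n"
    and g: "g \<in> borel_measurable (lebesgue_on \<Omega>)"
    and bound: "\<And>x s. x \<in> \<Omega> \<Longrightarrow> s > 0 \<Longrightarrow> \<bar>g x\<bar> \<le> s ^ k * (F x + (u x / s) ^ (2 * m))"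
  shows "integrable (lebesgue_on \<Omega>) g"
    and "(LINT x|lebesgue_on \<Omega>. \<bar>g x\<bar>) \<le> n ^ k * ((LINT x|lebesgue_on \<Omega>. F x) + C)"
proof -
  have int: "integrable (lebesgue_on \<Omega>) (\<lambda>x. s ^ k * (F x + (u x / s) ^ (2 * m)))" for s
    using u(1) F by (simp add: power_divide)
  show int_g: "integrable (lebesgue_on \<Omega>) g"
    by (rule Bochner_Integration.integrable_bound[OF int[of 1] g])
       (use bound[of _ 1] in \<open>auto intro!: AE_I2 order_trans[OF _ abs_ge_self]\<close>)
  show "(LINT x|lebesgue_on \<Omega>. \<bar>g x\<bar>) \<le> n ^ k * ((LINT x|lebesgue_on \<Omega>. F x) + C)"
  proof (rule homogeneous_bound[OF _ n])
    fix s :: real assume s: "s > 0" "n \<le> s"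
    have "(LINT x|lebesgue_on \<Omega>. \<bar>g x\<bar>) \<le> (LINT x|lebesgue_on \<Omega>. s ^ k * (F x + (u x / s) ^ (2 * m)))"
      using bound s int_g by (intro integral_mono int) auto
    also have "\<dots> = s ^ k * ((LINT x|lebesgue_on \<Omega>. F x) + (LINT x|lebesgue_on \<Omega>. u x ^ (2 * m)) / s ^ (2 * m))"
      using u(1) F by (simp add: power_divide)
    also have "\<dots> \<le> s ^ k * ((LINT x|lebesgue_on \<Omega>. F x) + C)"
    proof -
      have "(LINT x|lebesgue_on \<Omega>. u x ^ (2 * m)) \<le> C * s ^ (2 * m)"
        using u(2) mult_left_mono[OF power_mono[OF s(2) n, of "2 * m"] C] by linarith
      then show ?thesis using s by (simp add: divide_le_eq)
    qed
    finally show "(LINT x|lebesgue_on \<Omega>. \<bar>g x\<bar>) \<le> s ^ k * ((LINT x|lebesgue_on \<Omega>. F x) + C)" .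
  qed
qed

lemma poincare_H10:
  fixes \<Omega> :: "'a::euclidean_space set"
  assumes \<Omega>: "open \<Omega>" "bounded \<Omega>" and dim: "DIM('a) = 2 \<or> DIM('a) = 3"
  obtains C where "C \<ge> 0" "\<And>u. u \<in> H10 \<Omega> \<Longrightarrow> L2_norm \<Omega> u \<le> C * H10_norm \<Omega> u"
proof -
  interpret finite_measure "lebesgue_on \<Omega>"
    using \<Omega> by (intro finite_measure_lebesgue_on lmeasurable_open)
  obtain C where C: "C \<ge> 0" "\<And>u. u \<in> H10 \<Omega> \<Longrightarrow> integrable (lebesgue_on \<Omega>) (\<lambda>x. u x ^ (2 * 3))"
    "\<And>u. u \<in> H10 \<Omega> \<Longrightarrow> (LINT x|lebesgue_on \<Omega>. u x ^ (2 * 3)) \<le> C * H10_norm \<Omega> u ^ (2 * 3)"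
    using sobolev_H10[OF \<Omega>, of 3] dim by auto
  let ?B = "(LINT x|lebesgue_on \<Omega>. 1) + C"
  have "L2_norm \<Omega> u \<le> sqrt ?B * H10_norm \<Omega> u" if u: "u \<in> H10 \<Omega>" for u
  proof -
    have [measurable]: "u \<in> borel_measurable (lebesgue_on \<Omega>)"
      using H1_wgrad(3)[OF \<Omega>(1) H10_H1[OF u]] by (rule L2_spaceD)
    have n: "0 \<le> H10_norm \<Omega> u" by (simp add: H10_norm_def)
    have g: "(\<lambda>x. (u x)\<^sup>2) \<in> borel_measurable (lebesgue_on \<Omega>)" by measurable
    have b: "\<bar>(u x)\<^sup>2\<bar> \<le> s\<^sup>2 * (1 + (u x / s) ^ (2 * 3))" if s: "s > 0" for x s
    proof -
      have "y \<le> 1 + y ^ 3" if "y \<ge> 0" for y :: real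
      proof (cases "y \<le> 1")
        case False
        then have "y ^ 1 \<le> y ^ 3" by (intro power_increasing) auto
        then show ?thesis by simp
      qed (use that in \<open>simp add: add_increasing2\<close>)
      from this[of "(u x / s)\<^sup>2"] have "(u x / s)\<^sup>2 \<le> 1 + (u x / s) ^ (2 * 3)" by (simp flip: power_mult)
      then have "s\<^sup>2 * (u x / s)\<^sup>2 \<le> s\<^sup>2 * (1 + (u x / s) ^ (2 * 3))" by (rule mult_left_mono) simp
      then show ?thesis using s by (simp add: power_divide)
    qed
    have "(L2_norm \<Omega> u)\<^sup>2 \<le> (H10_norm \<Omega> u)\<^sup>2 * ?B"
      using integral_bound_by_scaling(2)[OF C(2)[OF u] C(3)[OF u] _ C(1) n g b] by (simp add: L2_norm_square)
    from real_sqrt_le_mono[OF this] show ?thesis using n by (simp add: real_sqrt_mult mult.commute)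
  qed
  with C(1) show thesis by (intro that[of "sqrt ?B"]) auto
qed

text \<open>
  Integrability of \<open>f v\<close> is where the source exponent enters: \<open>2 m\<close> is an exponent of the Sobolev
  embedding and \<open>2 m / (2 m - 1)\<close> its conjugate.
\<close>
lemma load_bound:
  fixes \<Omega> :: "'a::euclidean_space set"
  assumes \<Omega>: "open \<Omega>" "bounded \<Omega>" and dim: "DIM('a) = 2 \<or> DIM('a) = 3 \<and> m = 3" and m: "m > 0"
    and f: "f \<in> L_var \<Omega> \<alpha>" and \<alpha>: "\<And>x. x \<in> \<Omega> \<Longrightarrow> 2 * real m / (2 * real m - 1) \<le> \<alpha> x"
  obtains B where "B \<ge> 0" "\<And>u. u \<in> H10 \<Omega> \<Longrightarrow> integrable (lebesgue_on \<Omega>) (\<lambda>x. f x * u x)"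
    "\<And>u. u \<in> H10 \<Omega> \<Longrightarrow> \<bar>load \<Omega> f u\<bar> \<le> B * H10_norm \<Omega> u"
proof -
  have lm: "\<Omega> \<in> lmeasurable" using \<Omega> by (intro lmeasurable_open)
  interpret finite_measure "lebesgue_on \<Omega>" by (rule finite_measure_lebesgue_on[OF lm])
  define q where "q = 2 * real m / (2 * real m - 1)"
  have m2: "2 * real m - 1 > 0" using m by simp
  have q: "q > 1" "1 / q + 1 / (2 * real m) = 1" "2 * real m > 1" using m2 m by (auto simp: q_def field_simps)
  obtain C where C: "C \<ge> 0" "\<And>u. u \<in> H10 \<Omega> \<Longrightarrow> integrable (lebesgue_on \<Omega>) (\<lambda>x. u x ^ (2 * m))"
    "\<And>u. u \<in> H10 \<Omega> \<Longrightarrow> (LINT x|lebesgue_on \<Omega>. u x ^ (2 * m)) \<le> C * H10_norm \<Omega> u ^ (2 * m)"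
    using sobolev_H10[OF \<Omega> dim m] by auto
  define F where "F x = 1 + \<bar>f x\<bar> powr \<alpha> x" for x
  have [measurable]: "f \<in> borel_measurable (lebesgue_on \<Omega>)" using f by (simp add: L_var_def)
  have F: "integrable (lebesgue_on \<Omega>) F" using f by (simp add: F_def[abs_def] L_var_def)
  have young: "\<bar>f x * y\<bar> \<le> F x + y ^ (2 * m)" if x: "x \<in> \<Omega>" for x y
  proof -
    have "\<bar>f x\<bar> * \<bar>y\<bar> \<le> \<bar>f x\<bar> powr q / q + \<bar>y\<bar> powr (2 * real m) / (2 * real m)"
      using q by (intro Youngs_inequality) auto
    also have "\<dots> \<le> \<bar>f x\<bar> powr q + \<bar>y\<bar> powr (2 * real m)"
      using q by (intro add_mono) (auto simp: divide_le_eq mult_le_cancel_left1)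
    also have "\<bar>y\<bar> powr (2 * real m) = y ^ (2 * m)"
    proof (cases "y = 0")
      case False
      then have "\<bar>y\<bar> powr (2 * real m) = \<bar>y\<bar> ^ (2 * m)"
        using powr_realpow[of "\<bar>y\<bar>" "2 * m"] by simp
      then show ?thesis by (simp add: power_even_abs)
    qed (use m in auto)
    also have "\<bar>f x\<bar> powr q \<le> F x"
    proof (cases "\<bar>f x\<bar> \<le> 1")
      case True
      then have "\<bar>f x\<bar> powr q \<le> 1" using q(1) by (simp add: powr_le1)
      then show ?thesis by (simp add: F_def add_increasing2)
    next
      case False
      then have "\<bar>f x\<bar> powr q \<le> \<bar>f x\<bar> powr \<alpha> x" using \<alpha>[OF x] by (intro powr_mono) (auto simp: q_def)
      then show ?thesis by (simp add: F_def)
    qed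
    finally show ?thesis by (simp add: abs_mult)
  qed
  have bounds: "integrable (lebesgue_on \<Omega>) (\<lambda>x. f x * u x)"
    "(LINT x|lebesgue_on \<Omega>. \<bar>f x * u x\<bar>) \<le> H10_norm \<Omega> u * ((LINT x|lebesgue_on \<Omega>. F x) + C)"
    if u: "u \<in> H10 \<Omega>" for u
  proof -
    have [measurable]: "u \<in> borel_measurable (lebesgue_on \<Omega>)"
      using H1_wgrad(3)[OF \<Omega>(1) H10_H1[OF u]] by (rule L2_spaceD)
    have g: "(\<lambda>x. f x * u x) \<in> borel_measurable (lebesgue_on \<Omega>)" by measurable
    have n: "0 \<le> H10_norm \<Omega> u" by (simp add: H10_norm_def)
    have b: "\<bar>f x * u x\<bar> \<le> s ^ 1 * (F x + (u x / s) ^ (2 * m))" if "x \<in> \<Omega>" "s > 0" for x s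
    proof -
      have "\<bar>f x * u x\<bar> = s * \<bar>f x * (u x / s)\<bar>" using that(2) by (simp add: abs_mult)
      also have "\<dots> \<le> s * (F x + (u x / s) ^ (2 * m))"
        by (rule mult_left_mono[OF young[OF that(1)]]) (use that(2) in simp)
      finally show ?thesis by simp
    qed
    show "integrable (lebesgue_on \<Omega>) (\<lambda>x. f x * u x)"
      "(LINT x|lebesgue_on \<Omega>. \<bar>f x * u x\<bar>) \<le> H10_norm \<Omega> u * ((LINT x|lebesgue_on \<Omega>. F x) + C)"
      using integral_bound_by_scaling[OF C(2)[OF u] C(3)[OF u] F C(1) n g b] by simp_all
  qed
  have "0 \<le> (LINT x|lebesgue_on \<Omega>. F x) + C"
    using C(1) by (intro add_nonneg_nonneg Bochner_Integration.integral_nonneg) (simp_all add: F_def)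
  moreover have "\<bar>load \<Omega> f u\<bar> \<le> ((LINT x|lebesgue_on \<Omega>. F x) + C) * H10_norm \<Omega> u" if "u \<in> H10 \<Omega>" for u
    unfolding load_def mult.commute[of "_ + C"]
    by (rule order_trans[OF integral_abs_bound bounds(2)[OF that]])
  ultimately show thesis using bounds(1) by (intro that)
qed

text \<open>
  Both sides of the defining identity are \<open>L\<^sup>2\<close> pairings with a fixed function.
\<close>
lemma weak_gradient_limit:
  fixes \<Omega> :: "'a::euclidean_space set"
  assumes \<Omega>: "open \<Omega>" "bounded \<Omega>" and v: "\<And>n::nat. v n \<in> L2_space \<Omega>" "\<And>n. h n \<in> L2_space \<Omega>"
    "\<And>n. is_weak_gradient \<Omega> (v n) (h n)"
    and w: "w \<in> L2_space \<Omega>" "(\<lambda>n. L2_norm \<Omega> (\<lambda>x. v n x - w x)) \<longlonglongrightarrow> 0"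
    and g: "g \<in> L2_space \<Omega>" "(\<lambda>n. L2_norm \<Omega> (\<lambda>x. h n x - g x)) \<longlonglongrightarrow> 0"
  shows "is_weak_gradient \<Omega> w g"
  unfolding is_weak_gradient_def
proof (intro conjI ballI)
  have lm: "\<Omega> \<in> lmeasurable" using \<Omega> by (intro lmeasurable_open)
  show "locally_integrable \<Omega> w" "locally_integrable \<Omega> g"
    using L2_space_locally_integrable[OF lm] w(1) g(1) by auto
  fix \<psi> and b :: 'a assume \<psi>: "\<psi> \<in> test_functions \<Omega>" and b: "b \<in> Basis"
  note gL2 = test_function_L2(2)[OF \<Omega>(1) \<psi>] and pL2 = test_function_L2(1)[OF \<Omega>(1) \<psi>]
  have pair: "(\<lambda>n. LINT x|lebesgue_on \<Omega>. a n x \<bullet> c x) \<longlonglongrightarrow> (LINT x|lebesgue_on \<Omega>. d x \<bullet> c x)"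
    if a: "\<And>n::nat. a n \<in> L2_space \<Omega>" "d \<in> L2_space \<Omega>" "(\<lambda>n. L2_norm \<Omega> (\<lambda>x. a n x - d x)) \<longlonglongrightarrow> 0"
      and c: "c \<in> L2_space \<Omega>" for a d and c :: "'a \<Rightarrow> 'c::euclidean_space"
  proof -
    have "norm ((LINT x|lebesgue_on \<Omega>. a n x \<bullet> c x) - (LINT x|lebesgue_on \<Omega>. d x \<bullet> c x))
        \<le> L2_norm \<Omega> (\<lambda>x. a n x - d x) * L2_norm \<Omega> c" for n
      using L2_Cauchy_Schwarz[OF L2_space_diff[OF a(1)[of n] a(2)] c]
        L2_inner_integrable[OF a(1)[of n] c] L2_inner_integrable[OF a(2) c]
      by (simp add: inner_diff_left)
    moreover have "(\<lambda>n. L2_norm \<Omega> (\<lambda>x. a n x - d x) * L2_norm \<Omega> c) \<longlonglongrightarrow> 0"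
      using a(3) by (rule tendsto_mult_left_zero)
    ultimately have "(\<lambda>n. (LINT x|lebesgue_on \<Omega>. a n x \<bullet> c x) - (LINT x|lebesgue_on \<Omega>. d x \<bullet> c x)) \<longlonglongrightarrow> 0"
      by (rule Lim_null_comparison[OF always_eventually[OF allI]])
    then show ?thesis by (rule LIM_zero_cancel)
  qed
  have "(\<lambda>x. grad \<psi> x \<bullet> b) \<in> L2_space \<Omega>"
    using L2_spaceD(1)[OF gL2] b
    by (intro L2_space_dominated[OF _ gL2, of _ 1]) (auto intro!: AE_I2 order_trans[OF Cauchy_Schwarz_ineq2])
  from pair[OF v(1) w this]
  have l1: "(\<lambda>n. LINT x|lebesgue_on \<Omega>. v n x * frechet_derivative \<psi> (at x) b)
      \<longlonglongrightarrow> (LINT x|lebesgue_on \<Omega>. w x * frechet_derivative \<psi> (at x) b)"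
    by (simp add: test_function_grad(3)[OF \<psi> b])
  have "(\<lambda>x. \<psi> x *\<^sub>R b) \<in> L2_space \<Omega>"
    using L2_spaceD(1)[OF pL2] b by (intro L2_space_dominated[OF _ pL2, of _ 1]) auto
  from pair[OF v(2) g this]
  have "(\<lambda>n. LINT x|lebesgue_on \<Omega>. (h n x \<bullet> b) * \<psi> x) \<longlonglongrightarrow> (LINT x|lebesgue_on \<Omega>. (g x \<bullet> b) * \<psi> x)"
    by (simp add: mult.commute)
  then have l2: "(\<lambda>n. - (LINT x|lebesgue_on \<Omega>. (h n x \<bullet> b) * \<psi> x)) \<longlonglongrightarrow> - (LINT x|lebesgue_on \<Omega>. (g x \<bullet> b) * \<psi> x)"
    by (rule tendsto_minus)
  have "(LINT x|lebesgue_on \<Omega>. v n x * frechet_derivative \<psi> (at x) b) = - (LINT x|lebesgue_on \<Omega>. (h n x \<bullet> b) * \<psi> x)" for n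
    using v(3)[of n] \<psi> b by (simp add: is_weak_gradient_def)
  with l1 l2 show "(LINT x|lebesgue_on \<Omega>. w x * frechet_derivative \<psi> (at x) b) = - (LINT x|lebesgue_on \<Omega>. (g x \<bullet> b) * \<psi> x)"
    by (simp add: LIMSEQ_unique)
qed

text \<open>
  By the Poincare inequality, gradients that are Cauchy in \<open>L\<^sup>2\<close> force the functions to be Cauchy in \<open>L\<^sup>2\<close>.
\<close>
lemma H10_complete:
  fixes \<Omega> :: "'a::euclidean_space set"
  assumes \<Omega>: "open \<Omega>" "bounded \<Omega>" and dim: "DIM('a) = 2 \<or> DIM('a) = 3"
    and v: "\<And>n::nat. v n \<in> H10 \<Omega>" "\<And>m n. (\<lambda>x. v m x - v n x) \<in> H10 \<Omega>"
    and Cauchy: "\<And>e. e > 0 \<Longrightarrow> \<exists>N. \<forall>m\<ge>N. \<forall>n\<ge>N. H10_norm \<Omega> (\<lambda>x. v m x - v n x) < e"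
  obtains w where "w \<in> H10 \<Omega>" "(\<lambda>n. H10_norm \<Omega> (\<lambda>x. v n x - w x)) \<longlonglongrightarrow> 0"
proof -
  have lm: "\<Omega> \<in> lmeasurable" using \<Omega> by (intro lmeasurable_open)
  have H1: "v n \<in> H1 \<Omega>" for n using v(1) by (rule H10_H1)
  note vL2 = H1_wgrad[OF \<Omega>(1) H1]
  obtain C where C: "C \<ge> 0" "\<And>u. u \<in> H10 \<Omega> \<Longrightarrow> L2_norm \<Omega> u \<le> C * H10_norm \<Omega> u"
    by (rule poincare_H10[OF \<Omega> dim]) (rule that)
  have "\<exists>N. \<forall>m\<ge>N. \<forall>n\<ge>N. L2_norm \<Omega> (\<lambda>x. v m x - v n x) < e" if e: "e > 0" for e
  proof -
    have "e / (C + 1) > 0" using e C(1) by simp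
    from Cauchy[OF this] obtain N where
      N: "\<And>m n. m \<ge> N \<Longrightarrow> n \<ge> N \<Longrightarrow> H10_norm \<Omega> (\<lambda>x. v m x - v n x) < e / (C + 1)" by blast
    have "L2_norm \<Omega> (\<lambda>x. v m x - v n x) < e" if mn: "m \<ge> N" "n \<ge> N" for m n
    proof -
      have "L2_norm \<Omega> (\<lambda>x. v m x - v n x) \<le> C * H10_norm \<Omega> (\<lambda>x. v m x - v n x)" by (rule C(2)[OF v(2)])
      also have "\<dots> \<le> (C + 1) * H10_norm \<Omega> (\<lambda>x. v m x - v n x)"
        by (rule mult_right_mono) (simp_all add: H10_norm_def)
      also have "\<dots> < (C + 1) * (e / (C + 1))"
        by (rule mult_strict_left_mono[OF N[OF mn]]) (use C(1) in simp)
      finally show ?thesis using C(1) by simp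
    qed
    then show ?thesis by blast
  qed
  note Cauchy_v = this
  obtain w where
    w: "w \<in> L2_space \<Omega>" "(\<lambda>k. L2_norm \<Omega> (\<lambda>x. v k x - w x)) \<longlonglongrightarrow> 0"
    by (rule L2_complete[OF lm vL2(3) Cauchy_v]) (assumption, rule that)
  have "\<exists>N. \<forall>m\<ge>N. \<forall>n\<ge>N. L2_norm \<Omega> (\<lambda>x. wgrad \<Omega> (v m) x - wgrad \<Omega> (v n) x) < e" if "e > 0" for e
    using Cauchy[OF that] by (simp add: H10_norm_diff[OF \<Omega>(1) H1 H1])
  note Cauchy_g = this
  obtain g where
    g: "g \<in> L2_space \<Omega>" "(\<lambda>k. L2_norm \<Omega> (\<lambda>x. wgrad \<Omega> (v k) x - g x)) \<longlonglongrightarrow> 0"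
    by (rule L2_complete[OF lm vL2(1) Cauchy_g]) (assumption, rule that)
  have wg: "is_weak_gradient \<Omega> w g"
    by (rule weak_gradient_limit[OF \<Omega> vL2(3) vL2(1) vL2(2) w g])
  have wH1: "w \<in> H1 \<Omega>" by (rule H1_I[OF w(1) wg g(1)])
  have wgrad_w: "AE x in lebesgue_on \<Omega>. wgrad \<Omega> w x = g x" by (rule wgrad_AE_eq[OF \<Omega>(1) wg])
  have norm_eq: "L2_norm \<Omega> (wgrad \<Omega> (\<lambda>x. z x - w x)) = L2_norm \<Omega> (\<lambda>x. wgrad \<Omega> z x - g x)" if z: "z \<in> H1 \<Omega>" for z
  proof (rule L2_norm_cong_AE)
    show "wgrad \<Omega> (\<lambda>x. z x - w x) \<in> borel_measurable (lebesgue_on \<Omega>)"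
      by (rule L2_spaceD(1)[OF H1_wgrad(1)[OF \<Omega>(1) H1_diff[OF \<Omega>(1) z wH1]]])
    show "(\<lambda>x. wgrad \<Omega> z x - g x) \<in> borel_measurable (lebesgue_on \<Omega>)"
      by (rule L2_spaceD(1)[OF L2_space_diff[OF H1_wgrad(1)[OF \<Omega>(1) z] g(1)]])
    show "AE x in lebesgue_on \<Omega>. wgrad \<Omega> (\<lambda>x. z x - w x) x = wgrad \<Omega> z x - g x"
      using wgrad_diff_AE[OF \<Omega>(1) z wH1] wgrad_w by eventually_elim simp
  qed
  have lim: "(\<lambda>n. H10_norm \<Omega> (\<lambda>x. v n x - w x)) \<longlonglongrightarrow> 0"
    unfolding H10_norm_def norm_eq[OF H1] by (rule g(2))
  \<comment> \<open>A diagonal sequence of test functions shows that the limit keeps zero boundary values.\<close>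
  have "\<exists>\<psi>\<in>test_functions \<Omega>. H1_norm \<Omega> (\<lambda>x. \<psi> x - v n x) < inverse (real (Suc n))" for n
  proof -
    obtain \<phi> where \<phi>: "\<And>k::nat. \<phi> k \<in> test_functions \<Omega>" "(\<lambda>k. H1_norm \<Omega> (\<lambda>x. \<phi> k x - v n x)) \<longlonglongrightarrow> 0"
      using v(1)[of n] unfolding H10_def by blast
    have "inverse (real (Suc n)) > 0" by simp
    from order_tendstoD(2)[OF \<phi>(2) this] obtain k where "H1_norm \<Omega> (\<lambda>x. \<phi> k x - v n x) < inverse (real (Suc n))"
      by (auto simp: eventually_sequentially)
    with \<phi>(1) show ?thesis by blast
  qed
  then obtain \<psi> where \<psi>: "\<And>n. \<psi> n \<in> test_functions \<Omega>"
    "\<And>n. H1_norm \<Omega> (\<lambda>x. \<psi> n x - v n x) < inverse (real (Suc n))" by metis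
  have "(\<lambda>n. H1_norm \<Omega> (\<lambda>x. \<psi> n x - w x)) \<longlonglongrightarrow> 0"
  proof (rule tendsto_sandwich[OF _ _ tendsto_const])
    show "\<forall>\<^sub>F n in sequentially. 0 \<le> H1_norm \<Omega> (\<lambda>x. \<psi> n x - w x)" by (simp add: H1_norm_def)
    have "H1_norm \<Omega> (\<lambda>x. \<psi> n x - w x) \<le> 2 * inverse (real (Suc n)) + L2_norm \<Omega> (\<lambda>x. v n x - w x)
        + L2_norm \<Omega> (\<lambda>x. wgrad \<Omega> (v n) x - g x)" for n
    proof -
      have pH1: "\<psi> n \<in> H1 \<Omega>" by (rule test_function_L2(3)[OF \<Omega>(1) \<psi>(1)])
      note pL2 = H1_wgrad[OF \<Omega>(1) pH1]
      have "H1_norm \<Omega> (\<lambda>x. \<psi> n x - w x) \<le> L2_norm \<Omega> (\<lambda>x. \<psi> n x - w x) + L2_norm \<Omega> (\<lambda>x. wgrad \<Omega> (\<psi> n) x - g x)"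
        using H1_norm_bounds(3)[of \<Omega> "\<lambda>x. \<psi> n x - w x"] norm_eq[OF pH1] by simp
      also have "\<dots> \<le> L2_norm \<Omega> (\<lambda>x. \<psi> n x - v n x) + L2_norm \<Omega> (\<lambda>x. v n x - w x)
          + (L2_norm \<Omega> (\<lambda>x. wgrad \<Omega> (\<psi> n) x - wgrad \<Omega> (v n) x) + L2_norm \<Omega> (\<lambda>x. wgrad \<Omega> (v n) x - g x))"
        by (intro add_mono L2_norm_triangle_diff pL2 vL2 w(1) g(1))
      also have "L2_norm \<Omega> (\<lambda>x. wgrad \<Omega> (\<psi> n) x - wgrad \<Omega> (v n) x) = L2_norm \<Omega> (wgrad \<Omega> (\<lambda>x. \<psi> n x - v n x))"
        using H10_norm_diff[OF \<Omega>(1) pH1 H1, of n] by (simp add: H10_norm_def)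
      finally show ?thesis
        using H1_norm_bounds(1,2)[of \<Omega> "\<lambda>x. \<psi> n x - v n x"] \<psi>(2)[of n] by linarith
    qed
    then show "\<forall>\<^sub>F n in sequentially. H1_norm \<Omega> (\<lambda>x. \<psi> n x - w x) \<le> 2 * inverse (real (Suc n))
        + L2_norm \<Omega> (\<lambda>x. v n x - w x) + L2_norm \<Omega> (\<lambda>x. wgrad \<Omega> (v n) x - g x)" by simp
    have "(\<lambda>n. 2 * inverse (real (Suc n)) + L2_norm \<Omega> (\<lambda>x. v n x - w x) + L2_norm \<Omega> (\<lambda>x. wgrad \<Omega> (v n) x - g x))
        \<longlonglongrightarrow> 2 * 0 + 0 + 0"
      by (intro tendsto_add tendsto_mult tendsto_const LIMSEQ_inverse_real_of_nat w(2) g(2))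
    then show "(\<lambda>n. 2 * inverse (real (Suc n)) + L2_norm \<Omega> (\<lambda>x. v n x - w x) + L2_norm \<Omega> (\<lambda>x. wgrad \<Omega> (v n) x - g x))
        \<longlonglongrightarrow> 0" by simp
  qed
  with \<psi>(1) wH1 have "w \<in> H10 \<Omega>" unfolding H10_def by blast
  with lim show thesis by (intro that)
qed

section \<open>Convexity of the relaxed density\<close>

text \<open>
  Convexity stated through prescribed slopes \<open>g'\<close>; unlike conditions on second derivatives, it can be glued
  at a kink of \<open>g'\<close>.
\<close>
definition lies_above_tangents :: "(real \<Rightarrow> real) \<Rightarrow> (real \<Rightarrow> real) \<Rightarrow> real set \<Rightarrow> bool" where
  "lies_above_tangents g g' S \<longleftrightarrow> (\<forall>s\<in>S. \<forall>t\<in>S. g t + g' t * (s - t) \<le> g s)"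

text \<open>
  Adding the two tangent inequalities shows that \<open>g'\<close> is nondecreasing on each piece, so a tangent at
  one side of \<open>c\<close> stays below the tangent at \<open>c\<close> on the other side.
\<close>
lemma lies_above_tangents_Un:
  assumes S: "lies_above_tangents g g' S" and T: "lies_above_tangents g g' T"
    and c: "c \<in> S" "c \<in> T" "\<And>s. s \<in> S \<Longrightarrow> s \<le> c" "\<And>t. t \<in> T \<Longrightarrow> c \<le> t"
  shows "lies_above_tangents g g' (S \<union> T)"
proof -
  have mono: "g' r \<le> g' s" if "lies_above_tangents g g' U" "r \<in> U" "s \<in> U" "r \<le> s" for U r s
  proof (cases "r = s")
    case False
    have "g r + g' r * (s - r) \<le> g s" "g s + g' s * (r - s) \<le> g r"
      using that unfolding lies_above_tangents_def by blast+
    then have "0 \<le> (g' s - g' r) * (s - r)" by (simp add: algebra_simps)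
    with False that(4) show ?thesis by (simp add: zero_le_mult_iff)
  qed simp
  have "g t + g' t * (s - t) \<le> g s" if st: "s \<in> S \<union> T" "t \<in> S \<union> T" for s t
  proof -
    consider "s \<in> S" "t \<in> S" | "s \<in> T" "t \<in> T" | "t \<in> S" "s \<in> T" | "t \<in> T" "s \<in> S"
      using st by blast
    then show ?thesis
    proof cases
      case 3
      have "g t + g' t * (c - t) \<le> g c" "g c + g' c * (s - c) \<le> g s"
        using 3 c S T unfolding lies_above_tangents_def by blast+
      moreover have "g' t * (s - c) \<le> g' c * (s - c)"
        using 3 c mono[OF S] by (intro mult_right_mono) auto
      ultimately show ?thesis by (simp add: algebra_simps)
    next
      case 4
      have "g t + g' t * (c - t) \<le> g c" "g c + g' c * (s - c) \<le> g s"
        using 4 c S T unfolding lies_above_tangents_def by blast+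
      moreover have "g' t * (s - c) \<le> g' c * (s - c)"
        using 4 c mono[OF T] by (intro mult_right_mono_neg) auto
      ultimately show ?thesis by (simp add: algebra_simps)
    qed (use S T in \<open>auto simp: lies_above_tangents_def\<close>)
  qed
  then show ?thesis by (auto simp: lies_above_tangents_def)
qed

lemma lies_above_tangents_quadratic:
  assumes "\<And>t. t \<in> S \<Longrightarrow> g t = a / 2 * t\<^sup>2 + b" "\<And>t. t \<in> S \<Longrightarrow> g' t = a * t" "0 \<le> a"
  shows "lies_above_tangents g g' S"
  unfolding lies_above_tangents_def
proof (intro ballI)
  fix s t assume st: "s \<in> S" "t \<in> S"
  have "0 \<le> a / 2 * (s - t)\<^sup>2" using assms(3) by simp
  then show "g t + g' t * (s - t) \<le> g s"
    using st by (simp add: assms(1,2) power2_eq_square algebra_simps)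
qed

text \<open>
  Convexity in the radius gives convexity in the vector provided that the slope is nonnegative: then
  \<open>norm y * norm z\<close> may be replaced by the smaller \<open>y \<bullet> z\<close>.
\<close>
lemma lies_above_tangents_norm:
  fixes y z :: "'b::euclidean_space"
  assumes g: "lies_above_tangents g (\<lambda>t. k t * t) {0..}" and k: "0 \<le> k (norm y)"
  shows "g (norm y) + k (norm y) * (y \<bullet> (z - y)) \<le> g (norm z)"
proof -
  have "y \<bullet> (z - y) \<le> norm y * (norm z - norm y)"
    using norm_cauchy_schwarz[of y z] by (simp add: inner_diff_right right_diff_distrib flip: power2_norm_eq_inner power2_eq_square)
  then have "k (norm y) * (y \<bullet> (z - y)) \<le> k (norm y) * (norm y * (norm z - norm y))"
    using k by (rule mult_left_mono)
  moreover have "g (norm y) + k (norm y) * norm y * (norm z - norm y) \<le> g (norm z)"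
    using g by (simp add: lies_above_tangents_def)
  ultimately show ?thesis by (simp add: mult.assoc)
qed

lemma square_less_iff: "0 \<le> t \<Longrightarrow> 0 < c \<Longrightarrow> t\<^sup>2 < c\<^sup>2 \<longleftrightarrow> t < (c::real)"
  by (metis less_imp_le power2_less_imp_less power_strict_mono zero_less_numeral)

lemma square_le_iff: "0 \<le> t \<Longrightarrow> 0 < c \<Longrightarrow> t\<^sup>2 \<le> c\<^sup>2 \<longleftrightarrow> t \<le> (c::real)"
  by (metis less_imp_le power2_le_imp_le power_mono)

context
  fixes p :: "'a \<Rightarrow> real" and em ep :: real and x :: 'a
  assumes eps: "0 < em" "em < 1" "1 < ep"
begin

text \<open>
  The three cases of \<open>\<mu>\<close> are one power of the radius clamped to \<open>{em..ep}\<close>.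
\<close>
lemma \<mu>_clamp:
  assumes "0 \<le> t"
  shows "\<mu> p em ep x (t\<^sup>2) = (max em (min t ep)) powr (p x - 2)"
proof -
  have "t\<^sup>2 powr ((p x - 2) / 2) = t powr (p x - 2)" if "0 < t"
  proof -
    have "t\<^sup>2 powr ((p x - 2) / 2) = t powr (2 * ((p x - 2) / 2))"
      using that powr_powr[of t 2 "(p x - 2) / 2"] by (simp only: powr_numeral)
    also have "2 * ((p x - 2) / 2) = p x - 2" by simp
    finally show ?thesis .
  qed
  then show ?thesis
    using assms eps by (auto simp: \<mu>_def square_less_iff square_le_iff max_def min_def)
qed

lemma \<mu>_low: "0 \<le> t \<Longrightarrow> t \<le> em \<Longrightarrow> \<mu> p em ep x (t\<^sup>2) = em powr (p x - 2)"
  and \<mu>_mid: "em \<le> t \<Longrightarrow> t \<le> ep \<Longrightarrow> \<mu> p em ep x (t\<^sup>2) = t powr (p x - 2)"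
  and \<mu>_high: "ep \<le> t \<Longrightarrow> \<mu> p em ep x (t\<^sup>2) = ep powr (p x - 2)"
  using eps by (subst \<mu>_clamp; auto simp: max_def min_def)+

lemma \<phi>_mid:
  assumes "em \<le> t" "t \<le> ep"
  shows "\<phi>_relaxed p em ep x (t\<^sup>2) = 1 / p x * t powr p x"
proof -
  have "t\<^sup>2 powr (p x / 2) = t powr p x" using assms eps by (simp add: powr_powr flip: powr_numeral)
  then show ?thesis using assms eps by (simp add: \<phi>_relaxed_def square_less_iff square_le_iff)
qed

lemma powr_minus_two: "0 < r \<Longrightarrow> r powr (q - 2) * r\<^sup>2 = r powr (q::real)"
  by (simp add: powr_diff powr_numeral)

lemma \<phi>_low:
  assumes "0 \<le> t" "t \<le> em"
  shows "\<phi>_relaxed p em ep x (t\<^sup>2) = 1/2 * em powr (p x - 2) * t\<^sup>2 + (1 / p x - 1/2) * em powr p x"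
proof (cases "t = em")
  case True
  then show ?thesis using \<phi>_mid[of em] eps powr_minus_two[of em "p x"] by (simp add: algebra_simps)
qed (use assms eps in \<open>simp add: \<phi>_relaxed_def square_less_iff\<close>)

lemma \<phi>_high:
  assumes "ep \<le> t"
  shows "\<phi>_relaxed p em ep x (t\<^sup>2) = 1/2 * ep powr (p x - 2) * t\<^sup>2 + (1 / p x - 1/2) * ep powr p x"
proof (cases "t = ep")
  case True
  then show ?thesis using \<phi>_mid[of ep] eps powr_minus_two[of ep "p x"] by (simp add: algebra_simps)
qed (use assms eps in \<open>simp add: \<phi>_relaxed_def square_less_iff square_le_iff not_less\<close>)

text \<open>
  For \<open>\<sigma> = 1\<close>, \<open>a = - m\<close> this is strong convexity, for \<open>\<sigma> = - 1\<close>, \<open>a = L\<close> it is the quadratic upper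
  bound; in both cases the function in question is convex on each of the three pieces, quadratic on the outer two.
\<close>
lemma relaxed_density_tangents:
  assumes p: "1 < p x" and \<xi>: "\<And>t. 0 \<le> t \<Longrightarrow> 0 \<le> \<sigma> * \<xi>' p em ep x t + a"
  shows "lies_above_tangents (\<lambda>t. \<sigma> * \<phi>_relaxed p em ep x (t\<^sup>2) + a / 2 * t\<^sup>2)
    (\<lambda>t. (\<sigma> * \<mu> p em ep x (t\<^sup>2) + a) * t) {0..}"
    (is "lies_above_tangents ?g ?g' _")
proof -
  have low: "lies_above_tangents ?g ?g' {0..em}"
    using \<xi>[of 0] eps
    by (intro lies_above_tangents_quadratic[where a="\<sigma> * em powr (p x - 2) + a"
          and b="\<sigma> * ((1 / p x - 1/2) * em powr p x)"])
       (auto simp: \<phi>_low \<mu>_low \<xi>'_def algebra_simps)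
  have high: "lies_above_tangents ?g ?g' {ep..}"
    using \<xi>[of "ep + 1"] eps
    by (intro lies_above_tangents_quadratic[where a="\<sigma> * ep powr (p x - 2) + a"
          and b="\<sigma> * ((1 / p x - 1/2) * ep powr p x)"])
       (auto simp: \<phi>_high \<mu>_high \<xi>'_def algebra_simps)
  have mid: "lies_above_tangents ?g ?g' {em..ep}"
    unfolding lies_above_tangents_def
  proof (intro ballI)
    fix s t assume st: "s \<in> {em..ep}" "t \<in> {em..ep}"
    let ?h = "\<lambda>t. \<sigma> * (1 / p x * t powr p x) + a / 2 * t\<^sup>2"
      and ?h' = "\<lambda>t. \<sigma> * t powr (p x - 1) + a * t"
      and ?h'' = "\<lambda>t. \<sigma> * ((p x - 1) * t powr (p x - 2)) + a"
    have h: "?h' t * (s - t) \<le> ?h s - ?h t"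
    proof (rule f''_imp_f'[where C="{em..ep}" and f''="?h''"])
      fix r assume r: "r \<in> {em..ep}"
      then have r0: "0 < r" using eps by simp
      show "(?h has_real_derivative ?h' r) (at r)"
      proof (rule DERIV_cong)
        show "(?h has_real_derivative \<sigma> * (1 / p x * (p x * r powr (p x - 1))) + a / 2 * (2 * r)) (at r)"
          using has_real_derivative_powr[OF r0, of "p x"] r0 by (auto intro!: derivative_eq_intros)
      qed (use p in simp)
      show "(?h' has_real_derivative ?h'' r) (at r)"
      proof (rule DERIV_cong)
        show "(?h' has_real_derivative \<sigma> * ((p x - 1) * r powr (p x - 1 - 1)) + a) (at r)"
          using has_real_derivative_powr[OF r0, of "p x - 1"] r0 by (auto intro!: derivative_eq_intros)
      qed simp
      show "0 \<le> ?h'' r" using \<xi>[of r] r r0 by (simp add: \<xi>'_def)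
    qed (use st in auto)
    have g': "?g' t = ?h' t"
    proof -
      have "t powr (p x - 2) * t = t powr (p x - 1)"
        using st eps powr_mult_base[of t "p x - 2"] by (simp add: mult.commute)
      moreover have "\<mu> p em ep x (t\<^sup>2) = t powr (p x - 2)" using st by (simp add: \<mu>_mid)
      ultimately show ?thesis by (simp add: distrib_right mult.assoc)
    qed
    have "?g s = ?h s" "?g t = ?h t" using st by (simp_all add: \<phi>_mid)
    with h show "?g t + ?g' t * (s - t) \<le> ?g s" unfolding g' by linarith
  qed
  have "lies_above_tangents ?g ?g' ({0..em} \<union> {em..ep})"
    using eps by (intro lies_above_tangents_Un[OF low mid, of em]) auto
  then have "lies_above_tangents ?g ?g' ({0..em} \<union> {em..ep} \<union> {ep..})"
    by (rule lies_above_tangents_Un[OF _ high, of _ ep]) (use eps in auto)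
  also have "{0..em} \<union> {em..ep} \<union> {ep..} = {0..}" using eps by auto
  finally show ?thesis .
qed

text \<open>
  Completing the square \<open>a / 2 * (norm (z - y))\<^sup>2\<close> turns the tangent inequality for the shifted density into an
  expansion of the density itself.
\<close>
lemma relaxed_density_expansion:
  fixes y z :: "'b::euclidean_space"
  assumes p: "1 < p x" and \<xi>: "\<And>t. 0 \<le> t \<Longrightarrow> 0 \<le> \<sigma> * \<xi>' p em ep x t + a"
    and \<mu>: "\<And>t. 0 \<le> t \<Longrightarrow> 0 \<le> \<sigma> * \<mu> p em ep x (t\<^sup>2) + a"
  shows "\<sigma> * \<phi>_relaxed p em ep x ((norm y)\<^sup>2) + \<sigma> * (\<mu> p em ep x ((norm y)\<^sup>2) * (y \<bullet> (z - y)))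
      - a / 2 * (norm (z - y))\<^sup>2 \<le> \<sigma> * \<phi>_relaxed p em ep x ((norm z)\<^sup>2)"
proof -
  have "\<sigma> * \<phi>_relaxed p em ep x ((norm y)\<^sup>2) + a / 2 * (norm y)\<^sup>2
      + (\<sigma> * \<mu> p em ep x ((norm y)\<^sup>2) + a) * (y \<bullet> (z - y))
      \<le> \<sigma> * \<phi>_relaxed p em ep x ((norm z)\<^sup>2) + a / 2 * (norm z)\<^sup>2"
    by (rule lies_above_tangents_norm[OF relaxed_density_tangents[OF p \<xi>] \<mu>]) auto
  moreover have "a / 2 * (norm (z - y))\<^sup>2 = a / 2 * (norm z)\<^sup>2 - a / 2 * (norm y)\<^sup>2 - a * (y \<bullet> (z - y))"
    unfolding power2_norm_eq_inner by (simp add: inner_diff inner_commute algebra_simps add_divide_distrib)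
  ultimately show ?thesis by (simp add: algebra_simps)
qed

text \<open>
  The power is monotone in \<open>r\<close>, increasing for \<open>q \<ge> 2\<close> and decreasing for \<open>q < 2\<close>; the extreme base is \<open>em < 1\<close> or
  \<open>ep > 1\<close>, which decides the monotonicity in \<open>q\<close>.
\<close>
lemma powr_bounds:
  assumes "em \<le> r" "r \<le> ep" "Q \<le> q" "q \<le> P"
  shows "min (em powr (P - 2)) (ep powr (Q - 2)) \<le> r powr (q - 2)"
    and "r powr (q - 2) \<le> em powr (Q - 2) + ep powr (P - 2)"
proof -
  have "min (em powr (P - 2)) (ep powr (Q - 2)) \<le> r powr (q - 2) \<and>
      r powr (q - 2) \<le> em powr (Q - 2) + ep powr (P - 2)"
  proof (cases "2 \<le> q")
    case True
    have "em powr (P - 2) \<le> em powr (q - 2)" using eps assms by (intro powr_mono') auto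
    moreover have "em powr (q - 2) \<le> r powr (q - 2)" using True eps assms by (intro powr_mono2) auto
    moreover have "r powr (q - 2) \<le> ep powr (q - 2)" using True eps assms by (intro powr_mono2) auto
    moreover have "ep powr (q - 2) \<le> ep powr (P - 2)" using eps assms by (intro powr_mono) auto
    moreover have "0 \<le> em powr (Q - 2)" by simp
    ultimately show ?thesis by linarith
  next
    case False
    have "ep powr (Q - 2) \<le> ep powr (q - 2)" using eps assms by (intro powr_mono) auto
    moreover have "ep powr (q - 2) \<le> r powr (q - 2)" using False eps assms by (intro powr_mono2') auto
    moreover have "r powr (q - 2) \<le> em powr (q - 2)" using False eps assms by (intro powr_mono2') auto
    moreover have "em powr (q - 2) \<le> em powr (Q - 2)" using eps assms by (intro powr_mono') auto
    moreover have "0 \<le> ep powr (P - 2)" by simp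
    ultimately show ?thesis by linarith
  qed
  then show "min (em powr (P - 2)) (ep powr (Q - 2)) \<le> r powr (q - 2)"
    and "r powr (q - 2) \<le> em powr (Q - 2) + ep powr (P - 2)" by blast+
qed

lemma \<mu>_bounds:
  assumes "Q \<le> p x" "p x \<le> P" "0 \<le> t"
  shows "min (em powr (P - 2)) (ep powr (Q - 2)) \<le> \<mu> p em ep x (t\<^sup>2)"
    and "\<mu> p em ep x (t\<^sup>2) \<le> em powr (Q - 2) + ep powr (P - 2)"
  using powr_bounds[of "max em (min t ep)" Q "p x" P] eps assms by (auto simp: \<mu>_clamp)

lemma \<xi>'_eq_\<mu>:
  assumes "0 \<le> t"
  shows "\<xi>' p em ep x t = (if em \<le> t \<and> t \<le> ep then p x - 1 else 1) * \<mu> p em ep x (t\<^sup>2)"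
  using assms eps by (auto simp: \<xi>'_def \<mu>_clamp max_def min_def)

lemma \<xi>'_bounds:
  assumes "1 < Q" "Q \<le> p x" "p x \<le> P" "0 \<le> t"
  shows "min (em powr (P - 2)) (ep powr (Q - 2)) * min 1 (Q - 1) \<le> \<xi>' p em ep x t"
    and "\<xi>' p em ep x t \<le> max 1 (P - 1) * (em powr (Q - 2) + ep powr (P - 2))"
proof -
  have c: "min 1 (Q - 1) \<le> (if em \<le> t \<and> t \<le> ep then p x - 1 else 1)"
    "(if em \<le> t \<and> t \<le> ep then p x - 1 else 1) \<le> max 1 (P - 1)" "0 \<le> min 1 (Q - 1)"
    using assms by auto
  show "min (em powr (P - 2)) (ep powr (Q - 2)) * min 1 (Q - 1) \<le> \<xi>' p em ep x t"
    unfolding \<xi>'_eq_\<mu>[OF assms(4)] mult.commute[of _ "min 1 (Q - 1)"]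
    by (intro mult_mono c \<mu>_bounds[OF assms(2-4)] order_trans[OF c(3) c(1)]) (auto simp: min_def)
  show "\<xi>' p em ep x t \<le> max 1 (P - 1) * (em powr (Q - 2) + ep powr (P - 2))"
    unfolding \<xi>'_eq_\<mu>[OF assms(4)]
    by (intro mult_mono c \<mu>_bounds[OF assms(2-4)]) (auto simp: \<mu>_clamp[OF assms(4)])
qed

text \<open>
  Where \<open>p x \<ge> 2\<close>, \<open>\<mu>\<close> is below the derivative at the same (clamped) point; where \<open>p x < 2\<close> it is largest
  at \<open>0\<close>, and there the derivative has the same value.
\<close>
lemma \<mu>_le_of_\<xi>'_le:
  assumes \<xi>: "\<And>t. 0 \<le> t \<Longrightarrow> \<xi>' p em ep x t \<le> L" and t: "0 \<le> t"
  shows "\<mu> p em ep x (t\<^sup>2) \<le> L"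
proof -
  define r where "r = max em (min t ep)"
  have r: "em \<le> r" "r \<le> ep" using eps by (auto simp: r_def)
  have \<mu>: "\<mu> p em ep x (t\<^sup>2) = r powr (p x - 2)" using t by (simp add: \<mu>_clamp r_def)
  show ?thesis
  proof (cases "2 \<le> p x")
    case True
    have "1 * r powr (p x - 2) \<le> (p x - 1) * r powr (p x - 2)"
      using True by (intro mult_right_mono) auto
    also have "\<dots> = \<xi>' p em ep x r" using r by (simp add: \<xi>'_def)
    also have "\<dots> \<le> L" using r eps by (intro \<xi>) auto
    finally show ?thesis using \<mu> by simp
  next
    case False
    have "r powr (p x - 2) \<le> em powr (p x - 2)" using False r eps by (intro powr_mono2') auto
    also have "\<dots> = \<xi>' p em ep x 0" using eps by (simp add: \<xi>'_def)
    also have "\<dots> \<le> L" by (intro \<xi>) auto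
    finally show ?thesis using \<mu> by simp
  qed
qed

end

section \<open>Representation of functionals\<close>

text \<open>
  The functional \<open>J v = B v v - 2 l v\<close> is bounded below, and by the parallelogram identity its minimising
  sequences are Cauchy.  Comparing \<open>J\<close> along the line through \<open>v n\<close> in direction \<open>z\<close> bounds
  \<open>B (v n) z - l z\<close>, so the limit represents \<open>l\<close>.
\<close>
lemma coercive_form_represents_functional:
  fixes X :: "('a \<Rightarrow> real) set" and B :: "('a \<Rightarrow> real) \<Rightarrow> ('a \<Rightarrow> real) \<Rightarrow> real"
  assumes X: "(\<lambda>x. 0) \<in> X" "\<And>v w. v \<in> X \<Longrightarrow> w \<in> X \<Longrightarrow> (\<lambda>x. v x + w x) \<in> X"
      "\<And>c v. v \<in> X \<Longrightarrow> (\<lambda>x. c * v x) \<in> X"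
    and B: "\<And>v w z. v \<in> X \<Longrightarrow> w \<in> X \<Longrightarrow> z \<in> X \<Longrightarrow> B (\<lambda>x. v x + w x) z = B v z + B w z"
      "\<And>c v z. v \<in> X \<Longrightarrow> z \<in> X \<Longrightarrow> B (\<lambda>x. c * v x) z = c * B v z"
      "\<And>v w. v \<in> X \<Longrightarrow> w \<in> X \<Longrightarrow> B v w = B w v"
    and l: "\<And>v w. v \<in> X \<Longrightarrow> w \<in> X \<Longrightarrow> l (\<lambda>x. v x + w x) = l v + l w"
      "\<And>c v. v \<in> X \<Longrightarrow> l (\<lambda>x. c * v x) = c * l v"
    and N: "\<And>v. 0 \<le> N v"
    and coercive: "0 < \<kappa>" "\<And>v. v \<in> X \<Longrightarrow> \<kappa> * (N v)\<^sup>2 \<le> B v v"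
    and bounded: "\<And>v w. v \<in> X \<Longrightarrow> w \<in> X \<Longrightarrow> \<bar>B v w\<bar> \<le> U * N v * N w" "\<And>v. v \<in> X \<Longrightarrow> \<bar>l v\<bar> \<le> K * N v"
    and complete: "\<And>v. (\<And>n::nat. v n \<in> X) \<Longrightarrow>
      (\<And>e. e > 0 \<Longrightarrow> \<exists>M. \<forall>m\<ge>M. \<forall>n\<ge>M. N (\<lambda>x. v m x - v n x) < e) \<Longrightarrow>
      \<exists>w\<in>X. (\<lambda>n. N (\<lambda>x. v n x - w x)) \<longlonglongrightarrow> 0"
  shows "\<exists>v\<in>X. \<forall>w\<in>X. B v w = l w"
proof -
  have diff: "(\<lambda>x. v x - w x) \<in> X" if "v \<in> X" "w \<in> X" for v w
    using X(2)[OF that(1) X(3)[OF that(2), of "-1"]] by simp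
  have line: "(\<lambda>x. v x + t * w x) \<in> X" "B (\<lambda>x. v x + t * w x) (\<lambda>x. v x + t * w x) = B v v + 2 * t * B v w + t\<^sup>2 * B w w"
    "l (\<lambda>x. v x + t * w x) = l v + t * l w" if vw: "v \<in> X" "w \<in> X" for v w t
  proof -
    let ?z = "\<lambda>x. v x + t * w x"
    have tw: "(\<lambda>x. t * w x) \<in> X" by (rule X(3)[OF vw(2)])
    show z: "?z \<in> X" by (rule X(2)[OF vw(1) tw])
    have "B v' ?z = B v' v + t * B v' w" if "v' \<in> X" for v'
      using B(3)[OF that z] B(1)[OF vw(1) tw that] B(2)[OF vw(2) that, of t] B(3)[OF vw(1) that] B(3)[OF vw(2) that]
      by simp
    then have "B ?z ?z = B v v + t * B v w + t * (B w v + t * B w w)"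
      using B(1)[OF vw(1) tw z] B(2)[OF vw(2) z, of t] vw by simp
    then show "B ?z ?z = B v v + 2 * t * B v w + t\<^sup>2 * B w w"
      using B(3)[OF vw] by (simp add: power2_eq_square algebra_simps)
    show "l ?z = l v + t * l w" using l(1)[OF vw(1) tw] l(2)[OF vw(2)] by simp
  qed
  define J where "J v = B v v - 2 * l v" for v
  have J_lower: "- K\<^sup>2 / \<kappa> \<le> J v" if v: "v \<in> X" for v
  proof -
    have "0 \<le> (\<kappa> * N v - K)\<^sup>2 / \<kappa>" using coercive(1) by simp
    also have "\<dots> = \<kappa> * (N v)\<^sup>2 - 2 * (K * N v) + K\<^sup>2 / \<kappa>"
      using coercive(1) by (simp add: power2_eq_square field_simps)
    finally show ?thesis
      using coercive(2)[OF v] bounded(2)[OF v] unfolding J_def by (simp add: abs_le_iff)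
  qed
  define d where "d = (INF v\<in>X. J v)"
  have bdd: "bdd_below (J ` X)" using J_lower by (auto simp: bdd_below_def)
  have d: "d \<le> J v" if "v \<in> X" for v unfolding d_def by (rule cINF_lower[OF bdd that])
  have "\<exists>v\<in>X. J v < d + inverse (real (Suc n))" for n
  proof -
    have "Inf (J ` X) < d + inverse (real (Suc n))" by (simp add: d_def)
    then show ?thesis using cInf_lessD[of "J ` X"] X(1) by blast
  qed
  then obtain v where v: "\<And>n. v n \<in> X" "\<And>n. J (v n) < d + inverse (real (Suc n))" by metis
  have par: "B (\<lambda>x. v m x - v n x) (\<lambda>x. v m x - v n x) \<le> 2 * inverse (real (Suc m)) + 2 * inverse (real (Suc n))" for m n
  proof -
    have z: "(\<lambda>x. (1/2) * (v m x + 1 * v n x)) \<in> X" by (intro X(3) line(1) v(1))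
    define y where "y x = v m x + 1 * v n x" for x
    have y: "y \<in> X" "(\<lambda>x. (1/2) * y x) \<in> X" using line(1)[OF v(1) v(1), of m 1 n] z by (simp_all add: y_def[abs_def])
    have "J (\<lambda>x. (1/2) * y x) = 1/4 * B y y - l y"
      unfolding J_def B(2)[OF y(1) y(2)] B(3)[OF y] B(2)[OF y(1) y(1)] l(2)[OF y(1)] by simp
    then have "J (\<lambda>x. (1/2) * (v m x + 1 * v n x)) = 1/4 * B (\<lambda>x. v m x + 1 * v n x) (\<lambda>x. v m x + 1 * v n x) - l (\<lambda>x. v m x + 1 * v n x)"
      by (simp only: y_def[abs_def])
    also have "4 * \<dots> = B (v m) (v m) + 2 * B (v m) (v n) + B (v n) (v n) - 4 * l (v m) - 4 * l (v n)"
      unfolding line(2)[OF v(1) v(1)] line(3)[OF v(1) v(1)] by simp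
    finally have "4 * J (\<lambda>x. (1/2) * (v m x + 1 * v n x))
        = B (v m) (v m) + 2 * B (v m) (v n) + B (v n) (v n) - 4 * l (v m) - 4 * l (v n)" .
    moreover have "B (\<lambda>x. v m x - v n x) (\<lambda>x. v m x - v n x) = B (v m) (v m) - 2 * B (v m) (v n) + B (v n) (v n)"
      using line(2)[OF v(1) v(1), of m "-1" n] by simp
    ultimately show ?thesis using d[OF z] v(2)[of m] v(2)[of n] J_def[of "v m"] J_def[of "v n"] by linarith
  qed
  have "\<exists>M. \<forall>m\<ge>M. \<forall>n\<ge>M. N (\<lambda>x. v m x - v n x) < e" if e: "e > 0" for e
  proof -
    have "\<kappa> * e\<^sup>2 / 4 > 0" using e coercive(1) by simp
    then obtain M where M: "inverse (real (Suc M)) < \<kappa> * e\<^sup>2 / 4" using reals_Archimedean by blast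
    have "N (\<lambda>x. v m x - v n x) < e" if mn: "m \<ge> M" "n \<ge> M" for m n
    proof -
      have "inverse (real (Suc m)) \<le> inverse (real (Suc M))" "inverse (real (Suc n)) \<le> inverse (real (Suc M))"
        using mn by (auto intro: le_imp_inverse_le)
      then have "\<kappa> * (N (\<lambda>x. v m x - v n x))\<^sup>2 < \<kappa> * e\<^sup>2"
        using par[of m n] coercive(2)[OF diff[OF v(1) v(1)], of m n] M by linarith
      then have "(N (\<lambda>x. v m x - v n x))\<^sup>2 < e\<^sup>2" using coercive(1) by simp
      then show ?thesis by (rule power2_less_imp_less) (use e in simp)
    qed
    then show ?thesis by blast
  qed
  from complete[OF v(1) this] obtain w where w: "w \<in> X" "(\<lambda>n. N (\<lambda>x. v n x - w x)) \<longlonglongrightarrow> 0" by blast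
  have "B w z = l z" if z: "z \<in> X" for z
  proof -
    have "(B (v n) z - l z)\<^sup>2 \<le> inverse (real (Suc n)) * B z z" for n
    proof (rule nonneg_quadratic_discriminant)
      have "0 \<le> \<kappa> * (N z)\<^sup>2" using coercive(1) by simp
      then show "0 \<le> B z z" using coercive(2)[OF z] by (rule order_trans)
      fix t
      have "d \<le> J (\<lambda>x. v n x + t * z x)" by (intro d line(1) v(1) z)
      also have "\<dots> = J (v n) + 2 * t * (B (v n) z - l z) + t\<^sup>2 * B z z"
        unfolding J_def line(2)[OF v(1) z] line(3)[OF v(1) z] by (simp add: algebra_simps)
      finally show "0 \<le> inverse (real (Suc n)) + 2 * t * (B (v n) z - l z) + t\<^sup>2 * B z z"
        using v(2)[of n] by linarith
    qed
    then have "norm ((B (v n) z - l z)\<^sup>2) \<le> inverse (real (Suc n)) * B z z" for n by simp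
    moreover have "(\<lambda>n. inverse (real (Suc n)) * B z z) \<longlonglongrightarrow> 0"
      by (rule tendsto_mult_left_zero[OF LIMSEQ_inverse_real_of_nat])
    ultimately have "(\<lambda>n. (B (v n) z - l z)\<^sup>2) \<longlonglongrightarrow> 0"
      by (rule Lim_null_comparison[OF always_eventually[OF allI]])
    then have "(\<lambda>n. B (v n) z - l z) \<longlonglongrightarrow> 0" by simp
    then have 1: "(\<lambda>n. B (v n) z) \<longlonglongrightarrow> l z" by (rule LIM_zero_cancel)
    have "norm (B (v n) z - B w z) \<le> N (\<lambda>x. v n x - w x) * (U * N z)" for n
    proof -
      have "B (\<lambda>x. v n x - w x) z = B (v n) z - B w z"
        using B(1)[OF v(1) X(3)[OF w(1), of "-1"] z, of n] B(2)[OF w(1) z, of "-1"] by simp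
      then show ?thesis using bounded(1)[OF diff[OF v(1) w(1)] z, of n] by (simp add: mult_ac)
    qed
    moreover have "(\<lambda>n. N (\<lambda>x. v n x - w x) * (U * N z)) \<longlonglongrightarrow> 0" by (rule tendsto_mult_left_zero[OF w(2)])
    ultimately have "(\<lambda>n. B (v n) z - B w z) \<longlonglongrightarrow> 0"
      by (rule Lim_null_comparison[OF always_eventually[OF allI]])
    then have "(\<lambda>n. B (v n) z) \<longlonglongrightarrow> B w z" by (rule LIM_zero_cancel)
    with 1 show ?thesis by (simp add: LIMSEQ_unique)
  qed
  with w(1) show ?thesis by blast
qed

section \<open>Convergence of the damped scheme\<close>

text \<open>
  The assumption on \<open>f\<close> is the continuity of the load on \<open>H10\<close>, which is all that is left of the source
  after the Sobolev embedding.
\<close>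
locale relaxed_problem =
  fixes \<Omega> :: "'a::euclidean_space set" and p f :: "'a \<Rightarrow> real" and em ep Bf :: real
    and X :: "('a \<Rightarrow> real) set"
  assumes dim: "DIM('a) = 2 \<or> DIM('a) = 3"
    and \<Omega>: "open \<Omega>" "bounded \<Omega>" and exponent: "p \<in> C_plus (closure \<Omega>)"
    and eps: "0 < em" "em < 1" "1 < ep" and subspace: "closed_subspace_H10 \<Omega> X"
    and load: "\<And>v. v \<in> H10 \<Omega> \<Longrightarrow> integrable (lebesgue_on \<Omega>) (\<lambda>x. f x * v x)"
      "\<And>v. v \<in> H10 \<Omega> \<Longrightarrow> \<bar>load \<Omega> f v\<bar> \<le> Bf * H10_norm \<Omega> v"
begin

abbreviation G :: "('a \<Rightarrow> real) \<Rightarrow> 'a \<Rightarrow> 'a" where "G v \<equiv> wgrad \<Omega> v"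
abbreviation W :: "('a \<Rightarrow> real) \<Rightarrow> 'a \<Rightarrow> real" where "W u x \<equiv> \<mu> p em ep x ((norm (G u x))\<^sup>2)"
abbreviation N :: "('a \<Rightarrow> real) \<Rightarrow> real" where "N v \<equiv> H10_norm \<Omega> v"
abbreviation E :: "('a \<Rightarrow> real) \<Rightarrow> real" where "E \<equiv> energy \<Omega> p em ep f"
abbreviation A :: "('a \<Rightarrow> real) \<Rightarrow> ('a \<Rightarrow> real) \<Rightarrow> ('a \<Rightarrow> real) \<Rightarrow> real" where "A \<equiv> A_op \<Omega> p em ep"
abbreviation F :: "('a \<Rightarrow> real) \<Rightarrow> ('a \<Rightarrow> real) \<Rightarrow> real" where "F \<equiv> F_op \<Omega> p em ep f"

definition P :: real where "P = (SUP x\<in>closure \<Omega>. p x)"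
definition Q :: real where "Q = (INF x\<in>closure \<Omega>. p x)"
text \<open>
  \<open>U\<close> is a common upper bound of \<open>\<mu>\<close> and \<open>\<xi>'\<close>, and \<open>m\<close> a common positive lower bound.
\<close>
definition U :: real where "U = max 1 (P - 1) * (em powr (Q - 2) + ep powr (P - 2))"
definition m :: real where "m = \<mu>_minus \<Omega> p em ep * min 1 (Q - 1)"

lemma lmeasurable: "\<Omega> \<in> lmeasurable" using \<Omega> by (intro lmeasurable_open)

lemma X_zero: "(\<lambda>x. 0) \<in> X"
  and X_add: "v \<in> X \<Longrightarrow> w \<in> X \<Longrightarrow> (\<lambda>x. v x + w x) \<in> X"
  and X_scale: "v \<in> X \<Longrightarrow> (\<lambda>x. c * v x) \<in> X"
  and X_H10: "v \<in> X \<Longrightarrow> v \<in> H10 \<Omega>"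
  and X_closed: "(\<And>k::nat. v' k \<in> X) \<Longrightarrow> w \<in> H10 \<Omega> \<Longrightarrow> (\<lambda>k. N (\<lambda>x. v' k x - w x)) \<longlonglongrightarrow> 0 \<Longrightarrow> w \<in> X"
  using subspace unfolding closed_subspace_H10_def by blast+

lemma X_diff: "v \<in> X \<Longrightarrow> w \<in> X \<Longrightarrow> (\<lambda>x. v x - w x) \<in> X"
  using X_add[OF _ X_scale[of w "-1"], of v] by simp

lemma X_H1: "v \<in> X \<Longrightarrow> v \<in> H1 \<Omega>" by (intro H10_H1 X_H10)

lemma G_L2: "v \<in> X \<Longrightarrow> G v \<in> L2_space \<Omega>" by (intro H1_wgrad(1)[OF \<Omega>(1)] X_H1)

lemma G_measurable: "v \<in> X \<Longrightarrow> G v \<in> borel_measurable (lebesgue_on \<Omega>)"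
  by (intro L2_spaceD(1) G_L2)

lemma G_add: "v \<in> X \<Longrightarrow> w \<in> X \<Longrightarrow> AE x in lebesgue_on \<Omega>. G (\<lambda>x. v x + w x) x = G v x + G w x"
  by (intro wgrad_add_AE[OF \<Omega>(1)] X_H1)

lemma G_scale: "v \<in> X \<Longrightarrow> AE x in lebesgue_on \<Omega>. G (\<lambda>x. c * v x) x = c *\<^sub>R G v x"
  by (intro wgrad_scale_AE[OF \<Omega>(1)] X_H1)

lemma G_diff: "v \<in> X \<Longrightarrow> w \<in> X \<Longrightarrow> AE x in lebesgue_on \<Omega>. G (\<lambda>x. v x - w x) x = G v x - G w x"
  by (intro wgrad_diff_AE[OF \<Omega>(1)] X_H1)

lemma N_nonneg: "0 \<le> N v" by (simp add: H10_norm_def)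

lemma N_diff: "v \<in> X \<Longrightarrow> w \<in> X \<Longrightarrow> N (\<lambda>x. v x - w x) = L2_norm \<Omega> (\<lambda>x. G v x - G w x)"
  by (intro H10_norm_diff[OF \<Omega>(1)] X_H1)

lemma N_diff_commute: "v \<in> X \<Longrightarrow> w \<in> X \<Longrightarrow> N (\<lambda>x. v x - w x) = N (\<lambda>x. w x - v x)"
  by (simp add: N_diff L2_norm_minus_commute[of \<Omega> "G v"])

lemma N_triangle:
  "v \<in> X \<Longrightarrow> w \<in> X \<Longrightarrow> z \<in> X \<Longrightarrow> N (\<lambda>x. v x - z x) \<le> N (\<lambda>x. v x - w x) + N (\<lambda>x. w x - z x)"
  by (simp add: N_diff L2_norm_triangle_diff G_L2)

lemma p_bounds: "1 < Q" "x \<in> \<Omega> \<Longrightarrow> Q \<le> p x" "x \<in> \<Omega> \<Longrightarrow> p x \<le> P"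
proof -
  show "1 < Q" using exponent by (simp add: C_plus_def Q_def)
  have "compact (closure \<Omega>)" "continuous_on (closure \<Omega>) p"
    using \<Omega>(2) exponent by (auto simp: compact_closure C_plus_def)
  then have "bounded (p ` closure \<Omega>)" by (intro compact_imp_bounded compact_continuous_image)
  then have bdd: "bdd_above (p ` closure \<Omega>)" "bdd_below (p ` closure \<Omega>)"
    by (auto intro: bounded_imp_bdd_above bounded_imp_bdd_below)
  show "x \<in> \<Omega> \<Longrightarrow> Q \<le> p x" "x \<in> \<Omega> \<Longrightarrow> p x \<le> P"
    unfolding Q_def P_def using closure_subset[of \<Omega>]
    by (auto intro!: cINF_lower[OF bdd(2)] cSUP_upper[OF _ bdd(1)])
qed

lemma p_gt_1: "x \<in> \<Omega> \<Longrightarrow> 1 < p x" using p_bounds(1) p_bounds(2)[of x] by linarith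

lemma \<mu>_minus_eq: "\<mu>_minus \<Omega> p em ep = min (em powr (P - 2)) (ep powr (Q - 2))"
  by (simp add: \<mu>_minus_def P_def Q_def)

lemma \<mu>_minus_pos: "0 < \<mu>_minus \<Omega> p em ep" using eps by (simp add: \<mu>_minus_eq)

lemma m_pos: "0 < m" using \<mu>_minus_pos p_bounds(1) by (simp add: m_def)

lemma U_nonneg: "0 \<le> U" by (simp add: U_def)

lemma \<mu>_bounds_\<Omega>:
  assumes "x \<in> \<Omega>" "0 \<le> t"
  shows "\<mu>_minus \<Omega> p em ep \<le> \<mu> p em ep x (t\<^sup>2)" "m \<le> \<mu> p em ep x (t\<^sup>2)" "\<mu> p em ep x (t\<^sup>2) \<le> U"
    "0 \<le> \<mu> p em ep x (t\<^sup>2)"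
proof -
  note b = \<mu>_bounds[where p=p, OF eps p_bounds(2,3)[OF assms(1)] assms(2)]
  show 1: "\<mu>_minus \<Omega> p em ep \<le> \<mu> p em ep x (t\<^sup>2)" using b(1) by (simp add: \<mu>_minus_eq)
  have "m \<le> \<mu>_minus \<Omega> p em ep * 1" unfolding m_def using \<mu>_minus_pos by (intro mult_left_mono) auto
  with 1 show "m \<le> \<mu> p em ep x (t\<^sup>2)" by simp
  have "1 * (em powr (Q - 2) + ep powr (P - 2)) \<le> U" unfolding U_def by (intro mult_right_mono) auto
  with b(2) show "\<mu> p em ep x (t\<^sup>2) \<le> U" by simp
  show "0 \<le> \<mu> p em ep x (t\<^sup>2)" using 1 \<mu>_minus_pos by linarith
qed

lemma \<xi>'_bounds_\<Omega>:
  assumes "x \<in> \<Omega>" "0 \<le> t"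
  shows "m \<le> \<xi>' p em ep x t" "\<xi>' p em ep x t \<le> U"
  using \<xi>'_bounds[where p=p, OF eps p_bounds(1) p_bounds(2,3)[OF assms(1)] assms(2)]
  by (simp_all add: m_def U_def \<mu>_minus_eq)

lemma p_measurable: "p \<in> borel_measurable (lebesgue_on \<Omega>)"
proof (rule continuous_imp_measurable_on_sets_lebesgue)
  show "continuous_on \<Omega> p" using exponent closure_subset by (auto simp: C_plus_def intro: continuous_on_subset)
qed (use \<Omega>(1) in simp)

lemma \<mu>_measurable:
  assumes [measurable]: "t \<in> borel_measurable (lebesgue_on \<Omega>)"
  shows "(\<lambda>x. \<mu> p em ep x (t x)) \<in> borel_measurable (lebesgue_on \<Omega>)"
proof -
  note [measurable] = p_measurable
  show ?thesis unfolding \<mu>_def by measurable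
qed

lemma \<phi>_measurable:
  assumes [measurable]: "t \<in> borel_measurable (lebesgue_on \<Omega>)"
  shows "(\<lambda>x. \<phi>_relaxed p em ep x (t x)) \<in> borel_measurable (lebesgue_on \<Omega>)"
proof -
  note [measurable] = p_measurable
  show ?thesis unfolding \<phi>_relaxed_def by measurable
qed

lemma weighted_G_L2:
  assumes u: "u \<in> X" and v: "v \<in> X"
  shows "(\<lambda>x. W u x *\<^sub>R G v x) \<in> L2_space \<Omega>"
    "L2_norm \<Omega> (\<lambda>x. W u x *\<^sub>R G v x) \<le> U * N v"
proof -
  note [measurable] = G_measurable[OF u] G_measurable[OF v]
  have meas: "(\<lambda>x. W u x *\<^sub>R G v x) \<in> borel_measurable (lebesgue_on \<Omega>)"
    by (intro borel_measurable_scaleR \<mu>_measurable) measurable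
  have le: "norm (W u x *\<^sub>R G v x) \<le> U * norm (G v x)" if "x \<in> \<Omega>" for x
    using \<mu>_bounds_\<Omega>(3,4)[OF that norm_ge_zero, of "G u x"] by (simp add: mult_right_mono)
  show L2: "(\<lambda>x. W u x *\<^sub>R G v x) \<in> L2_space \<Omega>"
    using le by (intro L2_space_dominated[OF meas G_L2[OF v], of U] AE_I2) simp
  have "(L2_norm \<Omega> (\<lambda>x. W u x *\<^sub>R G v x))\<^sup>2 \<le> (L2_norm \<Omega> (\<lambda>x. U *\<^sub>R G v x))\<^sup>2"
    unfolding L2_norm_square
  proof (rule integral_mono)
    fix x assume "x \<in> space (lebesgue_on \<Omega>)"
    then show "(norm (W u x *\<^sub>R G v x))\<^sup>2 \<le> (norm (U *\<^sub>R G v x))\<^sup>2"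
      using le[of x] U_nonneg by (intro power_mono) auto
  qed (use L2_spaceD(2)[OF L2] L2_spaceD(2)[OF L2_space_scaleR[OF G_L2[OF v], of U]] in auto)
  then have "L2_norm \<Omega> (\<lambda>x. W u x *\<^sub>R G v x) \<le> L2_norm \<Omega> (\<lambda>x. U *\<^sub>R G v x)"
    by (rule power2_le_imp_le) simp
  then show "L2_norm \<Omega> (\<lambda>x. W u x *\<^sub>R G v x) \<le> U * N v"
    using U_nonneg by (simp add: L2_norm_scaleR H10_norm_def)
qed

lemma A_integrable:
  assumes "u \<in> X" "v \<in> X" "w \<in> X"
  shows "integrable (lebesgue_on \<Omega>) (\<lambda>x. W u x * (G v x \<bullet> G w x))"
  using L2_inner_integrable[OF weighted_G_L2(1)[OF assms(1,2)] G_L2[OF assms(3)]] by simp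

lemma A_bound:
  assumes "u \<in> X" "v \<in> X" "w \<in> X"
  shows "\<bar>A u v w\<bar> \<le> U * N v * N w"
proof -
  have "\<bar>A u v w\<bar> \<le> L2_norm \<Omega> (\<lambda>x. W u x *\<^sub>R G v x) * L2_norm \<Omega> (G w)"
    using L2_Cauchy_Schwarz[OF weighted_G_L2(1)[OF assms(1,2)] G_L2[OF assms(3)]] by (simp add: A_op_def)
  also have "\<dots> \<le> U * N v * L2_norm \<Omega> (G w)"
    by (intro mult_right_mono weighted_G_L2(2) assms) simp
  finally show ?thesis by (simp add: H10_norm_def)
qed

text \<open>
  Identities for weak gradients hold only almost everywhere and enter \<open>A\<close> through this lemma.
\<close>
lemma A_cong:
  assumes "u \<in> X" "v \<in> X" "w \<in> X" "g \<in> borel_measurable (lebesgue_on \<Omega>)" "AE x in lebesgue_on \<Omega>. G v x = g x"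
  shows "A u v w = (LINT x|lebesgue_on \<Omega>. W u x * (g x \<bullet> G w x))"
  unfolding A_op_def
proof (rule integral_cong_AE)
  note [measurable] = G_measurable[OF assms(1)] G_measurable[OF assms(2)] G_measurable[OF assms(3)] assms(4)
  show "(\<lambda>x. W u x * (G v x \<bullet> G w x)) \<in> borel_measurable (lebesgue_on \<Omega>)"
    "(\<lambda>x. W u x * (g x \<bullet> G w x)) \<in> borel_measurable (lebesgue_on \<Omega>)"
    by (intro borel_measurable_times \<mu>_measurable; measurable)+
qed (use assms(5) in \<open>eventually_elim, simp\<close>)

lemma A_commute: "A u v w = A u w v"
  by (simp add: A_op_def inner_commute)

lemma A_add:
  assumes "u \<in> X" "v \<in> X" "w \<in> X" "z \<in> X"
  shows "A u (\<lambda>x. v x + w x) z = A u v z + A u w z"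
proof -
  have "A u (\<lambda>x. v x + w x) z = (LINT x|lebesgue_on \<Omega>. W u x * ((G v x + G w x) \<bullet> G z x))"
    using G_measurable[OF assms(2)] G_measurable[OF assms(3)]
    by (intro A_cong[OF assms(1) X_add[OF assms(2,3)] assms(4)] G_add assms) simp_all
  then show ?thesis
    using A_integrable[OF assms(1,2,4)] A_integrable[OF assms(1,3,4)]
    by (simp add: A_op_def inner_add_left distrib_left)
qed

lemma A_scale:
  assumes "u \<in> X" "v \<in> X" "z \<in> X"
  shows "A u (\<lambda>x. c * v x) z = c * A u v z"
proof -
  have "A u (\<lambda>x. c * v x) z = (LINT x|lebesgue_on \<Omega>. W u x * ((c *\<^sub>R G v x) \<bullet> G z x))"
    using G_measurable[OF assms(2)]
    by (intro A_cong[OF assms(1) X_scale[OF assms(2)] assms(3)] G_scale assms) simp_all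
  also have "\<dots> = (LINT x|lebesgue_on \<Omega>. c * (W u x * (G v x \<bullet> G z x)))"
    by (simp add: mult.left_commute)
  finally show ?thesis by (simp add: A_op_def)
qed

lemma A_coercive:
  assumes u: "u \<in> X" and v: "v \<in> X"
  shows "\<mu>_minus \<Omega> p em ep * (N v)\<^sup>2 \<le> A u v v"
proof -
  have "\<mu>_minus \<Omega> p em ep * (N v)\<^sup>2 = (LINT x|lebesgue_on \<Omega>. \<mu>_minus \<Omega> p em ep * (norm (G v x))\<^sup>2)"
    by (simp add: H10_norm_def L2_norm_square)
  also have "\<dots> \<le> (LINT x|lebesgue_on \<Omega>. W u x * (G v x \<bullet> G v x))"
  proof (rule integral_mono[OF _ A_integrable[OF u v v]])
    show "integrable (lebesgue_on \<Omega>) (\<lambda>x. \<mu>_minus \<Omega> p em ep * (norm (G v x))\<^sup>2)"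
      using L2_spaceD(2)[OF G_L2[OF v]] by simp
    fix x assume "x \<in> space (lebesgue_on \<Omega>)"
    then show "\<mu>_minus \<Omega> p em ep * (norm (G v x))\<^sup>2 \<le> W u x * (G v x \<bullet> G v x)"
      unfolding power2_norm_eq_inner[of "G v x", symmetric]
      by (intro mult_right_mono \<mu>_bounds_\<Omega>(1)) simp_all
  qed
  finally show ?thesis by (simp add: A_op_def)
qed

lemma load_add: "v \<in> X \<Longrightarrow> w \<in> X \<Longrightarrow> load \<Omega> f (\<lambda>x. v x + w x) = load \<Omega> f v + load \<Omega> f w"
  using load(1)[OF X_H10, of v] load(1)[OF X_H10, of w] by (simp add: load_def distrib_left)

lemma load_scale: "load \<Omega> f (\<lambda>x. c * v x) = c * load \<Omega> f v"
  by (simp add: load_def mult.left_commute)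

lemma F_add: "u \<in> X \<Longrightarrow> v \<in> X \<Longrightarrow> w \<in> X \<Longrightarrow> F u (\<lambda>x. v x + w x) = F u v + F u w"
  by (simp add: F_op_def load_add A_commute[of u u] A_add)

lemma F_scale: "u \<in> X \<Longrightarrow> v \<in> X \<Longrightarrow> F u (\<lambda>x. c * v x) = c * F u v"
  by (simp add: F_op_def load_scale A_commute[of u u] A_scale right_diff_distrib)

lemma F_diff: "u \<in> X \<Longrightarrow> v \<in> X \<Longrightarrow> w \<in> X \<Longrightarrow> F u (\<lambda>x. v x - w x) = F u v - F u w"
  using F_add[of u v "\<lambda>x. (-1) * w x"] F_scale[of u w "-1"] X_scale[of w "-1"] by simp

lemma F_bound: "u \<in> X \<Longrightarrow> v \<in> X \<Longrightarrow> \<bar>F u v\<bar> \<le> (U * N u + Bf) * N v"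
  using A_bound[of u u v] load(2)[OF X_H10, of v] by (simp add: F_op_def distrib_right)

lemma X_complete:
  assumes v: "\<And>n::nat. v n \<in> X"
    and Cauchy: "\<And>e. e > 0 \<Longrightarrow> \<exists>M. \<forall>m\<ge>M. \<forall>n\<ge>M. N (\<lambda>x. v m x - v n x) < e"
  shows "\<exists>w\<in>X. (\<lambda>n. N (\<lambda>x. v n x - w x)) \<longlonglongrightarrow> 0"
proof -
  obtain w where "w \<in> H10 \<Omega>" "(\<lambda>n. N (\<lambda>x. v n x - w x)) \<longlonglongrightarrow> 0"
    using H10_complete[OF \<Omega> dim X_H10[OF v] X_H10[OF X_diff[OF v v]] Cauchy] by blast
  with X_closed[of v w] v show ?thesis by blast
qed

lemma A_inv:
  assumes u: "u \<in> X"
  shows "A_inv \<Omega> p em ep X u (F u) \<in> X"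
    and "w \<in> X \<Longrightarrow> A u (A_inv \<Omega> p em ep X u (F u)) w = F u w"
proof -
  have "\<exists>v\<in>X. \<forall>w\<in>X. A u v w = F u w"
    by (rule coercive_form_represents_functional[where B="A u" and l="F u" and N=N and
          \<kappa>="\<mu>_minus \<Omega> p em ep" and U=U and K="U * N u + Bf", OF X_zero X_add X_scale A_add[OF u] A_scale[OF u]
          A_commute F_add[OF u] F_scale[OF u] N_nonneg \<mu>_minus_pos A_coercive[OF u] A_bound[OF u] F_bound[OF u]
          X_complete])
  then have "\<exists>v. v \<in> X \<and> (\<forall>w\<in>X. A u v w = F u w)" by blast
  from someI_ex[OF this] show "A_inv \<Omega> p em ep X u (F u) \<in> X"
    and "w \<in> X \<Longrightarrow> A u (A_inv \<Omega> p em ep X u (F u)) w = F u w"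
    unfolding A_inv_def by blast+
qed

text \<open>
  The expansions at \<open>0\<close> with \<open>\<sigma> = 1\<close> and \<open>\<sigma> = - 1\<close> bound the density by a quadratic function of the gradient.
\<close>
lemma density_integrable:
  assumes v: "v \<in> X"
  shows "integrable (lebesgue_on \<Omega>) (\<lambda>x. \<phi>_relaxed p em ep x ((norm (G v x))\<^sup>2))"
proof -
  interpret finite_measure "lebesgue_on \<Omega>" by (rule finite_measure_lebesgue_on[OF lmeasurable])
  note [measurable] = G_measurable[OF v]
  have bound: "\<bar>\<phi>_relaxed p em ep x ((norm (G v x))\<^sup>2)\<bar> \<le> 1 + U / 2 * (norm (G v x))\<^sup>2" if x: "x \<in> \<Omega>" for x
  proof -
    have at_0: "\<phi>_relaxed p em ep x ((norm (0::'a))\<^sup>2) = (1 / p x - 1/2) * em powr p x"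
      using eps by (simp add: \<phi>_relaxed_def)
    have px: "1 < p x" by (rule p_gt_1[OF x])
    have "\<bar>(1 / p x - 1/2) * em powr p x\<bar> \<le> 1 * 1"
      unfolding abs_mult using px eps
      by (intro mult_mono) (auto simp: abs_le_iff field_simps powr_le1)
    moreover have "(1 / p x - 1/2) * em powr p x \<le> \<phi>_relaxed p em ep x ((norm (G v x))\<^sup>2)"
      using relaxed_density_expansion[where p=p, OF eps px, of 1 0 "0::'a" "G v x"] \<xi>'_bounds_\<Omega>[OF x] \<mu>_bounds_\<Omega>[OF x] m_pos
      unfolding at_0 by (force intro: order_trans[OF less_imp_le])
    moreover have "\<phi>_relaxed p em ep x ((norm (G v x))\<^sup>2) \<le> (1 / p x - 1/2) * em powr p x + U / 2 * (norm (G v x))\<^sup>2"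
      using relaxed_density_expansion[where p=p, OF eps px, of "-1" U "0::'a" "G v x"] \<xi>'_bounds_\<Omega>(2)[OF x] \<mu>_bounds_\<Omega>(3)[OF x]
      unfolding at_0 by force
    moreover have "0 \<le> U / 2 * (norm (G v x))\<^sup>2" using U_nonneg by simp
    ultimately show ?thesis unfolding abs_le_iff by linarith
  qed
  show ?thesis
  proof (rule Bochner_Integration.integrable_bound)
    show "integrable (lebesgue_on \<Omega>) (\<lambda>x. 1 + U / 2 * (norm (G v x))\<^sup>2)"
      using L2_spaceD(2)[OF G_L2[OF v]] by simp
    show "(\<lambda>x. \<phi>_relaxed p em ep x ((norm (G v x))\<^sup>2)) \<in> borel_measurable (lebesgue_on \<Omega>)"
      by (intro \<phi>_measurable) measurable
    show "AE x in lebesgue_on \<Omega>. norm (\<phi>_relaxed p em ep x ((norm (G v x))\<^sup>2)) \<le> norm (1 + U / 2 * (norm (G v x))\<^sup>2)"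
      using bound by (intro AE_I2) (auto intro: order_trans[OF _ abs_ge_self])
  qed
qed

lemma energy_expansion:
  assumes v: "v \<in> X" and w: "w \<in> X"
    and \<xi>: "\<And>x t. x \<in> \<Omega> \<Longrightarrow> 0 \<le> t \<Longrightarrow> 0 \<le> \<sigma> * \<xi>' p em ep x t + a"
    and \<mu>: "\<And>x t. x \<in> \<Omega> \<Longrightarrow> 0 \<le> t \<Longrightarrow> 0 \<le> \<sigma> * \<mu> p em ep x (t\<^sup>2) + a"
  shows "\<sigma> * E v + \<sigma> * F v (\<lambda>x. w x - v x) - a / 2 * (N (\<lambda>x. w x - v x))\<^sup>2 \<le> \<sigma> * E w"
proof -
  let ?\<phi> = "\<lambda>z x. \<phi>_relaxed p em ep x ((norm (G z x))\<^sup>2)"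
    and ?\<mu> = "\<lambda>x. W v x"
  have wv: "(\<lambda>x. w x - v x) \<in> X" by (rule X_diff[OF w v])
  note int = density_integrable[OF v] density_integrable[OF w] A_integrable[OF v w v] A_integrable[OF v v v]
    L2_spaceD(2)[OF L2_space_diff[OF G_L2[OF w] G_L2[OF v]]] A_integrable[OF v v w]
  have A_eq: "A v v (\<lambda>x. w x - v x) = (LINT x|lebesgue_on \<Omega>. ?\<mu> x * (G v x \<bullet> (G w x - G v x)))"
    unfolding A_commute[of v v]
    using A_cong[OF v wv v _ G_diff[OF w v]] G_measurable[OF v] G_measurable[OF w] by (simp add: inner_commute)
  have N_eq: "(N (\<lambda>x. w x - v x))\<^sup>2 = (LINT x|lebesgue_on \<Omega>. (norm (G w x - G v x))\<^sup>2)"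
    by (simp add: N_diff[OF w v] L2_norm_square)
  have int_\<mu>: "integrable (lebesgue_on \<Omega>) (\<lambda>x. ?\<mu> x * (G v x \<bullet> (G w x - G v x)))"
    unfolding inner_diff_right right_diff_distrib by (intro Bochner_Integration.integrable_diff int)
  have "\<sigma> * (LINT x|lebesgue_on \<Omega>. ?\<phi> v x) + \<sigma> * A v v (\<lambda>x. w x - v x) - a / 2 * (N (\<lambda>x. w x - v x))\<^sup>2
      = (LINT x|lebesgue_on \<Omega>. \<sigma> * ?\<phi> v x + \<sigma> * (?\<mu> x * (G v x \<bullet> (G w x - G v x)))
          - a / 2 * (norm (G w x - G v x))\<^sup>2)"
    unfolding A_eq N_eq using int(1,5) int_\<mu> by simp
  also have "\<dots> \<le> (LINT x|lebesgue_on \<Omega>. \<sigma> * ?\<phi> w x)"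
  proof (rule integral_mono)
    fix x assume "x \<in> space (lebesgue_on \<Omega>)"
    then have "x \<in> \<Omega>" by simp
    then show "\<sigma> * ?\<phi> v x + \<sigma> * (?\<mu> x * (G v x \<bullet> (G w x - G v x))) - a / 2 * (norm (G w x - G v x))\<^sup>2 \<le> \<sigma> * ?\<phi> w x"
      by (intro relaxed_density_expansion[where p=p, OF eps p_gt_1] \<xi> \<mu>)
  qed (use int int_\<mu> in auto)
  also have "\<dots> = \<sigma> * (LINT x|lebesgue_on \<Omega>. ?\<phi> w x)" by simp
  finally have "\<sigma> * (LINT x|lebesgue_on \<Omega>. ?\<phi> v x) + \<sigma> * A v v (\<lambda>x. w x - v x) - a / 2 * (N (\<lambda>x. w x - v x))\<^sup>2
      \<le> \<sigma> * (LINT x|lebesgue_on \<Omega>. ?\<phi> w x)" .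
  moreover have load_diff: "load \<Omega> f (\<lambda>x. w x - v x) = load \<Omega> f w - load \<Omega> f v"
    using load_add[OF w X_scale[OF v, of "-1"]] load_scale[of "-1" v] by simp
  ultimately show ?thesis unfolding energy_def F_op_def load_diff right_diff_distrib by linarith
qed

lemma energy_lower:
  assumes "v \<in> X" "w \<in> X"
  shows "E v + F v (\<lambda>x. w x - v x) + m / 2 * (N (\<lambda>x. w x - v x))\<^sup>2 \<le> E w"
  using energy_expansion[OF assms, of 1 "- m"] \<xi>'_bounds_\<Omega>(1) \<mu>_bounds_\<Omega>(2) by simp

lemma energy_upper:
  assumes "v \<in> X" "w \<in> X" "\<And>x t. x \<in> \<Omega> \<Longrightarrow> 0 \<le> t \<Longrightarrow> \<xi>' p em ep x t \<le> L"
  shows "E w \<le> E v + F v (\<lambda>x. w x - v x) + L / 2 * (N (\<lambda>x. w x - v x))\<^sup>2"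
  using energy_expansion[OF assms(1,2), of "-1" L] assms(3) \<mu>_le_of_\<xi>'_le[OF eps assms(3)] by simp

lemma F_strongly_monotone:
  assumes v: "v \<in> X" and w: "w \<in> X"
  shows "m * (N (\<lambda>x. v x - w x))\<^sup>2 \<le> F v (\<lambda>x. v x - w x) - F w (\<lambda>x. v x - w x)"
  using energy_lower[OF v w] energy_lower[OF w v] F_diff[OF v v w] F_diff[OF v w v] F_diff[OF w v w]
    N_diff_commute[OF v w] by simp

text \<open>
  The iteration prescribes \<open>u (Suc n)\<close> up to null sets, hence its gradient almost everywhere, hence its image
  under \<open>A (u n)\<close>.
\<close>
lemma scheme_step:
  assumes scheme: "damped_kacanov \<Omega> p em ep f X \<delta> u"
  shows "u n \<in> X" "0 < \<delta> (u n)"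
    and "w \<in> X \<Longrightarrow> A (u n) (\<lambda>x. u (Suc n) x - u n x) w = - \<delta> (u n) * F (u n) w"
proof -
  let ?v = "A_inv \<Omega> p em ep X (u n) (F (u n))" and ?h = "\<lambda>x. u (Suc n) x - u n x"
  have uX: "u k \<in> X" for k using scheme by (simp add: damped_kacanov_def)
  then show "u n \<in> X" .
  show "0 < \<delta> (u n)" using scheme by (simp add: damped_kacanov_def)
  assume w: "w \<in> X"
  have ae: "AE x in lebesgue_on \<Omega>. u (Suc n) x = u n x - \<delta> (u n) * ?v x"
    using scheme by (simp add: damped_kacanov_def)
  have hX: "?h \<in> X" by (rule X_diff[OF uX uX])
  note vX = A_inv(1)[OF uX[of n]]
  have "is_weak_gradient \<Omega> ?h (\<lambda>x. (- \<delta> (u n)) *\<^sub>R G ?v x)"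
  proof (rule weak_gradient_cong_AE[OF \<Omega>(1) weak_gradient_scale[OF H1_wgrad(2)[OF \<Omega>(1) X_H1[OF vX]]]])
    show "AE x in lebesgue_on \<Omega>. - \<delta> (u n) * ?v x = u (Suc n) x - u n x"
      using ae by eventually_elim simp
    show "locally_integrable \<Omega> ?h"
      by (rule L2_space_locally_integrable[OF lmeasurable H1_wgrad(3)[OF \<Omega>(1) X_H1[OF hX]]])
  qed
  from wgrad_AE_eq[OF \<Omega>(1) this]
  have "A (u n) ?h w = (LINT x|lebesgue_on \<Omega>. W (u n) x * (((- \<delta> (u n)) *\<^sub>R G ?v x) \<bullet> G w x))"
    using G_measurable[OF vX] by (intro A_cong[OF uX hX w]) simp_all
  also have "\<dots> = (LINT x|lebesgue_on \<Omega>. - \<delta> (u n) * (W (u n) x * (G ?v x \<bullet> G w x)))"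
    by (intro Bochner_Integration.integral_cong) (simp_all add: mult.left_commute)
  also have "\<dots> = - \<delta> (u n) * A (u n) ?v w" unfolding A_op_def by (rule integral_mult_right_zero)
  finally show "A (u n) ?h w = - \<delta> (u n) * F (u n) w" using A_inv(2)[OF uX w] by simp
qed

text \<open>
  The energy decrease and the lower bound of the energy make the increments tend to \<open>0\<close>; the scheme
  turns small increments into small residuals, and strong monotonicity turns small residuals into a
  Cauchy sequence.  The two energy expansions show that the limit is a minimiser, the only one.
\<close>
lemma convergence:
  assumes scheme: "damped_kacanov \<Omega> p em ep f X \<delta> u"
    and \<delta>: "0 < \<delta>min" "\<And>n. \<delta>min \<le> \<delta> (u n)"
    and decrease: "0 < \<gamma>" "\<And>n. \<gamma> * (N (\<lambda>x. u (Suc n) x - u n x))\<^sup>2 \<le> E (u n) - E (u (Suc n))"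
  shows "converges_to_minimiser \<Omega> X E u"
proof -
  have uX: "u n \<in> X" for n by (rule scheme_step(1)[OF scheme])
  define d where "d n = N (\<lambda>x. u (Suc n) x - u n x)" for n
  have d_nonneg: "0 \<le> d n" for n by (simp add: d_def N_nonneg)
  define C where "C = U / \<delta>min"
  have C: "0 \<le> C" using U_nonneg \<delta>(1) by (simp add: C_def)
  have d_lim: "d \<longlonglongrightarrow> 0"
  proof -
    let ?K = "U * N (u 0) + Bf"
    \<comment> \<open>The minimum over \<open>r\<close> of the lower bound \<open>E (u 0) - ?K * r + m / 2 * r\<^sup>2\<close>.\<close>
    have "E (u 0) - ?K\<^sup>2 / (2 * m) \<le> E (u n)" for n
    proof -
      let ?r = "N (\<lambda>x. u n x - u 0 x)"
      have "0 \<le> (m * ?r - ?K)\<^sup>2 / (2 * m)" using m_pos by simp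
      also have "\<dots> = m / 2 * ?r\<^sup>2 - ?K * ?r + ?K\<^sup>2 / (2 * m)"
        using m_pos by (simp add: power2_eq_square field_simps)
      finally show ?thesis
        using energy_lower[OF uX[of 0] uX[of n]] F_bound[OF uX[of 0] X_diff[OF uX[of n] uX[of 0]]]
        by (simp add: abs_le_iff)
    qed
    moreover have "decseq (\<lambda>n. E (u n))"
    proof (rule decseq_SucI)
      fix n
      have "0 \<le> \<gamma> * (N (\<lambda>x. u (Suc n) x - u n x))\<^sup>2" using decrease(1) by simp
      with decrease(2)[of n] show "E (u (Suc n)) \<le> E (u n)" by linarith
    qed
    ultimately obtain e where e: "(\<lambda>n. E (u n)) \<longlonglongrightarrow> e" by (metis decseq_convergent)
    have "(\<lambda>n. (E (u n) - E (u (Suc n))) / \<gamma>) \<longlonglongrightarrow> (e - e) / \<gamma>"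
      using e decrease(1) by (intro tendsto_intros LIMSEQ_Suc) auto
    then have lim: "(\<lambda>n. (E (u n) - E (u (Suc n))) / \<gamma>) \<longlonglongrightarrow> 0" by simp
    have "norm ((d n)\<^sup>2) \<le> (E (u n) - E (u (Suc n))) / \<gamma>" for n
      using decrease(1) decrease(2)[of n] by (simp add: d_def field_simps)
    then have "(\<lambda>n. (d n)\<^sup>2) \<longlonglongrightarrow> 0"
      by (rule Lim_null_comparison[OF always_eventually[OF allI] lim])
    then show ?thesis by simp
  qed
  have residual: "\<bar>F (u n) w\<bar> \<le> C * d n * N w" if w: "w \<in> X" for n w
  proof -
    have "\<delta>min * \<bar>F (u n) w\<bar> \<le> \<bar>\<delta> (u n) * F (u n) w\<bar>"
      using \<delta>(2)[of n] \<delta>(1) by (simp add: abs_mult mult_right_mono)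
    also have "\<dots> = \<bar>A (u n) (\<lambda>x. u (Suc n) x - u n x) w\<bar>"
      using scheme_step(3)[OF scheme w, of n] by simp
    also have "\<dots> \<le> U * d n * N w"
      unfolding d_def by (rule A_bound[OF uX X_diff[OF uX uX] w])
    finally show ?thesis using \<delta>(1) by (simp add: C_def field_simps)
  qed
  have gap: "N (\<lambda>x. u k x - u n x) \<le> C * (d k + d n) / m" for k n
  proof -
    let ?r = "N (\<lambda>x. u k x - u n x)"
    have rX: "(\<lambda>x. u k x - u n x) \<in> X" by (rule X_diff[OF uX uX])
    have "m * ?r\<^sup>2 \<le> C * d k * ?r + C * d n * ?r"
      using F_strongly_monotone[OF uX[of k] uX[of n]] residual[OF rX, of k] residual[OF rX, of n] by linarith
    then have "(m * ?r) * ?r \<le> (C * (d k + d n)) * ?r" by (simp add: power2_eq_square algebra_simps)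
    then have "m * ?r \<le> C * (d k + d n)"
      using N_nonneg[of "\<lambda>x. u k x - u n x"] C d_nonneg[of k] d_nonneg[of n]
      by (cases "?r = 0") auto
    then show ?thesis using m_pos by (simp add: field_simps)
  qed
  have "\<exists>M. \<forall>k\<ge>M. \<forall>n\<ge>M. N (\<lambda>x. u k x - u n x) < e" if e: "e > 0" for e
  proof -
    have "(\<lambda>n. C * (2 * d n) / m) \<longlonglongrightarrow> C * (2 * 0) / m"
      using d_lim m_pos by (intro tendsto_intros) auto
    then have "\<forall>\<^sub>F n in sequentially. C * (2 * d n) / m < e"
      using e by (intro order_tendstoD(2)) simp_all
    then obtain M where M: "\<And>n. n \<ge> M \<Longrightarrow> C * (2 * d n) / m < e" by (auto simp: eventually_sequentially)
    have "N (\<lambda>x. u k x - u n x) < e" if "k \<ge> M" "n \<ge> M" for k n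
    proof -
      have average: "(a + b) / 2 < e" if "a < e" "b < e" for a b :: real using that by simp
      have eq: "C * (d k + d n) / m = (C * (2 * d k) / m + C * (2 * d n) / m) / 2"
        by (simp add: add_divide_distrib distrib_left)
      show ?thesis
        by (rule le_less_trans[OF gap[of k n, unfolded eq] average[OF M[OF that(1)] M[OF that(2)]]])
    qed
    then show ?thesis by (intro exI[of _ M]) simp
  qed
  from X_complete[OF uX this] obtain v where v: "v \<in> X" "(\<lambda>n. N (\<lambda>x. u n x - v x)) \<longlonglongrightarrow> 0" by blast
  have quadratic_growth: "E v + m / 2 * (N (\<lambda>x. w x - v x))\<^sup>2 \<le> E w" if w: "w \<in> X" for w
  proof -
    have wv: "(\<lambda>x. w x - v x) \<in> X" by (rule X_diff[OF w v(1)])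
    let ?e = "\<lambda>n. N (\<lambda>x. u n x - v x)"
    have dist: "N (\<lambda>x. w x - v x) - ?e n \<le> N (\<lambda>x. w x - u n x)" for n
      using N_triangle[OF w uX v(1), of n] by linarith
    \<comment> \<open>The upper expansion from \<open>u n\<close> to \<open>v\<close> and the lower one from \<open>u n\<close> to \<open>w\<close>; only the residual in
      direction \<open>w - v\<close> survives, and it tends to \<open>0\<close>.\<close>
    have step: "E v - C * d n * N (\<lambda>x. w x - v x) - U / 2 * (?e n)\<^sup>2 + m / 2 * (N (\<lambda>x. w x - u n x))\<^sup>2 \<le> E w" for n
    proof -
      have "E v \<le> E (u n) + F (u n) (\<lambda>x. v x - u n x) + U / 2 * (?e n)\<^sup>2"
        using energy_upper[OF uX v(1) \<xi>'_bounds_\<Omega>(2), of n] N_diff_commute[OF v(1) uX, of n] by simp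
      moreover have "E (u n) + F (u n) (\<lambda>x. w x - u n x) + m / 2 * (N (\<lambda>x. w x - u n x))\<^sup>2 \<le> E w"
        by (rule energy_lower[OF uX w])
      moreover have "F (u n) (\<lambda>x. w x - u n x) - F (u n) (\<lambda>x. v x - u n x) = F (u n) (\<lambda>x. w x - v x)"
        by (simp add: F_diff[OF uX] uX w v(1))
      ultimately show ?thesis using residual[OF wv, of n] unfolding abs_le_iff by linarith
    qed
    have sq: "(\<lambda>n. (N (\<lambda>x. w x - u n x))\<^sup>2) \<longlonglongrightarrow> (N (\<lambda>x. w x - v x))\<^sup>2"
    proof (rule tendsto_power)
      have "norm (N (\<lambda>x. w x - u n x) - N (\<lambda>x. w x - v x)) \<le> ?e n" for n
        using dist[of n] N_triangle[OF w v(1) uX, of n] N_diff_commute[OF v(1) uX, of n] by (simp add: abs_le_iff)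
      then have "(\<lambda>n. N (\<lambda>x. w x - u n x) - N (\<lambda>x. w x - v x)) \<longlonglongrightarrow> 0"
        by (rule Lim_null_comparison[OF always_eventually[OF allI] v(2)])
      then show "(\<lambda>n. N (\<lambda>x. w x - u n x)) \<longlonglongrightarrow> N (\<lambda>x. w x - v x)" by (rule LIM_zero_cancel)
    qed
    have "(\<lambda>n. E v - C * d n * N (\<lambda>x. w x - v x) - U / 2 * (?e n)\<^sup>2 + m / 2 * (N (\<lambda>x. w x - u n x))\<^sup>2)
        \<longlonglongrightarrow> E v - C * 0 * N (\<lambda>x. w x - v x) - U / 2 * 0\<^sup>2 + m / 2 * (N (\<lambda>x. w x - v x))\<^sup>2"
      by (intro sq tendsto_add tendsto_diff tendsto_mult tendsto_const tendsto_power d_lim v(2))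
    then have "E v - C * 0 * N (\<lambda>x. w x - v x) - U / 2 * 0\<^sup>2 + m / 2 * (N (\<lambda>x. w x - v x))\<^sup>2 \<le> E w"
      by (rule LIMSEQ_le_const2) (use step in blast)
    then show ?thesis by simp
  qed
  have min: "is_minimiser X E v"
    unfolding is_minimiser_def
  proof (intro conjI ballI v(1))
    fix w assume w: "w \<in> X"
    have "0 \<le> m / 2 * (N (\<lambda>x. w x - v x))\<^sup>2" using m_pos by simp
    with quadratic_growth[OF w] show "E v \<le> E w" by linarith
  qed
  moreover have "AE x in lebesgue_on \<Omega>. w x = v x" if w: "is_minimiser X E w" for w
  proof -
    have wX: "w \<in> X" and le: "E w \<le> E v" using w v(1) by (auto simp: is_minimiser_def)
    have wv: "(\<lambda>x. w x - v x) \<in> X" by (rule X_diff[OF wX v(1)])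
    have "m / 2 * (N (\<lambda>x. w x - v x))\<^sup>2 \<le> 0" using quadratic_growth[OF wX] le by linarith
    then have N0: "N (\<lambda>x. w x - v x) = 0" using m_pos by (simp add: mult_le_0_iff)
    obtain Cp where "\<And>u. u \<in> H10 \<Omega> \<Longrightarrow> L2_norm \<Omega> u \<le> Cp * N u"
      using poincare_H10[OF \<Omega> dim] by blast
    from this[OF X_H10[OF wv]] have "L2_norm \<Omega> (\<lambda>x. w x - v x) \<le> 0" by (simp add: N0)
    then have "L2_norm \<Omega> (\<lambda>x. w x - v x) = 0" by (simp add: order_antisym)
    then have "(LINT x|lebesgue_on \<Omega>. (norm (w x - v x))\<^sup>2) = 0"
      using L2_norm_square[of \<Omega> "\<lambda>x. w x - v x"] by simp
    then have "AE x in lebesgue_on \<Omega>. (norm (w x - v x))\<^sup>2 = 0"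
      using integral_nonneg_eq_0_iff_AE[OF L2_spaceD(2)[OF H1_wgrad(3)[OF \<Omega>(1) X_H1[OF wv]]]] by simp
    then show ?thesis by eventually_elim simp
  qed
  ultimately have "is_unique_minimiser \<Omega> X E v" by (simp add: is_unique_minimiser_def)
  with v(2) show ?thesis unfolding converges_to_minimiser_def by blast
qed

text \<open>
  Testing the scheme with the increment \<open>h\<close> gives \<open>F (u n) h = - A (u n) h h / \<delta>\<close>, which is at most
  \<open>- \<mu>_minus / \<delta>max * (N h)\<^sup>2\<close>, while the energy lies above its tangent by at most \<open>\<xi>'_plus / 2 * (N h)\<^sup>2\<close>.
  The bound on \<open>\<delta>max\<close> makes the first quantity the larger one.
\<close>
lemma step_size_bound_implies_decrease:
  assumes scheme: "damped_kacanov \<Omega> p em ep f X \<delta> u"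
    and \<delta>: "0 < \<delta>min" "\<And>n. \<delta>min \<le> \<delta> (u n)" "\<And>n. \<delta> (u n) \<le> \<delta>max"
    and \<delta>max: "\<delta>max < 2 * \<mu>_minus \<Omega> p em ep / (sqrt 3 * \<xi>'_plus \<Omega> p em ep)"
  shows "\<exists>\<gamma>>0. \<forall>n. \<gamma> * (N (\<lambda>x. u (Suc n) x - u n x))\<^sup>2 \<le> E (u n) - E (u (Suc n))"
proof -
  define L where "L = \<xi>'_plus \<Omega> p em ep"
  have \<xi>_le: "\<xi>' p em ep x t \<le> L" if "x \<in> \<Omega>" "0 \<le> t" for x t
  proof -
    have "bdd_above ((\<lambda>(x, t). \<xi>' p em ep x t) ` (\<Omega> \<times> {0..}))"
      using \<xi>'_bounds_\<Omega>(2) by (auto simp: bdd_above_def)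
    from cSUP_upper[OF _ this, of "(x, t)"] that show ?thesis by (simp add: L_def \<xi>'_plus_def)
  qed
  have \<delta>max_pos: "0 < \<delta>max" using \<delta>(1) \<delta>(2)[of 0] \<delta>(3)[of 0] by linarith
  define \<gamma> where "\<gamma> = \<mu>_minus \<Omega> p em ep / \<delta>max - L / 2"
  have "\<gamma> > 0"
  proof -
    have pos: "0 < 2 * \<mu>_minus \<Omega> p em ep / (sqrt 3 * L)" using \<delta>max \<delta>max_pos by (simp add: L_def)
    then have L: "L > 0" using \<mu>_minus_pos by (simp add: zero_less_divide_iff zero_less_mult_iff)
    have "\<delta>max * L < \<delta>max * (sqrt 3 * L)" using L \<delta>max_pos by simp
    also have "\<dots> < 2 * \<mu>_minus \<Omega> p em ep" using \<delta>max L by (simp add: L_def[symmetric] pos_less_divide_eq)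
    finally show ?thesis using \<delta>max_pos by (simp add: \<gamma>_def field_simps)
  qed
  moreover have "\<gamma> * (N (\<lambda>x. u (Suc n) x - u n x))\<^sup>2 \<le> E (u n) - E (u (Suc n))" for n
  proof -
    let ?h = "\<lambda>x. u (Suc n) x - u n x"
    have uX: "u k \<in> X" for k by (rule scheme_step(1)[OF scheme])
    have hX: "?h \<in> X" by (rule X_diff[OF uX uX])
    have \<delta>n: "0 < \<delta> (u n)" by (rule scheme_step(2)[OF scheme])
    have A_nonneg: "\<mu>_minus \<Omega> p em ep * (N ?h)\<^sup>2 \<le> A (u n) ?h ?h" "0 \<le> \<mu>_minus \<Omega> p em ep * (N ?h)\<^sup>2"
      using A_coercive[OF uX hX] \<mu>_minus_pos by simp_all
    have "\<mu>_minus \<Omega> p em ep / \<delta>max * (N ?h)\<^sup>2 = \<mu>_minus \<Omega> p em ep * (N ?h)\<^sup>2 / \<delta>max" by simp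
    also have "\<dots> \<le> A (u n) ?h ?h / \<delta> (u n)"
      using A_nonneg \<delta>(3)[of n] \<delta>n by (intro frac_le) auto
    also have "\<dots> = - F (u n) ?h"
      using scheme_step(3)[OF scheme hX, of n] \<delta>n by simp
    finally show ?thesis
      using energy_upper[OF uX[of n] uX[of "Suc n"] \<xi>_le] by (simp add: \<gamma>_def left_diff_distrib)
  qed
  ultimately show ?thesis by blast
qed

end

section \<open>The convergence theorem\<close>

text \<open>
  In the plane every exponent \<open>2 m\<close> is a Sobolev exponent, so \<open>m\<close> can be chosen large enough for the
  conjugate exponent to fall below the lower bound of \<open>\<alpha>\<close>; in space \<open>m = 3\<close> has conjugate exponent \<open>6/5\<close>.
\<close>
lemma load_continuous:
  fixes \<Omega> :: "'a::euclidean_space set"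
  assumes \<Omega>: "open \<Omega>" "bounded \<Omega>" and dim: "DIM('a) = 2 \<or> DIM('a) = 3"
    and \<alpha>: "\<alpha> \<in> C_plus (closure \<Omega>)" "DIM('a) = 3 \<Longrightarrow> 6 / 5 \<le> (INF x\<in>closure \<Omega>. \<alpha> x)"
    and f: "f \<in> L_var \<Omega> \<alpha>"
  obtains B where "\<And>v. v \<in> H10 \<Omega> \<Longrightarrow> integrable (lebesgue_on \<Omega>) (\<lambda>x. f x * v x)"
    "\<And>v. v \<in> H10 \<Omega> \<Longrightarrow> \<bar>load \<Omega> f v\<bar> \<le> B * H10_norm \<Omega> v"
proof -
  define a where "a = (INF x\<in>closure \<Omega>. \<alpha> x)"
  have a: "1 < a" using \<alpha>(1) by (simp add: C_plus_def a_def)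
  have "bounded (\<alpha> ` closure \<Omega>)"
    using \<alpha>(1) \<Omega>(2) by (intro compact_imp_bounded compact_continuous_image) (auto simp: C_plus_def compact_closure)
  then have "bdd_below (\<alpha> ` closure \<Omega>)" by (rule bounded_imp_bdd_below)
  then have \<alpha>_ge: "a \<le> \<alpha> x" if "x \<in> \<Omega>" for x
    unfolding a_def using that closure_subset[of \<Omega>] by (intro cINF_lower) auto
  obtain k :: nat where k: "k > 0" "DIM('a) = 2 \<or> DIM('a) = 3 \<and> k = 3" "2 * real k / (2 * real k - 1) \<le> a"
  proof (cases "DIM('a) = 3")
    case True
    then show thesis using \<alpha>(2) by (intro that[of 3]) (simp_all add: a_def)
  next
    case False
    obtain k :: nat where k: "a / (2 * (a - 1)) < real k" using reals_Archimedean2 by blast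
    then have "a < real k * (2 * (a - 1))" using a by (simp add: pos_divide_less_eq)
    then have *: "2 * real k < a * (2 * real k - 1)" by (simp add: algebra_simps)
    have "0 < a / (2 * (a - 1))" using a by simp
    with k have "0 < real k" by linarith
    then have "k > 0" "2 * real k - 1 > 0" by auto
    with * False dim show thesis by (intro that[of k]) (simp_all add: pos_divide_le_eq)
  qed
  have "2 * real k / (2 * real k - 1) \<le> \<alpha> x" if "x \<in> \<Omega>" for x
    using k(3) \<alpha>_ge[OF that] by linarith
  then show thesis by (rule load_bound[OF \<Omega> k(2,1) f]) (assumption, rule that)
qed

theorem theorem3p2:
  fixes \<Omega> :: "(real ^ 'd::finite) set"
    and p \<alpha> f :: "real ^ 'd \<Rightarrow> real"
    and em ep :: real
    and X :: "(real ^ 'd \<Rightarrow> real) set"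
    and \<delta> :: "(real ^ 'd \<Rightarrow> real) \<Rightarrow> real"
    and u :: "nat \<Rightarrow> real ^ 'd \<Rightarrow> real"
  assumes dim: "CARD('d) \<in> {2, 3}"
    and domain: "open \<Omega>" "bounded \<Omega>" "lipschitz_boundary \<Omega>"
    and exponent: "p \<in> C_plus (closure \<Omega>)"
    and source_exponent: "\<alpha> \<in> C_plus (closure \<Omega>)"
      "CARD('d) = 2 \<Longrightarrow> (INF x\<in>closure \<Omega>. \<alpha> x) > 1"
      "CARD('d) = 3 \<Longrightarrow> (INF x\<in>closure \<Omega>. \<alpha> x) \<ge> 6 / 5"
    and source: "f \<in> L_var \<Omega> \<alpha>"
    and eps: "0 < em" "em < 1" "1 < ep"
    and subspace: "closed_subspace_H10 \<Omega> X"
    and scheme: "damped_kacanov \<Omega> p em ep f X \<delta> u"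
  shows
    "((\<exists>\<delta>min>0. \<forall>n. \<delta> (u n) \<ge> \<delta>min) \<and>
      (\<exists>\<gamma>>0. \<forall>n. energy \<Omega> p em ep f (u n) - energy \<Omega> p em ep f (u (Suc n))
         \<ge> \<gamma> * (H10_norm \<Omega> (\<lambda>x. u (Suc n) x - u n x))\<^sup>2)
      \<longrightarrow> converges_to_minimiser \<Omega> X (energy \<Omega> p em ep f) u) \<and>
     ((\<exists>\<delta>min \<delta>max. 0 < \<delta>min \<and> (\<forall>n. \<delta>min \<le> \<delta> (u n) \<and> \<delta> (u n) \<le> \<delta>max) \<and>
         \<delta>max < 2 * \<mu>_minus \<Omega> p em ep / (sqrt 3 * \<xi>'_plus \<Omega> p em ep))
      \<longrightarrow> converges_to_minimiser \<Omega> X (energy \<Omega> p em ep f) u)"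
proof -
  have DIM: "DIM(real ^ 'd) = 2 \<or> DIM(real ^ 'd) = 3" using dim by auto
  obtain B where B: "\<And>v. v \<in> H10 \<Omega> \<Longrightarrow> integrable (lebesgue_on \<Omega>) (\<lambda>x. f x * v x)"
    "\<And>v. v \<in> H10 \<Omega> \<Longrightarrow> \<bar>load \<Omega> f v\<bar> \<le> B * H10_norm \<Omega> v"
    by (rule load_continuous[OF domain(1,2) DIM source_exponent(1) _ source])
      (use source_exponent(3) in simp, rule that)
  interpret relaxed_problem \<Omega> p f em ep B X
    using DIM domain exponent eps subspace B by unfold_locales
  show ?thesis
  proof (intro conjI impI; elim conjE exE)
    fix \<delta>min \<gamma>
    assume "0 < \<delta>min" "\<forall>n. \<delta>min \<le> \<delta> (u n)" "0 < \<gamma>"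
      "\<forall>n. \<gamma> * (H10_norm \<Omega> (\<lambda>x. u (Suc n) x - u n x))\<^sup>2
        \<le> energy \<Omega> p em ep f (u n) - energy \<Omega> p em ep f (u (Suc n))"
    then show "converges_to_minimiser \<Omega> X (energy \<Omega> p em ep f) u"
      by (intro convergence[OF scheme, of \<delta>min \<gamma>]) auto
  next
    fix \<delta>min \<delta>max
    assume \<delta>: "0 < \<delta>min" "\<forall>n. \<delta>min \<le> \<delta> (u n) \<and> \<delta> (u n) \<le> \<delta>max"
      "\<delta>max < 2 * \<mu>_minus \<Omega> p em ep / (sqrt 3 * \<xi>'_plus \<Omega> p em ep)"
    then obtain \<gamma> where "0 < \<gamma>" "\<And>n. \<gamma> * (H10_norm \<Omega> (\<lambda>x. u (Suc n) x - u n x))\<^sup>2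
        \<le> energy \<Omega> p em ep f (u n) - energy \<Omega> p em ep f (u (Suc n))"
      using step_size_bound_implies_decrease[OF scheme] by blast
    with \<delta> show "converges_to_minimiser \<Omega> X (energy \<Omega> p em ep f) u"
      by (intro convergence[OF scheme, of \<delta>min \<gamma>]) auto
  qed
qed

end
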